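(* Let the observations be $y_t=u_t+z_t^{\gamma_n}\xi_t$, $t=1-p,\dots,n$, as described in the context. Let $\hat{\bm\beta}_n^y=(\hat\beta^y_{1n},\dots,\hat\beta^y_{pn})^T$ be an estimator of $\bm\beta$ based on $y_{1-p},\dots,y_n$, define residuals $\hat\varepsilon_t^y=y_t-\hat\beta^y_{1n}y_{t-1}-\dots-\hat\beta^y_{pn}y_{t-p}$, $t=1,\dots,n$. Fix $m\ge1$ and points $0=x_0<x_1<\dots<x_m=\infty$ with $p_j^+:=P(x_j)-P(x_{j-1})>0$, $j=1,\dots,m$. Let $B_j^+=(x_{j-1},x_j]$, $B_j^-=(-x_j,-x_{j-1}]$ (with $B_m^+=(x_{m-1},\infty)$, $B_m^-=(-\infty,-x_{m-1}]$), let $\hat\nu_j^{\pm}$ be the number of residuals $\hat\varepsilon_1^y,\dots,\hat\varepsilon_n^y$ lying in $B_j^{\pm}$, and $$\hat\chi_n^2=\sum_{j=1}^m\frac{(\hat\nu_j^+-\hat\nu_j^-)^2}{2\hat\nu_j^+}.$$ Let $F_m(x,\lambda^2)$ denote the d.f. of the noncentral chi-square distribution with $m$ degrees of freedom and noncentrality parameter $\lambda^2$, and $|\cdot|$ the Euclidean norm. Fix arbitrary finite $R\ge0$, $\Gamma\ge0$. 1. Suppose the hypothesis $\mathbb S$ holds (i.e. $\rho=0$, innovation d.f. $P$ symmetric about zero), $P$ has zero mean and finite variance and is twice differentiable with bounded second derivative, and Condition (iv) holds with $\rho=0$. Then $$\sup_{x\in\mathbb R,\ \gamma\le\Gamma}\big|\mathbb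 P(\hat\chi_n^2\le x)-F_m(x,\lambda^2)\big|\to0,\quad n\to\infty,$$ where $\lambda^2=\gamma^2\,|\mathcal P^{-1/2}\bm\delta(\Pi)|^2$. 2. Suppose the alternative $\mathbb A_n(\rho)$ holds with $\rho>0$, and Conditions (i), (ii), (iv) hold. Then $$\sup_{x\in\mathbb R,\ \gamma\le\Gamma,\ \rho\le R}\big|\mathbb P(\hat\chi_n^2\le x)-F_m(x,\lambda^2)\big|\to0,\quad n\to\infty,$$ where $$\lambda^2=\big|\mathcal P^{-1/2}\,[\rho(\bm q^+-\bm q^-)+\gamma\,\bm\delta(\Pi)]\big|^2.$$
   Context: $AR(p)$ model: $u_t=\beta_1u_{t-1}+\dots+\beta_pu_{t-p}+\varepsilon_t$, $t\in\mathbb Z$, with known order $p$, unknown $\bm\beta=(\beta_1,\dots,\beta_p)^T$ such that all roots of $z^p-\beta_1z^{p-1}-\dots-\beta_p=0$ lie inside the unit disk, and i.i.d. innovations $\{\varepsilon_t\}$ with mean $0$, finite positive variance and d.f. $G$; $\{u_t\}$ is the stationary solution. Contaminated observations: $y_t=u_t+z_t^{\gamma_n}\xi_t$, $t=1-p,\dots,n$, where $\{z_t^{\gamma_n}\}$ are i.i.d. Bernoulli with success probability $\gamma_n=\min\{1,\gamma n^{-1/2}\}$, $\gamma\ge0$ unknown; $\{\xi_t\}$ are i.i.d. with an arbitrary unknown distribution $\Pi$ (gross errors); the sequences $\{u_t\},\{z_t^{\gamma_n}\},\{\xi_t\}$ are independent. Local alternatives: for $\rho\ge0$, $\mathbb A_n(\rho)$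 means $G(x)=A_n(x):=(1-\rho_n)P(x)+\rho_nQ(x)$ with $\rho_n=\min\{1,\rho n^{-1/2}\}$, $P$ an unknown d.f. symmetric about zero, $Q$ an unknown non-symmetric d.f.; $\rho=0$ is the symmetry hypothesis $\mathbb S$: $\varepsilon_1\overset{d}{=}-\varepsilon_1$. Condition (i): $P$ and $Q$ have zero means and finite variances. Condition (ii): $P$ and $Q$ are twice differentiable with bounded second derivatives. Condition (iv): under $\mathbb A_n(\rho)$, $n^{1/2}(\hat{\bm\beta}^y_n-\bm\beta)=O_P(1)$ as $n\to\infty$, uniformly in $\rho\le R$, $\gamma\le\Gamma$ (for all finite $R,\Gamma\ge0$). Notation: $\Delta(x,\Pi)=\sum_{j=0}^p[\mathbb E\,P(x+\beta_j\xi_1)-P(x)]$ with $\beta_0=-1$; $\delta_j(\Pi)=\Delta(x_j,\Pi)-\Delta(x_{j-1},\Pi)-[\Delta(-x_{j-1},\Pi)-\Delta(-x_j,\Pi)]$, $\bm\delta(\Pi)=(\delta_1(\Pi),\dots,\delta_m(\Pi))^T$; $q_j^+=Q(x_j)-Q(x_{j-1})$, $q_j^-=Q(-x_{j-1})-Q(-x_j)$, $\bm q^{\pm}=(q_1^\pm,\dots,q_m^\pm)^T$; $\mathcal P=\mathrm{diag}\{2p_1^+,\dots,2p_m^+\}$. *)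

theory Defs
  imports "HOL-Probability.Probability"
begin

definition is_real_distr :: "real measure \<Rightarrow> bool" where
  "is_real_distr D \<longleftrightarrow> prob_space D \<and> sets D = sets borel"

definition symmetric_distr :: "real measure \<Rightarrow> bool" where
  "symmetric_distr D \<longleftrightarrow> distr D borel uminus = D"

definition zero_mean_finite_var :: "real measure \<Rightarrow> bool" where
  "zero_mean_finite_var D \<longleftrightarrow>
     integrable D (\<lambda>x. x) \<and> (\<integral>x. x \<partial>D) = 0 \<and> integrable D (\<lambda>x. x\<^sup>2)"

definition twice_diff_bounded :: "real measure \<Rightarrow> bool" where
  "twice_diff_bounded D \<longleftrightarrow>
     (\<exists>f f' B. \<forall>x. (cdf D has_real_derivative f x) (at x)
                \<and> (f has_real_derivative f' x) (at x) \<and> \<bar>f' x\<bar> \<le> B)"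

definition mix_distr :: "real \<Rightarrow> real measure \<Rightarrow> real measure \<Rightarrow> real measure" where
  "mix_distr r P Q = measure_of UNIV (sets borel)
     (\<lambda>A. ennreal ((1 - r) * measure P A + r * measure Q A))"

definition rate :: "real \<Rightarrow> nat \<Rightarrow> real" where
  "rate c n = min 1 (c / sqrt (real n))"

definition causal_coeffs :: "nat \<Rightarrow> (nat \<Rightarrow> real) \<Rightarrow> bool" where
  "causal_coeffs p \<beta> \<longleftrightarrow>
     (\<forall>w::complex. w ^ p - (\<Sum>i=1..p. complex_of_real (\<beta> i) * w ^ (p - i)) = 0 \<longrightarrow> cmod w < 1)"

definition strictly_stationary :: "'a measure \<Rightarrow> (int \<Rightarrow> 'a \<Rightarrow> real) \<Rightarrow> bool" where
  "strictly_stationary M u \<longleftrightarrow>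
     (\<forall>t k. distr M (PiM {..<k} (\<lambda>_. borel)) (\<lambda>\<omega>. \<lambda>i\<in>{..<k}. u (t + int i) \<omega>)
          = distr M (PiM {..<k} (\<lambda>_. borel)) (\<lambda>\<omega>. \<lambda>i\<in>{..<k}. u (int i) \<omega>))"

definition AR_contam_model ::
  "nat \<Rightarrow> (nat \<Rightarrow> real) \<Rightarrow> real measure \<Rightarrow> real measure \<Rightarrow> real \<Rightarrow> 'a measure \<Rightarrow>
   (int \<Rightarrow> 'a \<Rightarrow> real) \<Rightarrow> (int \<Rightarrow> 'a \<Rightarrow> real) \<Rightarrow> (int \<Rightarrow> 'a \<Rightarrow> real) \<Rightarrow>
   (int \<Rightarrow> 'a \<Rightarrow> real) \<Rightarrow> bool" where
  "AR_contam_model p \<beta> G GE g M eps z xi u \<longleftrightarrow>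
     prob_space M \<and>
     is_real_distr G \<and> zero_mean_finite_var G \<and> (\<integral>x. x\<^sup>2 \<partial>G) > 0 \<and>
     is_real_distr GE \<and>
     prob_space.indep_vars M (\<lambda>_. borel)
       (\<lambda>k. case k of Inl t \<Rightarrow> eps t | Inr (Inl t) \<Rightarrow> z t | Inr (Inr t) \<Rightarrow> xi t) UNIV \<and>
     (\<forall>t. distr M borel (eps t) = G) \<and>
     (\<forall>t. distr M borel (xi t) = GE) \<and>
     (\<forall>t. \<forall>\<omega>\<in>space M. z t \<omega> \<in> {0, 1}) \<and>
     (\<forall>t. measure M {\<omega>\<in>space M. z t \<omega> = 1} = g) \<and>
     (\<forall>t. u t \<in> borel_measurable M) \<and>
     (\<forall>t. \<forall>\<omega>\<in>space M. u t \<omega> = (\<Sum>i=1..p. \<beta> i * u (t - int i) \<omega>) + eps t \<omega>) \<and>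
     strictly_stationary M u"

definition yobs :: "(int \<Rightarrow> 'a \<Rightarrow> real) \<Rightarrow> (int \<Rightarrow> 'a \<Rightarrow> real) \<Rightarrow> (int \<Rightarrow> 'a \<Rightarrow> real) \<Rightarrow> int \<Rightarrow> 'a \<Rightarrow> real" where
  "yobs u z xi t \<omega> = u t \<omega> + z t \<omega> * xi t \<omega>"

definition est_of :: "nat \<Rightarrow> nat \<Rightarrow> (nat \<Rightarrow> (int \<Rightarrow> real) \<Rightarrow> nat \<Rightarrow> real) \<Rightarrow> (int \<Rightarrow> real) \<Rightarrow> nat \<Rightarrow> real" where
  "est_of p n est y = est n (restrict y {1 - int p..int n})"

text \<open>Cells; x :: nat => real gives x_0,...,x_{m-1}, and x_m = infinity.\<close>
definition bin_plus :: "(nat \<Rightarrow> real) \<Rightarrow> nat \<Rightarrow> nat \<Rightarrow> real set" where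
  "bin_plus x m j = (if j = m then {x (m - 1)<..} else {x (j - 1)<..x j})"

definition bin_minus :: "(nat \<Rightarrow> real) \<Rightarrow> nat \<Rightarrow> nat \<Rightarrow> real set" where
  "bin_minus x m j = (if j = m then {..- x (m - 1)} else {- x j<..- x (j - 1)})"

definition residual :: "nat \<Rightarrow> (nat \<Rightarrow> real) \<Rightarrow> (int \<Rightarrow> real) \<Rightarrow> int \<Rightarrow> real" where
  "residual p bh y t = y t - (\<Sum>i=1..p. bh i * y (t - int i))"

definition chi2_stat :: "nat \<Rightarrow> nat \<Rightarrow> (nat \<Rightarrow> real) \<Rightarrow> nat \<Rightarrow> (nat \<Rightarrow> real) \<Rightarrow> (int \<Rightarrow> real) \<Rightarrow> real" where
  "chi2_stat p m x n bh y =
     (\<Sum>j=1..m.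
        let nup = real (card {t\<in>{1..int n}. residual p bh y t \<in> bin_plus x m j});
            num = real (card {t\<in>{1..int n}. residual p bh y t \<in> bin_minus x m j})
        in (nup - num)\<^sup>2 / (2 * nup))"

text \<open>F_m(x, lambda2) = P(sum_{i<m} (Z_i + mu_i)^2 <= x), Z_i iid N(0,1), |mu|^2 = lambda2.\<close>
definition ncchisq_cdf :: "nat \<Rightarrow> real \<Rightarrow> real \<Rightarrow> real" where
  "ncchisq_cdf m lam2 x =
     measure (PiM {..<m} (\<lambda>_. density lborel std_normal_density))
       {v \<in> space (PiM {..<m} (\<lambda>_. density lborel std_normal_density)).
          (\<Sum>i<m. (v i + (if i = 0 then sqrt lam2 else 0))\<^sup>2) \<le> x}"

definition Delta :: "nat \<Rightarrow> (nat \<Rightarrow> real) \<Rightarrow> real measure \<Rightarrow> real measure \<Rightarrow> real \<Rightarrow> real" where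
  "Delta p \<beta> P GE x =
     (\<Sum>j=0..p. (\<integral>s. cdf P (x + (if j = 0 then -1 else \<beta> j) * s) \<partial>GE) - cdf P x)"

text \<open>delta_j(GE); for j = m we use Delta(+-infinity, GE) = 0 (limit value).\<close>
definition delta_j :: "nat \<Rightarrow> (nat \<Rightarrow> real) \<Rightarrow> real measure \<Rightarrow> real measure \<Rightarrow> (nat \<Rightarrow> real) \<Rightarrow> nat \<Rightarrow> nat \<Rightarrow> real" where
  "delta_j p \<beta> P GE x m j =
     (if j = m then
        (0 - Delta p \<beta> P GE (x (m - 1))) - (Delta p \<beta> P GE (- x (m - 1)) - 0)
      else
        (Delta p \<beta> P GE (x j) - Delta p \<beta> P GE (x (j - 1)))
        - (Delta p \<beta> P GE (- x (j - 1)) - Delta p \<beta> P GE (- x j)))"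

end

theory Submission
  imports Defs "HOL-Complex_Analysis.Complex_Analysis"
begin

text \<open>
  If the convergence were not uniform in \<open>\<gamma>\<close> and \<open>\<rho>\<close>, it would fail along sample sizes \<open>n\<close> tending to
  infinity and convergent \<open>\<gamma>\<close>, \<open>\<rho>\<close>. Along such a sequence a residual lies below \<open>y\<close> iff the innovation
  \<open>\<epsilon>\<^sub>t\<close> lies below a threshold that depends on the past of the innovations and on the contamination only.
  Hence the residual counts minus the innovation counts split into a martingale, which is negligible because
  the thresholds are close to \<open>y\<close>, and a compensator, whose Taylor expansion leaves \<open>\<gamma> \<Delta>(y, \<Pi>)\<close>: the term
  linear in the estimation error carries the factor \<open>n\<^sup>-\<^sup>1 \<Sum> u\<^sub>t\<close>, which tends to 0. A finite net makes this
  uniform in the estimator.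

  Thus the normalised count differences are, up to \<open>o\<^sub>P(1)\<close>, sums of independent vectors plus a shift. Their
  characteristic functions converge to that of a shifted Gaussian vector; averaging over a Gaussian argument
  gives the Laplace transform of the squared norm, which determines the limit law. As its distribution
  function is continuous, the convergence is uniform in \<open>y\<close>.
\<close>

section \<open>Bounds in mean\<close>

definition L1_bound :: "'a measure \<Rightarrow> ('a \<Rightarrow> real) \<Rightarrow> real \<Rightarrow> bool" where
  "L1_bound M X c \<longleftrightarrow> integrable M X \<and> (\<integral>\<omega>. \<bar>X \<omega>\<bar> \<partial>M) \<le> c"

lemma L1_bound_integrable: "L1_bound M X c \<Longrightarrow> integrable M X"
  by (simp add: L1_bound_def)

lemma L1_bound_weaken: "L1_bound M X c \<Longrightarrow> c \<le> d \<Longrightarrow> L1_bound M X d"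
  by (simp add: L1_bound_def)

lemma L1_bound_abs: "L1_bound M X c \<Longrightarrow> L1_bound M (\<lambda>\<omega>. \<bar>X \<omega>\<bar>) c"
  by (simp add: L1_bound_def)

lemma L1_bound_dominated_AE:
  assumes "X \<in> borel_measurable M" "AE \<omega> in M. \<bar>X \<omega>\<bar> \<le> Y \<omega>" "L1_bound M Y c"
  shows "L1_bound M X c"
proof -
  have Y: "integrable M Y" "(\<integral>\<omega>. \<bar>Y \<omega>\<bar> \<partial>M) \<le> c" using assms(3) by (auto simp: L1_bound_def)
  have abs_le: "AE \<omega> in M. \<bar>X \<omega>\<bar> \<le> \<bar>Y \<omega>\<bar>" using assms(2) by eventually_elim linarith
  have X: "integrable M X"
    by (rule Bochner_Integration.integrable_bound[OF Y(1) assms(1)]) (use abs_le in simp)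
  have "(\<integral>\<omega>. \<bar>X \<omega>\<bar> \<partial>M) \<le> (\<integral>\<omega>. \<bar>Y \<omega>\<bar> \<partial>M)"
    by (intro integral_mono_AE integrable_abs X Y abs_le)
  with X Y show ?thesis by (auto simp: L1_bound_def)
qed

lemma L1_bound_dominated:
  assumes "X \<in> borel_measurable M" "\<And>\<omega>. \<omega> \<in> space M \<Longrightarrow> \<bar>X \<omega>\<bar> \<le> Y \<omega>" "L1_bound M Y c"
  shows "L1_bound M X c"
  using assms by (intro L1_bound_dominated_AE[OF assms(1) _ assms(3)] AE_I2)

lemma L1_bound_add:
  assumes "L1_bound M X c" "L1_bound M Y d"
  shows "L1_bound M (\<lambda>\<omega>. X \<omega> + Y \<omega>) (c + d)"
proof -
  have integrable: "integrable M X" "integrable M Y" using assms by (auto simp: L1_bound_def)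
  have "(\<integral>\<omega>. \<bar>X \<omega> + Y \<omega>\<bar> \<partial>M) \<le> (\<integral>\<omega>. \<bar>X \<omega>\<bar> + \<bar>Y \<omega>\<bar> \<partial>M)"
    using integrable by (intro integral_mono abs_triangle_ineq) auto
  also have "\<dots> \<le> c + d" using assms integrable by (simp add: L1_bound_def)
  finally show ?thesis using integrable by (simp add: L1_bound_def)
qed

lemma L1_bound_cmult:
  assumes "L1_bound M X c"
  shows "L1_bound M (\<lambda>\<omega>. a * X \<omega>) (\<bar>a\<bar> * c)"
  using assms by (auto simp: L1_bound_def abs_mult intro: mult_left_mono)

lemma L1_bound_divide:
  assumes "L1_bound M X c" "0 < a"
  shows "L1_bound M (\<lambda>\<omega>. X \<omega> / a) (c / a)"
  using L1_bound_cmult[OF assms(1), of "1 / a"] assms(2) by simp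

lemma L1_bound_sum:
  assumes "\<And>i. i \<in> I \<Longrightarrow> L1_bound M (X i) (c i)"
  shows "L1_bound M (\<lambda>\<omega>. \<Sum>i\<in>I. X i \<omega>) (\<Sum>i\<in>I. c i)"
  using assms
proof (induction I rule: infinite_finite_induct)
  case (insert i I)
  then show ?case by (simp add: L1_bound_add)
qed (simp_all add: L1_bound_def)

context prob_space
begin

lemma bounded_integrable:
  fixes X :: "'a \<Rightarrow> 'b::{banach, second_countable_topology}"
  assumes "X \<in> borel_measurable M" "\<And>\<omega>. \<omega> \<in> space M \<Longrightarrow> norm (X \<omega>) \<le> c"
  shows "integrable M X"
  using assms by (intro integrable_const_bound[of _ c]) (auto intro!: AE_I2)

lemma L1_bound_of_second_moment:
  fixes X :: "'a \<Rightarrow> real"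
  assumes X[measurable]: "X \<in> borel_measurable M" and square_integrable: "integrable M (\<lambda>\<omega>. (X \<omega>)\<^sup>2)"
    and second_moment_le: "expectation (\<lambda>\<omega>. (X \<omega>)\<^sup>2) \<le> q"
  shows "L1_bound M X (sqrt q)"
proof -
  have integrable_X: "integrable M X"
    by (rule square_integrable_imp_integrable[OF X square_integrable])
  have "0 \<le> variance (\<lambda>\<omega>. \<bar>X \<omega>\<bar>)" by simp
  also have "\<dots> = expectation (\<lambda>\<omega>. (X \<omega>)\<^sup>2) - (expectation (\<lambda>\<omega>. \<bar>X \<omega>\<bar>))\<^sup>2"
    using integrable_X square_integrable by (subst variance_eq) auto
  finally have "expectation (\<lambda>\<omega>. \<bar>X \<omega>\<bar>) \<le> sqrt q"
    using second_moment_le by (intro real_le_rsqrt) simp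
  with integrable_X show ?thesis by (simp add: L1_bound_def)
qed

lemma square_integrable_mult:
  fixes X Y :: "'a \<Rightarrow> real"
  assumes [measurable]: "X \<in> borel_measurable M" "Y \<in> borel_measurable M"
    and "integrable M (\<lambda>\<omega>. (X \<omega>)\<^sup>2)" "integrable M (\<lambda>\<omega>. (Y \<omega>)\<^sup>2)"
  shows "integrable M (\<lambda>\<omega>. X \<omega> * Y \<omega>)"
proof (rule Bochner_Integration.integrable_bound)
  show "integrable M (\<lambda>\<omega>. (X \<omega>)\<^sup>2 + (Y \<omega>)\<^sup>2)" using assms by auto
  have "\<bar>X \<omega> * Y \<omega>\<bar> \<le> (X \<omega>)\<^sup>2 + (Y \<omega>)\<^sup>2" for \<omega>
    using sum_squares_bound[of "\<bar>X \<omega>\<bar>" "\<bar>Y \<omega>\<bar>"] zero_le_power2[of "X \<omega>"] zero_le_power2[of "Y \<omega>"]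
    by (simp only: abs_mult power2_abs)
  then show "AE \<omega> in M. norm (X \<omega> * Y \<omega>) \<le> norm ((X \<omega>)\<^sup>2 + (Y \<omega>)\<^sup>2)" by auto
qed measurable

lemma second_moment_orthogonal_sum:
  fixes D :: "'i \<Rightarrow> 'a \<Rightarrow> real"
  assumes T: "finite T" and [measurable]: "\<And>t. t \<in> T \<Longrightarrow> D t \<in> borel_measurable M"
    and square_integrable: "\<And>t. t \<in> T \<Longrightarrow> integrable M (\<lambda>\<omega>. (D t \<omega>)\<^sup>2)"
    and orthogonal: "\<And>s t. s \<in> T \<Longrightarrow> t \<in> T \<Longrightarrow> s \<noteq> t \<Longrightarrow> expectation (\<lambda>\<omega>. D s \<omega> * D t \<omega>) = 0"
  shows "expectation (\<lambda>\<omega>. (\<Sum>t\<in>T. D t \<omega>)\<^sup>2) = (\<Sum>t\<in>T. expectation (\<lambda>\<omega>. (D t \<omega>)\<^sup>2))"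
    and "integrable M (\<lambda>\<omega>. (\<Sum>t\<in>T. D t \<omega>)\<^sup>2)"
proof -
  have integrable: "integrable M (\<lambda>\<omega>. D s \<omega> * D t \<omega>)" if "s \<in> T" "t \<in> T" for s t
    using that square_integrable by (intro square_integrable_mult) auto
  have square_sum_eq: "(\<Sum>t\<in>T. D t \<omega>)\<^sup>2 = (\<Sum>s\<in>T. \<Sum>t\<in>T. D s \<omega> * D t \<omega>)" for \<omega>
    by (simp add: power2_eq_square sum_product)
  show "integrable M (\<lambda>\<omega>. (\<Sum>t\<in>T. D t \<omega>)\<^sup>2)"
    unfolding square_sum_eq using integrable by auto
  have "expectation (\<lambda>\<omega>. (\<Sum>t\<in>T. D t \<omega>)\<^sup>2) = (\<Sum>s\<in>T. \<Sum>t\<in>T. expectation (\<lambda>\<omega>. D s \<omega> * D t \<omega>))"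
    unfolding square_sum_eq using integrable by (subst Bochner_Integration.integral_sum; auto intro!: sum.cong)
  also have "\<dots> = (\<Sum>s\<in>T. \<Sum>t\<in>T. if t = s then expectation (\<lambda>\<omega>. (D s \<omega>)\<^sup>2) else 0)"
    using orthogonal by (intro sum.cong refl) (auto simp: power2_eq_square)
  also have "\<dots> = (\<Sum>t\<in>T. expectation (\<lambda>\<omega>. (D t \<omega>)\<^sup>2))"
    using T by simp
  finally show "expectation (\<lambda>\<omega>. (\<Sum>t\<in>T. D t \<omega>)\<^sup>2) = (\<Sum>t\<in>T. expectation (\<lambda>\<omega>. (D t \<omega>)\<^sup>2))" .
qed

lemma L1_bound_orthogonal_sum:
  fixes D :: "'i \<Rightarrow> 'a \<Rightarrow> real"
  assumes T: "finite T" and D: "\<And>t. t \<in> T \<Longrightarrow> D t \<in> borel_measurable M"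
    "\<And>t. t \<in> T \<Longrightarrow> integrable M (\<lambda>\<omega>. (D t \<omega>)\<^sup>2)" "\<And>t. t \<in> T \<Longrightarrow> expectation (\<lambda>\<omega>. (D t \<omega>)\<^sup>2) \<le> q"
    "\<And>s t. s \<in> T \<Longrightarrow> t \<in> T \<Longrightarrow> s \<noteq> t \<Longrightarrow> expectation (\<lambda>\<omega>. D s \<omega> * D t \<omega>) = 0"
  shows "L1_bound M (\<lambda>\<omega>. \<Sum>t\<in>T. D t \<omega>) (sqrt (real (card T)) * sqrt q)"
proof -
  note sq = second_moment_orthogonal_sum[of T D, OF T D(1,2,4)]
  have "expectation (\<lambda>\<omega>. (\<Sum>t\<in>T. D t \<omega>)\<^sup>2) \<le> real (card T) * q"
    using sum_bounded_above[of T, OF D(3)] by (simp add: sq(1))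
  from L1_bound_of_second_moment[OF borel_measurable_sum[OF D(1)] sq(2) this]
  show ?thesis by (simp add: real_sqrt_mult)
qed

lemma square_integrable_limit:
  fixes X :: "nat \<Rightarrow> 'a \<Rightarrow> real"
  assumes [measurable]: "\<And>k. X k \<in> borel_measurable M" "Y \<in> borel_measurable M"
    and lim: "AE \<omega> in M. (\<lambda>k. X k \<omega>) \<longlonglongrightarrow> Y \<omega>"
    and second_moment: "\<And>k. integrable M (\<lambda>\<omega>. (X k \<omega>)\<^sup>2)" "\<And>k. expectation (\<lambda>\<omega>. (X k \<omega>)\<^sup>2) \<le> q"
  shows "integrable M (\<lambda>\<omega>. (Y \<omega>)\<^sup>2)" and "expectation (\<lambda>\<omega>. (Y \<omega>)\<^sup>2) \<le> q"
proof -
  have q_nonneg: "0 \<le> q" by (rule order_trans[OF Bochner_Integration.integral_nonneg second_moment(2)]) simp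
  have "(\<integral>\<^sup>+\<omega>. ennreal ((Y \<omega>)\<^sup>2) \<partial>M) = (\<integral>\<^sup>+\<omega>. liminf (\<lambda>k. ennreal ((X k \<omega>)\<^sup>2)) \<partial>M)"
    using lim by (intro nn_integral_cong_AE) (auto intro!: lim_imp_Liminf[symmetric] tendsto_intros)
  also have "\<dots> \<le> liminf (\<lambda>k. \<integral>\<^sup>+\<omega>. ennreal ((X k \<omega>)\<^sup>2) \<partial>M)"
    by (rule nn_integral_liminf) measurable
  also have "\<dots> \<le> liminf (\<lambda>k. ennreal q)"
    using second_moment by (intro Liminf_mono always_eventually allI) (simp add: nn_integral_eq_integral ennreal_leI)
  also have "\<dots> = ennreal q" by (simp add: Liminf_const)
  finally have nn_integral_le: "(\<integral>\<^sup>+\<omega>. ennreal ((Y \<omega>)\<^sup>2) \<partial>M) \<le> ennreal q" .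
  show integrable: "integrable M (\<lambda>\<omega>. (Y \<omega>)\<^sup>2)"
    using le_less_trans[OF nn_integral_le ennreal_less_top] by (intro integrableI_nonneg) auto
  then have "ennreal (expectation (\<lambda>\<omega>. (Y \<omega>)\<^sup>2)) \<le> ennreal q"
    using nn_integral_le by (simp add: nn_integral_eq_integral)
  then show "expectation (\<lambda>\<omega>. (Y \<omega>)\<^sup>2) \<le> q" using q_nonneg by simp
qed

lemma expectation_min_one_tendsto_0:
  fixes X :: "'a \<Rightarrow> real"
  assumes [measurable]: "X \<in> borel_measurable M" and c_tendsto: "c \<longlonglongrightarrow> 0"
  shows "(\<lambda>k. expectation (\<lambda>\<omega>. min 1 \<bar>c k * X \<omega>\<bar>)) \<longlonglongrightarrow> 0"
proof -
  have "(\<lambda>k. expectation (\<lambda>\<omega>. min 1 \<bar>c k * X \<omega>\<bar>)) \<longlonglongrightarrow> expectation (\<lambda>\<omega>. 0)"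
  proof (rule integral_dominated_convergence[where w="\<lambda>_. 1"])
    have "(\<lambda>k. min 1 \<bar>c k * X \<omega>\<bar>) \<longlonglongrightarrow> min 1 \<bar>0 * X \<omega>\<bar>" for \<omega>
      by (intro tendsto_intros c_tendsto)
    then show "AE \<omega> in M. (\<lambda>k. min 1 \<bar>c k * X \<omega>\<bar>) \<longlonglongrightarrow> 0" by simp
  qed auto
  then show ?thesis by simp
qed

end

lemma min_one_abs_sum_le:
  fixes f :: "'i \<Rightarrow> real"
  assumes "finite A"
  shows "min 1 \<bar>\<Sum>i\<in>A. f i\<bar> \<le> (\<Sum>i\<in>A. min 1 \<bar>f i\<bar>)"
  using assms
proof (induction A rule: finite_induct)
  case (insert i A)
  have "min 1 \<bar>f i + sum f A\<bar> \<le> min 1 \<bar>f i\<bar> + min 1 \<bar>sum f A\<bar>"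
    by (auto simp: min_def)
  with insert show ?case by simp
qed simp

lemma AE_summable_of_summable_integral:
  fixes f :: "nat \<Rightarrow> 'a \<Rightarrow> real"
  assumes integrable: "\<And>k. integrable M (f k)" and nonneg: "\<And>k \<omega>. f k \<omega> \<ge> 0"
    and summable: "summable (\<lambda>k. \<integral>\<omega>. f k \<omega> \<partial>M)"
  shows "AE \<omega> in M. summable (\<lambda>k. f k \<omega>)"
proof -
  have [measurable]: "f k \<in> borel_measurable M" for k using integrable by auto
  have "(\<integral>\<^sup>+\<omega>. (\<Sum>k. ennreal (f k \<omega>)) \<partial>M) = (\<Sum>k. \<integral>\<^sup>+\<omega>. ennreal (f k \<omega>) \<partial>M)"
    by (rule nn_integral_suminf) auto
  also have "\<dots> = (\<Sum>k. ennreal (\<integral>\<omega>. f k \<omega> \<partial>M))"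
    using integrable nonneg by (simp add: nn_integral_eq_integral)
  also have "\<dots> \<noteq> top"
    using summable nonneg by (intro ennreal_suminf_neq_top) (auto intro!: integral_nonneg)
  finally have "AE \<omega> in M. (\<Sum>k. ennreal (f k \<omega>)) \<noteq> \<infinity>"
    by (intro nn_integral_PInf_AE) auto
  then show ?thesis
    by eventually_elim (auto intro!: summable_suminf_not_top nonneg)
qed

section \<open>Convergence and boundedness in probability\<close>

definition mostly_le :: "(nat \<Rightarrow> 'a measure) \<Rightarrow> (nat \<Rightarrow> 'a \<Rightarrow> real) \<Rightarrow> real \<Rightarrow> real \<Rightarrow> bool" where
  "mostly_le M X c e \<longleftrightarrow> (\<forall>\<^sub>F k in sequentially. \<exists>E\<in>sets (M k). measure (M k) E < e \<and>
     (\<forall>\<omega>\<in>space (M k) - E. \<bar>X k \<omega>\<bar> \<le> c))"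

definition oprob :: "(nat \<Rightarrow> 'a measure) \<Rightarrow> (nat \<Rightarrow> 'a \<Rightarrow> real) \<Rightarrow> bool" where
  "oprob M X \<longleftrightarrow> (\<forall>c>0. \<forall>e>0. mostly_le M X c e)"

definition Oprob :: "(nat \<Rightarrow> 'a measure) \<Rightarrow> (nat \<Rightarrow> 'a \<Rightarrow> real) \<Rightarrow> bool" where
  "Oprob M X \<longleftrightarrow> (\<forall>e>0. \<exists>c. mostly_le M X c e)"

lemma mostly_le_combine:
  assumes "mostly_le M X a d" "mostly_le M Y b e"
    and pointwise: "\<And>k \<omega>. \<omega> \<in> space (M k) \<Longrightarrow> \<bar>X k \<omega>\<bar> \<le> a \<Longrightarrow> \<bar>Y k \<omega>\<bar> \<le> b \<Longrightarrow> \<bar>Z k \<omega>\<bar> \<le> c"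
  shows "mostly_le M Z c (d + e)"
  using assms(1,2) unfolding mostly_le_def
proof eventually_elim
  case (elim k)
  then obtain E F where E: "E \<in> sets (M k)" "measure (M k) E < d" "\<forall>\<omega>\<in>space (M k) - E. \<bar>X k \<omega>\<bar> \<le> a"
    and F: "F \<in> sets (M k)" "measure (M k) F < e" "\<forall>\<omega>\<in>space (M k) - F. \<bar>Y k \<omega>\<bar> \<le> b"
    by blast
  have "measure (M k) (E \<union> F) < d + e"
    using measure_Un_le[OF E(1) F(1)] E(2) F(2) by linarith
  with E F show ?case by (intro bexI[of _ "E \<union> F"]) (auto intro: pointwise)
qed

lemma mostly_le_pointwise:
  assumes "0 < e" "\<And>k \<omega>. \<omega> \<in> space (M k) \<Longrightarrow> \<bar>X k \<omega>\<bar> \<le> c"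
  shows "mostly_le M X c e"
  unfolding mostly_le_def using assms by (intro always_eventually allI bexI[of _ "{}"]) auto

lemma mostly_le_mono:
  assumes "mostly_le M X a e" "\<And>k \<omega>. \<omega> \<in> space (M k) \<Longrightarrow> \<bar>X k \<omega>\<bar> \<le> a \<Longrightarrow> \<bar>Y k \<omega>\<bar> \<le> b"
  shows "mostly_le M Y b e"
  using assms(1) unfolding mostly_le_def by (rule eventually_mono) (use assms(2) in blast)

lemma mostly_le_AE_cong:
  assumes "mostly_le M X c e" "\<And>k. AE \<omega> in M k. X k \<omega> = Y k \<omega>"
  shows "mostly_le M Y c e"
  using assms(1) unfolding mostly_le_def
proof eventually_elim
  case (elim k)
  then obtain E where E: "E \<in> sets (M k)" "measure (M k) E < e" "\<And>\<omega>. \<omega> \<in> space (M k) - E \<Longrightarrow> \<bar>X k \<omega>\<bar> \<le> c"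
    by blast
  obtain Z where Z: "Z \<in> null_sets (M k)" "{\<omega> \<in> space (M k). X k \<omega> \<noteq> Y k \<omega>} \<subseteq> Z"
    using assms(2)[of k] by (auto elim!: AE_E)
  have "measure (M k) (E \<union> Z) = measure (M k) E"
    using E(1) Z(1) by (simp add: measure_Un_null_set)
  moreover have "\<bar>Y k \<omega>\<bar> \<le> c" if "\<omega> \<in> space (M k) - (E \<union> Z)" for \<omega>
    using that Z(2) E(3)[of \<omega>] by (cases "X k \<omega> = Y k \<omega>") auto
  ultimately show ?case
    using E Z by (intro bexI[of _ "E \<union> Z"]) auto
qed

lemma mostly_le_of_L1_bound:
  assumes L1_bounded: "\<And>k. L1_bound (M k) (X k) (b k)" and eventually_small: "\<forall>\<^sub>F k in sequentially. b k < c * e"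
    and c_pos: "0 < c"
  shows "mostly_le M X c e"
  unfolding mostly_le_def using eventually_small
proof eventually_elim
  case (elim k)
  let ?E = "{\<omega> \<in> space (M k). \<bar>X k \<omega>\<bar> \<ge> c}"
  have integrable: "integrable (M k) (\<lambda>\<omega>. \<bar>X k \<omega>\<bar>)" and integral_le: "(\<integral>\<omega>. \<bar>X k \<omega>\<bar> \<partial>M k) \<le> b k"
    using L1_bounded[of k] by (auto simp: L1_bound_def)
  have [measurable]: "(\<lambda>\<omega>. \<bar>X k \<omega>\<bar>) \<in> borel_measurable (M k)" using integrable by auto
  have "measure (M k) ?E \<le> (\<integral>\<omega>. \<bar>X k \<omega>\<bar> \<partial>M k) / c"
    by (rule integral_Markov_inequality_measure[OF integrable]) (use c_pos in auto)
  also have "\<dots> < e" using integral_le elim c_pos by (simp add: pos_divide_less_eq mult.commute)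
  finally show ?case by (intro bexI[of _ ?E]) auto
qed

lemma oprob_of_L1_bound:
  assumes "\<And>k. L1_bound (M k) (X k) (b k)" "b \<longlonglongrightarrow> 0"
  shows "oprob M X"
  unfolding oprob_def
proof (intro allI impI)
  fix c e :: real assume "c > 0" "e > 0"
  then show "mostly_le M X c e"
    using order_tendstoD(2)[OF assms(2), of "c * e"] by (intro mostly_le_of_L1_bound[OF assms(1)]) auto
qed

lemma Oprob_of_L1_bound:
  assumes L1_bounded: "\<And>k. L1_bound (M k) (X k) b"
  shows "Oprob M X"
  unfolding Oprob_def
proof (intro allI impI exI)
  fix e :: real assume e_pos: "e > 0"
  show "mostly_le M X ((\<bar>b\<bar> + 1) / e) e"
    by (rule mostly_le_of_L1_bound[OF L1_bounded]) (use e_pos in \<open>auto simp: add_nonneg_pos\<close>)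
qed

lemma oprob_imp_Oprob: "oprob M X \<Longrightarrow> Oprob M X"
  unfolding oprob_def Oprob_def by (blast intro: zero_less_one)

lemma oprob_mono:
  assumes "oprob M X" "\<And>k \<omega>. \<omega> \<in> space (M k) \<Longrightarrow> \<bar>Y k \<omega>\<bar> \<le> \<bar>X k \<omega>\<bar>"
  shows "oprob M Y"
  using assms(1) unfolding oprob_def by (blast intro: mostly_le_mono order_trans[OF assms(2)])

lemma Oprob_mono:
  assumes "Oprob M X" "\<And>k \<omega>. \<omega> \<in> space (M k) \<Longrightarrow> \<bar>Y k \<omega>\<bar> \<le> \<bar>X k \<omega>\<bar>"
  shows "Oprob M Y"
  using assms(1) unfolding Oprob_def by (blast intro: mostly_le_mono order_trans[OF assms(2)])

lemma oprob_AE_cong: "oprob M X \<Longrightarrow> (\<And>k. AE \<omega> in M k. X k \<omega> = Y k \<omega>) \<Longrightarrow> oprob M Y"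
  unfolding oprob_def by (blast intro: mostly_le_AE_cong)

lemma oprob_tendsto_0:
  assumes "c \<longlonglongrightarrow> 0"
  shows "oprob M (\<lambda>k \<omega>. c k)"
  unfolding oprob_def mostly_le_def
proof (intro allI impI)
  fix d e :: real assume "d > 0" "e > 0"
  from tendstoD[OF assms \<open>d > 0\<close>]
  show "\<forall>\<^sub>F k in sequentially. \<exists>E\<in>sets (M k). measure (M k) E < e \<and> (\<forall>\<omega>\<in>space (M k) - E. \<bar>c k\<bar> \<le> d)"
    by eventually_elim (use \<open>e > 0\<close> in \<open>auto simp: dist_real_def intro!: bexI[of _ "{}"]\<close>)
qed

lemma oprob_zero: "oprob M (\<lambda>k \<omega>. 0)"
  by (rule oprob_tendsto_0) simp

lemma Oprob_const: "Oprob M (\<lambda>k \<omega>. c)"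
  unfolding Oprob_def by (blast intro: mostly_le_pointwise order_refl)

lemma oprob_add:
  assumes "oprob M X" "oprob M Y"
  shows "oprob M (\<lambda>k \<omega>. X k \<omega> + Y k \<omega>)"
  unfolding oprob_def
proof (intro allI impI)
  fix c e :: real assume "c > 0" "e > 0"
  with assms have "mostly_le M X (c / 2) (e / 2)" "mostly_le M Y (c / 2) (e / 2)"
    by (auto simp: oprob_def)
  from mostly_le_combine[OF this, of "\<lambda>k \<omega>. X k \<omega> + Y k \<omega>" c]
  show "mostly_le M (\<lambda>k \<omega>. X k \<omega> + Y k \<omega>) c e" by force
qed

lemma oprob_uminus: "oprob M X \<Longrightarrow> oprob M (\<lambda>k \<omega>. - X k \<omega>)"
  by (erule oprob_mono) simp

lemma oprob_diff: "oprob M X \<Longrightarrow> oprob M Y \<Longrightarrow> oprob M (\<lambda>k \<omega>. X k \<omega> - Y k \<omega>)"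
  using oprob_add[OF _ oprob_uminus, of M X Y] by simp

lemma oprob_sum:
  assumes "\<And>j. j \<in> J \<Longrightarrow> oprob M (X j)"
  shows "oprob M (\<lambda>k \<omega>. \<Sum>j\<in>J. X j k \<omega>)"
  using assms by (induction J rule: infinite_finite_induct) (auto intro: oprob_add oprob_zero)

lemma Oprob_combine:
  assumes "Oprob M X" "Oprob M Y"
    and bound: "\<And>a b k \<omega>. \<bar>X k \<omega>\<bar> \<le> a \<Longrightarrow> \<bar>Y k \<omega>\<bar> \<le> b \<Longrightarrow> \<bar>Z k \<omega>\<bar> \<le> f a b"
  shows "Oprob M Z"
  unfolding Oprob_def
proof (intro allI impI)
  fix e :: real assume "e > 0"
  with assms(1,2) obtain a b where "mostly_le M X a (e / 2)" "mostly_le M Y b (e / 2)"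
    unfolding Oprob_def by (meson half_gt_zero)
  from mostly_le_combine[OF this, of Z "f a b"] bound show "\<exists>c. mostly_le M Z c e" by force
qed

lemma Oprob_add:
  assumes "Oprob M X" "Oprob M Y"
  shows "Oprob M (\<lambda>k \<omega>. X k \<omega> + Y k \<omega>)"
  by (rule Oprob_combine[OF assms, of _ "(+)"]) linarith

lemma Oprob_mult:
  assumes "Oprob M X" "Oprob M Y"
  shows "Oprob M (\<lambda>k \<omega>. X k \<omega> * Y k \<omega>)"
  by (rule Oprob_combine[OF assms, of _ times]) (auto simp: abs_mult intro!: mult_mono)

lemma oprob_mult:
  assumes "Oprob M X" "oprob M Y"
  shows "oprob M (\<lambda>k \<omega>. X k \<omega> * Y k \<omega>)"
  unfolding oprob_def
proof (intro allI impI)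
  fix c e :: real assume "c > 0" "e > 0"
  with assms(1) obtain a where a: "mostly_le M X a (e / 2)"
    unfolding Oprob_def by (meson half_gt_zero)
  have "mostly_le M Y (c / (\<bar>a\<bar> + 1)) (e / 2)"
    using assms(2) \<open>c > 0\<close> \<open>e > 0\<close> by (simp add: oprob_def)
  then have "mostly_le M (\<lambda>k \<omega>. X k \<omega> * Y k \<omega>) c (e / 2 + e / 2)"
  proof (rule mostly_le_combine[OF a])
    fix k \<omega> assume "\<bar>X k \<omega>\<bar> \<le> a" "\<bar>Y k \<omega>\<bar> \<le> c / (\<bar>a\<bar> + 1)"
    then have "\<bar>X k \<omega> * Y k \<omega>\<bar> \<le> (\<bar>a\<bar> + 1) * (c / (\<bar>a\<bar> + 1))"
      unfolding abs_mult by (intro mult_mono) auto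
    then show "\<bar>X k \<omega> * Y k \<omega>\<bar> \<le> c" by simp
  qed
  then show "mostly_le M (\<lambda>k \<omega>. X k \<omega> * Y k \<omega>) c e" by simp
qed

lemma oprob_continuous_map:
  assumes X: "oprob M (\<lambda>k \<omega>. X k \<omega> - c)" and h: "isCont h c"
  shows "oprob M (\<lambda>k \<omega>. h (X k \<omega>) - h c)"
  unfolding oprob_def
proof (intro allI impI)
  fix a e :: real assume "a > 0" "e > 0"
  then obtain d where d_pos: "d > 0" "\<And>y. \<bar>y - c\<bar> < d \<Longrightarrow> \<bar>h y - h c\<bar> < a"
    using h unfolding continuous_at_eps_delta dist_real_def by meson
  then have "mostly_le M (\<lambda>k \<omega>. X k \<omega> - c) (d / 2) e"
    using X \<open>e > 0\<close> by (simp add: oprob_def)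
  then show "mostly_le M (\<lambda>k \<omega>. h (X k \<omega>) - h c) a e"
    by (rule mostly_le_mono) (use d_pos in \<open>force intro: less_imp_le\<close>)
qed

lemma (in prob_space) abs_expectation_lipschitz_diff_le:
  fixes f :: "real \<Rightarrow> real"
  assumes [measurable]: "X \<in> borel_measurable M" "Y \<in> borel_measurable M" "f \<in> borel_measurable borel" "E \<in> sets M"
    and S: "\<And>\<omega>. \<omega> \<in> space M \<Longrightarrow> X \<omega> \<in> S" "\<And>\<omega>. \<omega> \<in> space M \<Longrightarrow> Y \<omega> \<in> S"
    and bounded: "\<And>y. y \<in> S \<Longrightarrow> \<bar>f y\<bar> \<le> B" and lipschitz: "L-lipschitz_on S f"
    and d_nonneg: "0 \<le> d" and close: "\<And>\<omega>. \<omega> \<in> space M - E \<Longrightarrow> \<bar>X \<omega> - Y \<omega>\<bar> \<le> d"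
  shows "\<bar>expectation (\<lambda>\<omega>. f (X \<omega>)) - expectation (\<lambda>\<omega>. f (Y \<omega>))\<bar> \<le> L * d + 2 * \<bar>B\<bar> * prob E"
proof -
  have L_nonneg: "0 \<le> L" using lipschitz by (rule lipschitz_on_nonneg)
  have integrable: "integrable M (\<lambda>\<omega>. f (X \<omega>))" "integrable M (\<lambda>\<omega>. f (Y \<omega>))"
    using S bounded by (auto intro!: bounded_integrable[of _ B])
  have int_E: "integrable M (\<lambda>\<omega>. indicator E \<omega> :: real)" by (rule bounded_integrable[of _ 1]) auto
  have pointwise: "\<bar>f (X \<omega>) - f (Y \<omega>)\<bar> \<le> L * d + 2 * \<bar>B\<bar> * indicator E \<omega>" if "\<omega> \<in> space M" for \<omega>
  proof (cases "\<omega> \<in> E")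
    case True
    have "0 \<le> L * d" using L_nonneg d_nonneg by simp
    with True bounded[OF S(1)[OF that]] bounded[OF S(2)[OF that]] show ?thesis by simp
  next
    case False
    have "\<bar>f (X \<omega>) - f (Y \<omega>)\<bar> \<le> L * \<bar>X \<omega> - Y \<omega>\<bar>"
      using lipschitz_onD[OF lipschitz S(1,2), OF that that] by (simp add: dist_real_def)
    also have "\<dots> \<le> L * d" using close[of \<omega>] that False L_nonneg by (intro mult_left_mono) auto
    finally show ?thesis using False by simp
  qed
  have "\<bar>expectation (\<lambda>\<omega>. f (X \<omega>)) - expectation (\<lambda>\<omega>. f (Y \<omega>))\<bar> \<le> expectation (\<lambda>\<omega>. \<bar>f (X \<omega>) - f (Y \<omega>)\<bar>)"
    using integrable integral_abs_bound[of M "\<lambda>\<omega>. f (X \<omega>) - f (Y \<omega>)"] by simp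
  also have "\<dots> \<le> expectation (\<lambda>\<omega>. L * d + 2 * \<bar>B\<bar> * indicator E \<omega>)"
    using integrable int_E by (intro integral_mono pointwise) auto
  also have "\<dots> = L * d + 2 * \<bar>B\<bar> * prob E" using int_E prob_space by simp
  finally show ?thesis .
qed

lemma oprob_imp_expectation_lipschitz_diff:
  fixes f :: "real \<Rightarrow> real"
  assumes M: "\<And>k. prob_space (M k)"
    and meas: "\<And>k. X k \<in> borel_measurable (M k)" "\<And>k. Y k \<in> borel_measurable (M k)" "f \<in> borel_measurable borel"
    and S: "\<And>k \<omega>. \<omega> \<in> space (M k) \<Longrightarrow> X k \<omega> \<in> S" "\<And>k \<omega>. \<omega> \<in> space (M k) \<Longrightarrow> Y k \<omega> \<in> S"
    and bounded: "\<And>y. y \<in> S \<Longrightarrow> \<bar>f y\<bar> \<le> B" and lipschitz: "L-lipschitz_on S f"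
    and diff: "oprob M (\<lambda>k \<omega>. X k \<omega> - Y k \<omega>)"
  shows "(\<lambda>k. (\<integral>\<omega>. f (X k \<omega>) \<partial>M k) - (\<integral>\<omega>. f (Y k \<omega>) \<partial>M k)) \<longlonglongrightarrow> 0"
proof (rule tendstoI)
  fix e :: real assume e_pos: "e > 0"
  have L_nonneg: "0 \<le> L" using lipschitz by (rule lipschitz_on_nonneg)
  define d where "d = e / (2 * (L + 1))"
  define d' where "d' = e / (4 * (\<bar>B\<bar> + 1))"
  have pos: "d > 0" "d' > 0"
    using e_pos L_nonneg by (simp_all add: d_def d'_def add_nonneg_pos)
  have cancel: "y * (e / (a * y)) = e / a" if "y > 0" for y a :: real
    using that by simp
  have d_scaled: "(L + 1) * d = e / 2" and d'_scaled: "(\<bar>B\<bar> + 1) * d' = e / 4"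
    unfolding d_def d'_def using L_nonneg by (intro cancel; simp)+
  from pos diff have "mostly_le M (\<lambda>k \<omega>. X k \<omega> - Y k \<omega>) d d'" by (simp add: oprob_def)
  then show "\<forall>\<^sub>F k in sequentially. dist ((\<integral>\<omega>. f (X k \<omega>) \<partial>M k) - (\<integral>\<omega>. f (Y k \<omega>) \<partial>M k)) 0 < e"
    unfolding mostly_le_def
  proof eventually_elim
    case (elim k)
    then obtain E where E: "E \<in> sets (M k)" "measure (M k) E < d'"
      "\<And>\<omega>. \<omega> \<in> space (M k) - E \<Longrightarrow> \<bar>X k \<omega> - Y k \<omega>\<bar> \<le> d" by blast
    have "\<bar>(\<integral>\<omega>. f (X k \<omega>) \<partial>M k) - (\<integral>\<omega>. f (Y k \<omega>) \<partial>M k)\<bar> \<le> L * d + 2 * \<bar>B\<bar> * measure (M k) E"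
      using pos(1) E(3)
      by (intro prob_space.abs_expectation_lipschitz_diff_le[OF M meas E(1) S bounded lipschitz]) auto
    also have "\<dots> \<le> (L + 1) * d + 2 * ((\<bar>B\<bar> + 1) * d') - d"
      using E(2) mult_mono[of "2 * \<bar>B\<bar>" "2 * \<bar>B\<bar> + 2" "measure (M k) E" d'] by (simp add: algebra_simps)
    also have "\<dots> < e" unfolding d_scaled d'_scaled using pos by simp
    finally show ?case by (simp add: dist_real_def)
  qed
qed

lemma finite_box_net:
  fixes C \<eta> :: real
  assumes "finite I" "\<eta> > 0"
  obtains T :: "('i \<Rightarrow> real) set" where "finite T"
    "\<And>\<tau>. (\<And>i. i \<in> I \<Longrightarrow> \<bar>\<tau> i\<bar> \<le> C) \<Longrightarrow> \<exists>\<tau>'\<in>T. \<forall>i\<in>I. \<bar>\<tau> i - \<tau>' i\<bar> \<le> \<eta>"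
proof -
  obtain F where F: "finite F" "F \<subseteq> {-C..C}" "{-C..C} \<subseteq> (\<Union>y\<in>F. ball y \<eta>)"
    using seq_compact_imp_totally_bounded[of "{-C..C}"] assms(2) compact_imp_seq_compact[of "{-C..C}"] by auto
  show thesis
  proof (rule that[of "PiE I (\<lambda>_. F)"])
    show "finite (PiE I (\<lambda>_. F))" using F assms(1) by (intro finite_PiE) auto
    fix \<tau> :: "'i \<Rightarrow> real" assume \<tau>: "\<And>i. i \<in> I \<Longrightarrow> \<bar>\<tau> i\<bar> \<le> C"
    have "\<exists>y\<in>F. \<bar>\<tau> i - y\<bar> \<le> \<eta>" if "i \<in> I" for i
    proof -
      have "\<tau> i \<in> {-C..C}" using \<tau>[OF that] by auto
      then obtain y where "y \<in> F" "\<tau> i \<in> ball y \<eta>" using F by blast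
      then show ?thesis by (intro bexI[of _ y]) (auto simp: dist_real_def)
    qed
    then obtain h where h: "\<And>i. i \<in> I \<Longrightarrow> h i \<in> F \<and> \<bar>\<tau> i - h i\<bar> \<le> \<eta>" by metis
    show "\<exists>\<tau>'\<in>PiE I (\<lambda>_. F). \<forall>i\<in>I. \<bar>\<tau> i - \<tau>' i\<bar> \<le> \<eta>"
      using h by (intro bexI[of _ "restrict h I"]) auto
  qed
qed

text \<open>The remainder \<open>Z\<close> must not depend on \<open>\<tau>\<close>: the size of the net grows as \<open>\<eta>\<close> shrinks.\<close>

lemma oprob_random_parameter:
  fixes X :: "nat \<Rightarrow> ('i \<Rightarrow> real) \<Rightarrow> 'a \<Rightarrow> real" and T :: "nat \<Rightarrow> 'a \<Rightarrow> 'i \<Rightarrow> real"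
  assumes I: "finite I" and tight: "Oprob M (\<lambda>k \<omega>. \<Sum>i\<in>I. \<bar>T k \<omega> i\<bar>)"
    and pointwise: "\<And>\<tau>. oprob M (\<lambda>k. X k \<tau>)"
    and modulus: "\<And>c e. c > 0 \<Longrightarrow> e > 0 \<Longrightarrow> \<exists>\<eta>>0. \<exists>Y Z. (\<forall>\<tau>. oprob M (\<lambda>k. Y k \<tau>)) \<and> mostly_le M Z c e \<and>
      (\<forall>k \<tau> \<tau>' \<omega>. (\<forall>i\<in>I. \<bar>\<tau>' i - \<tau> i\<bar> \<le> \<eta>) \<longrightarrow> \<bar>X k \<tau>' \<omega>\<bar> \<le> \<bar>X k \<tau> \<omega>\<bar> + \<bar>Y k \<tau> \<omega>\<bar> + Z k \<omega>)"
  shows "oprob M (\<lambda>k \<omega>. X k (T k \<omega>) \<omega>)"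
  unfolding oprob_def
proof (intro allI impI)
  fix c e :: real assume c_pos: "c > 0" and e_pos: "e > 0"
  then have "c / 2 > 0" "e / 3 > 0" by auto
  from modulus[OF this] obtain \<eta> Y Z where \<eta>_pos: "\<eta> > 0" and Y: "\<And>\<tau>. oprob M (\<lambda>k. Y k \<tau>)"
    and Z: "mostly_le M Z (c / 2) (e / 3)"
    and modulus_bound: "\<And>k \<tau> \<tau>' \<omega>. \<forall>i\<in>I. \<bar>\<tau>' i - \<tau> i\<bar> \<le> \<eta> \<Longrightarrow> \<bar>X k \<tau>' \<omega>\<bar> \<le> \<bar>X k \<tau> \<omega>\<bar> + \<bar>Y k \<tau> \<omega>\<bar> + Z k \<omega>"
    by metis
  from tight \<open>e / 3 > 0\<close> obtain C where C: "mostly_le M (\<lambda>k \<omega>. \<Sum>i\<in>I. \<bar>T k \<omega> i\<bar>) C (e / 3)"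
    unfolding Oprob_def by blast
  obtain N where N: "finite N"
    "\<And>\<tau>. (\<And>i. i \<in> I \<Longrightarrow> \<bar>\<tau> i\<bar> \<le> C) \<Longrightarrow> \<exists>\<tau>'\<in>N. \<forall>i\<in>I. \<bar>\<tau> i - \<tau>' i\<bar> \<le> \<eta>"
    using finite_box_net[OF I \<eta>_pos] by blast
  let ?S = "\<lambda>k \<omega>. \<Sum>\<tau>\<in>N. \<bar>X k \<tau> \<omega>\<bar> + \<bar>Y k \<tau> \<omega>\<bar>"
  have "oprob M ?S"
    by (intro oprob_sum oprob_add oprob_mono[OF pointwise] oprob_mono[OF Y]) auto
  then have "mostly_le M ?S (c / 2) (e / 3)" using \<open>c / 2 > 0\<close> \<open>e / 3 > 0\<close> by (simp add: oprob_def)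
  from this Z have "mostly_le M (\<lambda>k \<omega>. ?S k \<omega> + Z k \<omega>) c (e / 3 + e / 3)"
    by (rule mostly_le_combine) linarith
  from C this have "mostly_le M (\<lambda>k \<omega>. X k (T k \<omega>) \<omega>) c (e / 3 + (e / 3 + e / 3))"
  proof (rule mostly_le_combine)
    fix k \<omega> assume T: "\<bar>\<Sum>i\<in>I. \<bar>T k \<omega> i\<bar>\<bar> \<le> C" and S: "\<bar>?S k \<omega> + Z k \<omega>\<bar> \<le> c"
    have "\<bar>T k \<omega> i\<bar> \<le> C" if "i \<in> I" for i
      using T member_le_sum[OF that, of "\<lambda>i. \<bar>T k \<omega> i\<bar>"] I by simp
    then obtain \<tau> where \<tau>: "\<tau> \<in> N" "\<forall>i\<in>I. \<bar>T k \<omega> i - \<tau> i\<bar> \<le> \<eta>" using N(2) by blast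
    have "\<bar>X k \<tau> \<omega>\<bar> + \<bar>Y k \<tau> \<omega>\<bar> \<le> ?S k \<omega>"
      using \<tau>(1) N(1) by (intro member_le_sum) auto
    with modulus_bound[OF \<tau>(2), of k \<omega>] S show "\<bar>X k (T k \<omega>) \<omega>\<bar> \<le> c" by linarith
  qed
  then show "mostly_le M (\<lambda>k \<omega>. X k (T k \<omega>) \<omega>) c e" by simp
qed

section \<open>Weak convergence from Laplace transforms\<close>

lemma (in prob_space) norm_expectation_diff_le:
  fixes X Y :: "'a \<Rightarrow> 'b::{banach, second_countable_topology}"
  assumes "integrable M X" "integrable M Y" "\<And>\<omega>. \<omega> \<in> space M \<Longrightarrow> norm (X \<omega> - Y \<omega>) \<le> e"
  shows "norm (expectation X - expectation Y) \<le> e"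
proof -
  have "norm (expectation X - expectation Y) = norm (expectation (\<lambda>\<omega>. X \<omega> - Y \<omega>))"
    using assms by simp
  also have "\<dots> \<le> expectation (\<lambda>\<omega>. norm (X \<omega> - Y \<omega>))" by (rule integral_norm_bound)
  also have "\<dots> \<le> expectation (\<lambda>\<omega>. e)"
    using assms by (intro integral_mono) auto
  finally show ?thesis by (simp add: prob_space)
qed

lemma moments_imp_expectation_continuous:
  fixes M :: "nat \<Rightarrow> 'a measure" and V :: "nat \<Rightarrow> 'a \<Rightarrow> real"
    and L :: "'b measure" and W :: "'b \<Rightarrow> real" and f :: "real \<Rightarrow> real"
  assumes M: "\<And>k. prob_space (M k)" and L: "prob_space L"
    and V: "\<And>k. V k \<in> borel_measurable (M k)" and W: "W \<in> borel_measurable L"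
    and V_unit: "\<And>k \<omega>. \<omega> \<in> space (M k) \<Longrightarrow> V k \<omega> \<in> {0..1}"
    and W_unit: "\<And>\<omega>. \<omega> \<in> space L \<Longrightarrow> W \<omega> \<in> {0..1}"
    and moments: "\<And>a. (\<lambda>k. \<integral>\<omega>. V k \<omega> ^ a \<partial>M k) \<longlonglongrightarrow> (\<integral>\<omega>. W \<omega> ^ a \<partial>L)"
    and f: "continuous_on UNIV f"
  shows "(\<lambda>k. \<integral>\<omega>. f (V k \<omega>) \<partial>M k) \<longlonglongrightarrow> (\<integral>\<omega>. f (W \<omega>) \<partial>L)"
proof (rule tendstoI)
  fix e :: real assume e_pos: "e > 0"
  obtain h where h: "real_polynomial_function h" "\<And>x. x \<in> {0..1} \<Longrightarrow> \<bar>f x - h x\<bar> < e / 3"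
    using Stone_Weierstrass_real_polynomial_function[of "{0..1::real}" f "e / 3"] e_pos f
    by (auto intro: continuous_on_subset)
  obtain a N where h_eq: "h = (\<lambda>x. \<Sum>i\<le>N. a i * x ^ i)"
    using h(1) by (auto simp: real_polynomial_function_iff_sum)
  have [measurable]: "f \<in> borel_measurable borel"
    using f by (rule borel_measurable_continuous_onI)
  have "bounded (f ` {0..1})"
    using f by (intro compact_imp_bounded compact_continuous_image) (auto intro: continuous_on_subset)
  then obtain F where F: "\<And>x. x \<in> {0..1} \<Longrightarrow> \<bar>f x\<bar> \<le> F"
    unfolding bounded_iff by (metis imageI real_norm_def)
  have approx: "\<bar>(\<integral>\<omega>. f (X \<omega>) \<partial>N') - (\<Sum>i\<le>N. a i * (\<integral>\<omega>. X \<omega> ^ i \<partial>N'))\<bar> \<le> e / 3"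
    if "prob_space N'" and [measurable]: "X \<in> borel_measurable N'"
      and X: "\<And>\<omega>. \<omega> \<in> space N' \<Longrightarrow> X \<omega> \<in> {0..1}" for N' :: "'c measure" and X
  proof -
    interpret prob_space N' by fact
    have power_integrable: "integrable N' (\<lambda>\<omega>. X \<omega> ^ i)" for i
      using X by (intro bounded_integrable[of _ 1]) (auto intro!: power_le_one)
    have "norm (expectation (\<lambda>\<omega>. f (X \<omega>)) - expectation (\<lambda>\<omega>. h (X \<omega>))) \<le> e / 3"
      using X F h(2) power_integrable unfolding h_eq
      by (intro norm_expectation_diff_le bounded_integrable[of "\<lambda>\<omega>. f (X \<omega>)" F]) (auto intro: less_imp_le)
    then show ?thesis unfolding h_eq using power_integrable by simp
  qed
  have "(\<lambda>k. \<Sum>i\<le>N. a i * (\<integral>\<omega>. V k \<omega> ^ i \<partial>M k)) \<longlonglongrightarrow> (\<Sum>i\<le>N. a i * (\<integral>\<omega>. W \<omega> ^ i \<partial>L))"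
    by (intro tendsto_sum tendsto_mult tendsto_const moments)
  then have "\<forall>\<^sub>F k in sequentially. dist (\<Sum>i\<le>N. a i * (\<integral>\<omega>. V k \<omega> ^ i \<partial>M k))
      (\<Sum>i\<le>N. a i * (\<integral>\<omega>. W \<omega> ^ i \<partial>L)) < e / 3"
    using e_pos by (intro tendstoD) auto
  then show "\<forall>\<^sub>F k in sequentially. dist (\<integral>\<omega>. f (V k \<omega>) \<partial>M k) (\<integral>\<omega>. f (W \<omega>) \<partial>L) < e"
  proof eventually_elim
    case (elim k)
    with approx[OF M V V_unit, of k] approx[OF L W W_unit] show ?case
      unfolding dist_real_def by linarith
  qed
qed

text \<open>The values of the Laplace transform at the integers are the moments of the \<open>[0,1]\<close>-valued variable \<open>exp (- T)\<close>.\<close>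

lemma laplace_imp_weak_conv:
  fixes M :: "nat \<Rightarrow> 'a measure" and T :: "nat \<Rightarrow> 'a \<Rightarrow> real" and L :: "'b measure" and W :: "'b \<Rightarrow> real"
  assumes M: "\<And>k. prob_space (M k)" and L: "prob_space L"
    and T[measurable]: "\<And>k. T k \<in> borel_measurable (M k)" and W[measurable]: "W \<in> borel_measurable L"
    and T_nonneg: "\<And>k \<omega>. \<omega> \<in> space (M k) \<Longrightarrow> 0 \<le> T k \<omega>" and W_nonneg: "\<And>\<omega>. \<omega> \<in> space L \<Longrightarrow> 0 \<le> W \<omega>"
    and laplace: "\<And>a. (\<lambda>k. \<integral>\<omega>. exp (- (real a * T k \<omega>)) \<partial>M k) \<longlonglongrightarrow> (\<integral>\<omega>. exp (- (real a * W \<omega>)) \<partial>L)"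
  shows "weak_conv_m (\<lambda>k. distr (M k) borel (T k)) (distr L borel W)"
proof (rule integral_cts_step_conv_imp_weak_conv)
  show "real_distribution (distr (M k) borel (T k))" for k
    using M by (intro prob_space.real_distribution_distr) auto
  show "real_distribution (distr L borel W)"
    using L by (intro prob_space.real_distribution_distr) auto
  fix x y :: real assume x_less_y: "x < y"
  define f where "f v = cts_step x y (- ln (max v (exp (- y))))" for v
  have step: "continuous_on UNIV (cts_step x y)"
    by (rule uniformly_continuous_imp_continuous[OF cts_step_uniformly_continuous[OF x_less_y]])
  have [measurable]: "cts_step x y \<in> borel_measurable borel"
    by (rule borel_measurable_continuous_onI[OF step])
  have "max v (exp (- y)) > 0" for v by (simp add: less_max_iff_disj)
  then have f: "continuous_on UNIV f"
    unfolding f_def by (intro continuous_on_compose2[OF step] continuous_intros) (auto simp: less_le)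
  have f_exp: "f (exp (- t)) = cts_step x y t" for t
  proof -
    have "max (exp (- t)) (exp (- y)) = exp (- min t y)" by (auto simp: max_def min_def)
    with x_less_y show ?thesis by (simp add: f_def cts_step_def min_def)
  qed
  have power_exp: "exp (- s) ^ a = exp (- (real a * s))" for s :: real and a :: nat
    by (simp add: exp_of_nat_mult[symmetric])
  have "(\<lambda>k. \<integral>\<omega>. f (exp (- T k \<omega>)) \<partial>M k) \<longlonglongrightarrow> (\<integral>\<omega>. f (exp (- W \<omega>)) \<partial>L)"
    by (rule moments_imp_expectation_continuous[OF M L _ _ _ _ _ f])
      (use laplace T_nonneg W_nonneg in \<open>auto simp: power_exp\<close>)
  then show "(\<lambda>k. integral\<^sup>L (distr (M k) borel (T k)) (cts_step x y)) \<longlonglongrightarrow> integral\<^sup>L (distr L borel W) (cts_step x y)"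
    by (simp add: f_exp integral_distr)
qed

lemma (in real_distribution) cdf_surj_unit_interval:
  assumes cont: "\<And>y. isCont (cdf M) y" and v_pos: "0 < v" "v < 1"
  shows "\<exists>y. cdf M y = v"
proof -
  have "\<forall>\<^sub>F y in at_bot. cdf M y < v" "\<forall>\<^sub>F y in at_top. v < cdf M y"
    using order_tendstoD[OF cdf_lim_at_bot] order_tendstoD[OF cdf_lim_at_top_prob] v_pos by auto
  then obtain a b where a: "\<And>y. y \<le> a \<Longrightarrow> cdf M y < v" and b: "\<And>y. y \<ge> b \<Longrightarrow> v < cdf M y"
    by (auto simp: eventually_at_bot_linorder eventually_at_top_linorder)
  have "cdf M a \<le> v" "v \<le> cdf M (max a b)" using a[of a] b[of "max a b"] by auto
  then show ?thesis
    using IVT[of "cdf M" a v "max a b"] cont by auto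
qed

lemma abs_cdf_diff_less_of_quantiles:
  assumes D: "real_distribution D" and L: "real_distribution L" and n_pos: "0 < n" and d_pos: "0 < d"
    and quantile: "\<And>i. i \<in> {1..<n} \<Longrightarrow> cdf L (t i) = real i / real n"
    and close: "\<And>i. i \<in> {1..<n} \<Longrightarrow> \<bar>cdf D (t i) - cdf L (t i)\<bar> < d"
  shows "\<bar>cdf D y - cdf L y\<bar> < d + 1 / real n"
proof -
  interpret D: real_distribution D by fact
  interpret L: real_distribution L by fact
  define j where "j = nat \<lfloor>n * cdf L y\<rfloor> + 1"
  have j: "cdf L y < j / n" "j / n \<le> cdf L y + 1 / n"
    using n_pos L.cdf_nonneg[of y] unfolding j_def by (simp_all add: field_simps) linarith+
  have upper: "cdf D y < cdf L y + (d + 1 / n)"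
  proof (cases "j < n")
    case True
    then have j_range: "j \<in> {1..<n}" by (simp add: j_def)
    have "y \<le> t j"
      using j(1) quantile[OF j_range] L.cdf_nondecreasing[of "t j" y] by (cases "y \<le> t j") auto
    then show ?thesis
      using D.cdf_nondecreasing[of y "t j"] close[OF j_range] quantile[OF j_range] j(2) by linarith
  next
    case False
    then have "1 \<le> j / n" using n_pos by simp
    then show ?thesis using D.cdf_bounded_prob[of y] j(2) d_pos by linarith
  qed
  define i where "i = nat (\<lceil>n * cdf L y\<rceil> - 1)"
  have "n * cdf L y - 1 \<le> i" "i = 0 \<or> i < n * cdf L y" unfolding i_def by linarith+
  then have i: "cdf L y - 1 / n \<le> i / n" "i = 0 \<or> i / n < cdf L y"
    using n_pos
    by (simp_all add: pos_le_divide_eq pos_divide_less_eq right_diff_distrib left_diff_distrib mult.commute)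
  have lower: "cdf L y - (d + 1 / n) < cdf D y"
  proof (cases "i = 0")
    case True
    then show ?thesis using D.cdf_nonneg[of y] i(1) d_pos by simp
  next
    case False
    then have "real i / n < 1" using i(2) L.cdf_bounded_prob[of y] by linarith
    then have i_range: "i \<in> {1..<n}" using False n_pos by simp
    have "t i \<le> y"
      using i(2) False quantile[OF i_range] L.cdf_nondecreasing[of y "t i"] by (cases "t i \<le> y") auto
    then show ?thesis
      using D.cdf_nondecreasing[of "t i" y] close[OF i_range] quantile[OF i_range] i(1) by linarith
  qed
  show ?thesis using upper lower by linarith
qed

lemma weak_conv_imp_uniform_limit_cdf:
  assumes D: "\<And>k. real_distribution (D k)" and L: "real_distribution L"
    and weak: "weak_conv_m D L" and cont: "\<And>y. isCont (cdf L) y"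
  shows "uniform_limit UNIV (\<lambda>k. cdf (D k)) (cdf L) sequentially"
proof (rule uniform_limitI)
  fix e :: real assume e_pos: "e > 0"
  obtain n where n_pos: "0 < n" "1 / real n < e / 2"
    using nat_approx_posE[of "e / 2"] e_pos by (metis half_gt_zero zero_less_Suc)
  have "\<exists>y. cdf L y = real i / real n" if "i \<in> {1..<n}" for i
    using that by (intro real_distribution.cdf_surj_unit_interval[OF L] cont) auto
  then obtain t where t: "\<And>i. i \<in> {1..<n} \<Longrightarrow> cdf L (t i) = real i / real n" by metis
  have "\<forall>\<^sub>F k in sequentially. \<bar>cdf (D k) (t i) - cdf L (t i)\<bar> < e / 2" for i
    using weak cont e_pos unfolding weak_conv_m_def weak_conv_def
    by (auto dest!: spec[of _ "t i"] tendstoD[of _ _ _ "e / 2"] simp: dist_real_def)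
  then have "\<forall>\<^sub>F k in sequentially. \<forall>i\<in>{1..<n}. \<bar>cdf (D k) (t i) - cdf L (t i)\<bar> < e / 2"
    by (intro eventually_ball_finite) auto
  then show "\<forall>\<^sub>F k in sequentially. \<forall>y\<in>UNIV. dist (cdf (D k) y) (cdf L y) < e"
  proof eventually_elim
    case (elim k)
    have close: "\<bar>cdf (D k) y - cdf L y\<bar> < e / 2 + 1 / real n" for y
      using elim e_pos by (intro abs_cdf_diff_less_of_quantiles[OF D L n_pos(1) _ t]) auto
    have "dist (cdf (D k) y) (cdf L y) < e" for y
      using close[of y] n_pos(2) by (simp add: dist_real_def)
    then show ?case by simp
  qed
qed

section \<open>Gaussian vectors\<close>

lemma iexp_sum: "finite J \<Longrightarrow> iexp (\<Sum>j\<in>J. f j) = (\<Prod>j\<in>J. iexp (f j))"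
  by (simp add: sum_distrib_left exp_sum)

abbreviation std_normal_vector :: "'i set \<Rightarrow> ('i \<Rightarrow> real) measure" where
  "std_normal_vector J \<equiv> PiM J (\<lambda>_. std_normal_distribution)"

interpretation std_normal: real_distribution std_normal_distribution
  by (rule real_dist_normal_dist)

lemma prob_space_std_normal_vector: "prob_space (std_normal_vector J)"
  by (rule prob_space_PiM) (rule std_normal.prob_space_axioms)

lemma integral_prod_std_normal_vector:
  fixes f :: "'i \<Rightarrow> real \<Rightarrow> 'b::{real_normed_field, banach, second_countable_topology}"
  assumes J: "finite J" and f: "\<And>j. j \<in> J \<Longrightarrow> f j \<in> borel_measurable borel" "\<And>j x. j \<in> J \<Longrightarrow> norm (f j x) \<le> 1"
  shows "(\<integral>v. (\<Prod>j\<in>J. f j (v j)) \<partial>std_normal_vector J) = (\<Prod>j\<in>J. \<integral>x. f j x \<partial>std_normal_distribution)"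
proof -
  interpret product_prob_space "\<lambda>_. std_normal_distribution" J ..
  show ?thesis
    using f by (intro product_integral_prod J std_normal.bounded_integrable[of _ 1]) auto
qed

lemma exp_square_eq_gaussian_average:
  fixes s a :: real
  assumes "a \<ge> 0"
  shows "complex_of_real (exp (- (a * s\<^sup>2))) = (\<integral>g. iexp (sqrt (2 * a) * g * s) \<partial>std_normal_distribution)"
proof -
  have "(\<integral>g. iexp (sqrt (2 * a) * g * s) \<partial>std_normal_distribution) = char std_normal_distribution (sqrt (2 * a) * s)"
    unfolding char_def by (intro Bochner_Integration.integral_cong) (auto simp: mult_ac)
  then show ?thesis
    using assms by (simp add: char_std_normal_distribution power_mult_distrib)
qed

lemma laplace_square_norm_eq_gaussian_average:
  fixes X :: "'i \<Rightarrow> 'a \<Rightarrow> real" and a :: real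
  assumes M: "prob_space M" and J: "finite J" and [measurable]: "\<And>j. j \<in> J \<Longrightarrow> X j \<in> borel_measurable M"
    and a_nonneg: "a \<ge> 0"
  shows "complex_of_real (\<integral>\<omega>. exp (- (a * (\<Sum>j\<in>J. (X j \<omega>)\<^sup>2))) \<partial>M)
    = (\<integral>g. (\<integral>\<omega>. iexp (\<Sum>j\<in>J. sqrt (2 * a) * g j * X j \<omega>) \<partial>M) \<partial>std_normal_vector J)"
proof -
  interpret M: prob_space M by fact
  interpret P: prob_space "std_normal_vector J" by (rule prob_space_std_normal_vector)
  interpret MP: pair_prob_space M "std_normal_vector J" ..
  have integrable: "integrable (M \<Otimes>\<^sub>M std_normal_vector J) (\<lambda>(\<omega>, g). iexp (\<Sum>j\<in>J. sqrt (2 * a) * g j * X j \<omega>))"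
    by (intro MP.P.integrable_const_bound[of _ 1]) (auto simp: split_beta')
  have "complex_of_real (exp (- (a * (\<Sum>j\<in>J. (X j \<omega>)\<^sup>2))))
      = (\<integral>g. iexp (\<Sum>j\<in>J. sqrt (2 * a) * g j * X j \<omega>) \<partial>std_normal_vector J)" for \<omega>
  proof -
    have "complex_of_real (exp (- (a * (\<Sum>j\<in>J. (X j \<omega>)\<^sup>2)))) = (\<Prod>j\<in>J. complex_of_real (exp (- (a * (X j \<omega>)\<^sup>2))))"
      using J by (simp add: exp_sum sum_distrib_left sum_negf[symmetric] del: sum_negf)
    also have "\<dots> = (\<Prod>j\<in>J. \<integral>g. iexp (sqrt (2 * a) * g * X j \<omega>) \<partial>std_normal_distribution)"
      using exp_square_eq_gaussian_average[OF a_nonneg] by simp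
    also have "\<dots> = (\<integral>g. (\<Prod>j\<in>J. iexp (sqrt (2 * a) * g j * X j \<omega>)) \<partial>std_normal_vector J)"
      using J by (intro integral_prod_std_normal_vector[symmetric]) auto
    finally show ?thesis by (simp only: iexp_sum[OF J])
  qed
  then have "complex_of_real (\<integral>\<omega>. exp (- (a * (\<Sum>j\<in>J. (X j \<omega>)\<^sup>2))) \<partial>M)
      = (\<integral>\<omega>. (\<integral>g. iexp (\<Sum>j\<in>J. sqrt (2 * a) * g j * X j \<omega>) \<partial>std_normal_vector J) \<partial>M)"
    by (simp flip: integral_complex_of_real)
  also have "\<dots> = (\<integral>g. (\<integral>\<omega>. iexp (\<Sum>j\<in>J. sqrt (2 * a) * g j * X j \<omega>) \<partial>M) \<partial>std_normal_vector J)"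
    by (rule MP.Fubini_integral[OF integrable, symmetric])
  finally show ?thesis .
qed

lemma char_conv_imp_laplace_square_norm_conv:
  fixes X :: "nat \<Rightarrow> 'i \<Rightarrow> 'a \<Rightarrow> real" and Y :: "'i \<Rightarrow> 'b \<Rightarrow> real" and a :: real
  assumes M: "\<And>k. prob_space (M k)" and L: "prob_space L" and J: "finite J" and a_nonneg: "a \<ge> 0"
    and X: "\<And>k j. j \<in> J \<Longrightarrow> X k j \<in> borel_measurable (M k)"
    and Y: "\<And>j. j \<in> J \<Longrightarrow> Y j \<in> borel_measurable L"
    and char: "\<And>\<theta>. (\<lambda>k. \<integral>\<omega>. iexp (\<Sum>j\<in>J. \<theta> j * X k j \<omega>) \<partial>M k)
        \<longlonglongrightarrow> (\<integral>\<omega>. iexp (\<Sum>j\<in>J. \<theta> j * Y j \<omega>) \<partial>L)"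
  shows "(\<lambda>k. \<integral>\<omega>. exp (- (a * (\<Sum>j\<in>J. (X k j \<omega>)\<^sup>2))) \<partial>M k)
    \<longlonglongrightarrow> (\<integral>\<omega>. exp (- (a * (\<Sum>j\<in>J. (Y j \<omega>)\<^sup>2))) \<partial>L)"
proof -
  interpret P: prob_space "std_normal_vector J" by (rule prob_space_std_normal_vector)
  have meas: "(\<lambda>g. \<integral>\<omega>. iexp (\<Sum>j\<in>J. sqrt (2 * a) * g j * Z j \<omega>) \<partial>N') \<in> borel_measurable (std_normal_vector J)"
    if "prob_space N'" and [measurable]: "\<And>j. j \<in> J \<Longrightarrow> Z j \<in> borel_measurable N'" for N' :: "'c measure" and Z
  proof -
    interpret prob_space N' by fact
    show ?thesis
      by (rule borel_measurable_lebesgue_integral) (auto simp: split_beta')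
  qed
  have bound: "cmod (\<integral>\<omega>. iexp (\<Sum>j\<in>J. sqrt (2 * a) * g j * X k j \<omega>) \<partial>M k) \<le> 1" for k g
  proof -
    interpret prob_space "M k" by (rule M)
    show ?thesis
      by (rule order_trans[OF integral_norm_bound]) (simp add: prob_space del: of_real_sum)
  qed
  have "(\<lambda>k. \<integral>g. (\<integral>\<omega>. iexp (\<Sum>j\<in>J. sqrt (2 * a) * g j * X k j \<omega>) \<partial>M k) \<partial>std_normal_vector J)
    \<longlonglongrightarrow> (\<integral>g. (\<integral>\<omega>. iexp (\<Sum>j\<in>J. sqrt (2 * a) * g j * Y j \<omega>) \<partial>L) \<partial>std_normal_vector J)"
    by (rule integral_dominated_convergence[where w="\<lambda>_. 1"])
      (simp_all only: meas M L X Y char bound P.integrable_const AE_I2)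
  then show ?thesis
    using laplace_square_norm_eq_gaussian_average[OF M J X a_nonneg]
      laplace_square_norm_eq_gaussian_average[OF L J Y a_nonneg]
    by (simp flip: tendsto_of_real_iff[where 'a=complex])
qed

lemma std_normal_shifted_square_density:
  fixes a \<mu> x :: real
  assumes a_nonneg: "a \<ge> 0"
  shows "std_normal_density x * exp (- (a * (x + \<mu>)\<^sup>2))
    = exp (- (a * \<mu>\<^sup>2 / (1 + 2 * a))) / sqrt (1 + 2 * a)
      * normal_density (- (2 * a * \<mu> / (1 + 2 * a))) (1 / sqrt (1 + 2 * a)) x"
proof -
  define \<sigma> where "\<sigma> = 1 / sqrt (1 + 2 * a)"
  define c where "c = - (2 * a * \<mu> / (1 + 2 * a))"
  have pos: "1 + 2 * a > 0" using a_nonneg by simp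
  have \<sigma>: "\<sigma>\<^sup>2 = 1 / (1 + 2 * a)" using pos by (auto simp: \<sigma>_def power_divide)
  have square: "- x\<^sup>2 / 2 - a * (x + \<mu>)\<^sup>2 = - (a * \<mu>\<^sup>2 / (1 + 2 * a)) - (x - c)\<^sup>2 / (2 * \<sigma>\<^sup>2)"
    unfolding \<sigma> c_def using pos by (simp add: divide_simps) algebra
  have norm: "sqrt (2 * pi * \<sigma>\<^sup>2) = sqrt (2 * pi) / sqrt (1 + 2 * a)"
    unfolding \<sigma> by (simp add: real_sqrt_divide real_sqrt_mult)
  have "std_normal_density x * exp (- (a * (x + \<mu>)\<^sup>2)) = exp (- x\<^sup>2 / 2 - a * (x + \<mu>)\<^sup>2) / sqrt (2 * pi)"
    by (simp add: std_normal_density_def exp_add[symmetric])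
  also have "\<dots> = exp (- (a * \<mu>\<^sup>2 / (1 + 2 * a))) * exp (- ((x - c)\<^sup>2 / (2 * \<sigma>\<^sup>2))) / sqrt (2 * pi)"
    unfolding square by (simp add: exp_add[symmetric])
  also have "\<dots> = exp (- (a * \<mu>\<^sup>2 / (1 + 2 * a))) / sqrt (1 + 2 * a) * normal_density c \<sigma> x"
    unfolding normal_density_def norm using pos by (simp add: field_simps)
  finally show ?thesis by (simp add: c_def \<sigma>_def)
qed

lemma laplace_shifted_square_std_normal:
  fixes a \<mu> :: real
  assumes a_nonneg: "a \<ge> 0"
  shows "(\<integral>x. exp (- (a * (x + \<mu>)\<^sup>2)) \<partial>std_normal_distribution)
    = exp (- (a * \<mu>\<^sup>2 / (1 + 2 * a))) / sqrt (1 + 2 * a)"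
  using a_nonneg by (subst integral_density) (auto simp: std_normal_shifted_square_density[OF a_nonneg])

lemma laplace_shifted_square_norm_std_normal:
  fixes \<mu> :: "'i \<Rightarrow> real" and a :: real
  assumes J: "finite J" and a_nonneg: "a \<ge> 0"
  shows "(\<integral>v. exp (- (a * (\<Sum>j\<in>J. (v j + \<mu> j)\<^sup>2))) \<partial>std_normal_vector J)
    = exp (- (a * (\<Sum>j\<in>J. (\<mu> j)\<^sup>2) / (1 + 2 * a))) / sqrt (1 + 2 * a) ^ card J"
proof -
  have "(\<integral>v. exp (- (a * (\<Sum>j\<in>J. (v j + \<mu> j)\<^sup>2))) \<partial>std_normal_vector J)
      = (\<integral>v. (\<Prod>j\<in>J. exp (- (a * (v j + \<mu> j)\<^sup>2))) \<partial>std_normal_vector J)"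
    using J by (simp add: exp_sum[symmetric] sum_distrib_left sum_negf)
  also have "\<dots> = (\<Prod>j\<in>J. \<integral>x. exp (- (a * (x + \<mu> j)\<^sup>2)) \<partial>std_normal_distribution)"
    using J a_nonneg by (intro integral_prod_std_normal_vector) auto
  also have "\<dots> = exp (- (a * (\<Sum>j\<in>J. (\<mu> j)\<^sup>2) / (1 + 2 * a))) / sqrt (1 + 2 * a) ^ card J"
    using J by (simp add: laplace_shifted_square_std_normal[OF a_nonneg] prod_dividef exp_sum[symmetric]
        sum_distrib_left sum_divide_distrib sum_negf)
  finally show ?thesis .
qed

lemma char_shifted_std_normal_vector:
  fixes \<mu> \<theta> :: "'i \<Rightarrow> real"
  assumes J: "finite J"
  shows "(\<integral>v. iexp (\<Sum>j\<in>J. \<theta> j * (v j + \<mu> j)) \<partial>std_normal_vector J)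
    = exp (- (\<Sum>j\<in>J. (\<theta> j)\<^sup>2) / 2 + \<i> * (\<Sum>j\<in>J. \<theta> j * \<mu> j))"
proof -
  have char_coordinate: "(\<integral>x. iexp (\<theta> j * (x + \<mu> j)) \<partial>std_normal_distribution)
      = exp (- (complex_of_real (\<theta> j))\<^sup>2 / 2 + \<i> * (\<theta> j * \<mu> j))" for j
  proof -
    have "(\<integral>x. iexp (\<theta> j * (x + \<mu> j)) \<partial>std_normal_distribution)
       = (\<integral>x. iexp (\<theta> j * x) * iexp (\<theta> j * \<mu> j) \<partial>std_normal_distribution)"
      by (intro Bochner_Integration.integral_cong) (auto simp: exp_add[symmetric] algebra_simps)
    also have "\<dots> = char std_normal_distribution (\<theta> j) * iexp (\<theta> j * \<mu> j)"
      unfolding char_def by simp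
    also have "\<dots> = exp (- (complex_of_real (\<theta> j))\<^sup>2 / 2) * iexp (\<theta> j * \<mu> j)"
      unfolding char_std_normal_distribution by (simp add: exp_of_real[symmetric])
    finally show ?thesis by (simp only: exp_add)
  qed
  have "(\<integral>v. iexp (\<Sum>j\<in>J. \<theta> j * (v j + \<mu> j)) \<partial>std_normal_vector J)
      = (\<Prod>j\<in>J. \<integral>x. iexp (\<theta> j * (x + \<mu> j)) \<partial>std_normal_distribution)"
    unfolding iexp_sum[OF J] using J by (intro integral_prod_std_normal_vector) auto
  also have "\<dots> = exp (\<Sum>j\<in>J. - (complex_of_real (\<theta> j))\<^sup>2 / 2 + \<i> * (\<theta> j * \<mu> j))"
    unfolding char_coordinate using J by (rule exp_sum[symmetric])
  also have "\<dots> = exp (- (\<Sum>j\<in>J. (\<theta> j)\<^sup>2) / 2 + \<i> * (\<Sum>j\<in>J. \<theta> j * \<mu> j))"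
    by (simp add: sum_subtractf sum_distrib_left sum_divide_distrib)
  finally show ?thesis .
qed

lemma emeasure_std_normal_finite:
  assumes "finite B"
  shows "emeasure std_normal_distribution B = 0"
proof -
  have "B \<in> null_sets lborel" using assms by (simp add: finite_imp_null_set_lborel)
  then have "B \<in> null_sets std_normal_distribution"
    using absolutely_continuousI_density[of std_normal_density lborel]
    by (auto simp: absolutely_continuous_def)
  then show ?thesis by auto
qed

lemma shifted_square_norm_std_normal_null:
  fixes \<mu> :: "'i \<Rightarrow> real"
  assumes J: "finite J" "i \<in> J"
  shows "emeasure (std_normal_vector J)
    {v \<in> space (std_normal_vector J). (\<Sum>j\<in>J. (v j + \<mu> j)\<^sup>2) = y} = 0" (is "emeasure _ ?A = 0")
proof -
  interpret product_prob_space "\<lambda>_. std_normal_distribution" J ..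
  obtain I where I: "J = insert i I" "i \<notin> I" "finite I"
    using J by (metis finite_insert mk_disjoint_insert)
  have A[measurable]: "?A \<in> sets (std_normal_vector J)" by measurable
  have slice: "(\<integral>\<^sup>+t. indicator ?A (x(i := t)) \<partial>std_normal_distribution) = 0" for x
  proof -
    let ?r = "y - (\<Sum>j\<in>I. (x j + \<mu> j)\<^sup>2)"
    let ?B = "{sqrt ?r - \<mu> i, - sqrt ?r - \<mu> i}"
    have "t \<in> ?B" if "x(i := t) \<in> ?A" for t
    proof -
      have "(\<Sum>j\<in>I. ((x(i := t)) j + \<mu> j)\<^sup>2) = (\<Sum>j\<in>I. (x j + \<mu> j)\<^sup>2)"
        using I by (intro sum.cong) auto
      then have "(t + \<mu> i)\<^sup>2 = ?r" using that I by simp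
      then have "\<bar>t + \<mu> i\<bar> = sqrt ?r" by (metis real_sqrt_abs)
      then show ?thesis by auto
    qed
    then have "(\<integral>\<^sup>+t. indicator ?A (x(i := t)) \<partial>std_normal_distribution)
        \<le> (\<integral>\<^sup>+t. indicator ?B t \<partial>std_normal_distribution)"
      by (intro nn_integral_mono) (auto simp: indicator_def)
    also have "\<dots> = emeasure std_normal_distribution ?B" by (rule nn_integral_indicator) auto
    also have "\<dots> = 0" by (rule emeasure_std_normal_finite) simp
    finally show ?thesis by simp
  qed
  have "emeasure (std_normal_vector J) ?A = (\<integral>\<^sup>+v. indicator ?A v \<partial>std_normal_vector J)"
    using A by simp
  also have "\<dots> = (\<integral>\<^sup>+x. (\<integral>\<^sup>+t. indicator ?A (x(i := t)) \<partial>std_normal_distribution) \<partial>std_normal_vector I)"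
    using I A unfolding I(1) by (intro product_nn_integral_insert) auto
  finally show ?thesis by (simp add: slice)
qed

section \<open>The noncentral chi-square distribution\<close>

definition ncchisq_form :: "nat \<Rightarrow> real \<Rightarrow> (nat \<Rightarrow> real) \<Rightarrow> real" where
  "ncchisq_form m lam v = (\<Sum>i<m. (v i + (if i = 0 then sqrt lam else 0))\<^sup>2)"

definition ncchisq_distr :: "nat \<Rightarrow> real \<Rightarrow> real measure" where
  "ncchisq_distr m lam = distr (std_normal_vector {..<m}) borel (ncchisq_form m lam)"

lemma ncchisq_form_measurable[measurable]: "ncchisq_form m lam \<in> borel_measurable (std_normal_vector {..<m})"
  unfolding ncchisq_form_def[abs_def] by measurable

lemma ncchisq_form_nonneg: "0 \<le> ncchisq_form m lam v"
  unfolding ncchisq_form_def by (intro sum_nonneg) auto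

lemma real_distribution_ncchisq_distr: "real_distribution (ncchisq_distr m lam)"
  unfolding ncchisq_distr_def
  by (rule prob_space.real_distribution_distr[OF prob_space_std_normal_vector]) measurable

lemma ncchisq_cdf_eq_cdf: "ncchisq_cdf m lam = cdf (ncchisq_distr m lam)"
  unfolding ncchisq_cdf_def ncchisq_distr_def cdf_def ncchisq_form_def[symmetric]
  by (subst measure_distr) (auto simp: vimage_def Int_def conj_commute)

lemma isCont_ncchisq_cdf:
  assumes "m \<ge> 1"
  shows "isCont (ncchisq_cdf m lam) y"
proof -
  interpret real_distribution "ncchisq_distr m lam" by (rule real_distribution_ncchisq_distr)
  have "measure (ncchisq_distr m lam) {y}
      = measure (std_normal_vector {..<m}) {v \<in> space (std_normal_vector {..<m}). ncchisq_form m lam v = y}"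
    unfolding ncchisq_distr_def by (subst measure_distr) (auto simp: vimage_def Int_def conj_commute)
  also have "\<dots> = 0"
    using shifted_square_norm_std_normal_null[of "{..<m}" 0] assms by (simp add: measure_def ncchisq_form_def)
  finally show ?thesis by (simp add: ncchisq_cdf_eq_cdf isCont_cdf)
qed

lemma laplace_ncchisq_form:
  assumes "m \<ge> 1" "lam \<ge> 0" "a \<ge> 0"
  shows "(\<integral>v. exp (- (a * ncchisq_form m lam v)) \<partial>std_normal_vector {..<m})
    = exp (- (a * lam / (1 + 2 * a))) / sqrt (1 + 2 * a) ^ m"
proof -
  have "(\<Sum>i<m. (if i = 0 then sqrt lam else 0)\<^sup>2) = (\<Sum>i<m. if i = 0 then lam else 0)"
    using assms by (intro sum.cong) auto
  also have "\<dots> = lam" using assms by (subst sum.delta) auto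
  finally show ?thesis
    using laplace_shifted_square_norm_std_normal[of "{..<m}" a "\<lambda>i. if i = 0 then sqrt lam else 0"] assms
    by (simp add: ncchisq_form_def)
qed

lemma laplace_imp_uniform_limit_ncchisq_cdf:
  fixes M :: "nat \<Rightarrow> 'a measure" and T :: "nat \<Rightarrow> 'a \<Rightarrow> real"
  assumes M: "\<And>k. prob_space (M k)" and T[measurable]: "\<And>k. T k \<in> borel_measurable (M k)"
    and T_nonneg: "\<And>k \<omega>. 0 \<le> T k \<omega>" and m: "m \<ge> 1" and lam_nonneg: "lam \<ge> 0"
    and laplace: "\<And>a. a \<ge> 0 \<Longrightarrow> (\<lambda>k. \<integral>\<omega>. exp (- (a * T k \<omega>)) \<partial>M k)
      \<longlonglongrightarrow> exp (- (a * lam / (1 + 2 * a))) / sqrt (1 + 2 * a) ^ m"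
  shows "uniform_limit UNIV (\<lambda>k y. measure (M k) {\<omega> \<in> space (M k). T k \<omega> \<le> y}) (ncchisq_cdf m lam) sequentially"
proof -
  have "weak_conv_m (\<lambda>k. distr (M k) borel (T k)) (ncchisq_distr m lam)"
    unfolding ncchisq_distr_def
    by (rule laplace_imp_weak_conv[OF M prob_space_std_normal_vector])
      (use laplace laplace_ncchisq_form[OF m lam_nonneg] in \<open>auto simp: T_nonneg ncchisq_form_nonneg\<close>)
  then have "uniform_limit UNIV (\<lambda>k. cdf (distr (M k) borel (T k))) (ncchisq_cdf m lam) sequentially"
    using M unfolding ncchisq_cdf_eq_cdf
    by (intro weak_conv_imp_uniform_limit_cdf real_distribution_ncchisq_distr
        isCont_ncchisq_cdf[OF m, unfolded ncchisq_cdf_eq_cdf] prob_space.real_distribution_distr) auto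
  moreover have "cdf (distr (M k) borel (T k)) = (\<lambda>y. measure (M k) {\<omega> \<in> space (M k). T k \<omega> \<le> y})" for k
    unfolding cdf_def by (subst measure_distr) (auto simp: vimage_def Int_def conj_commute)
  ultimately show ?thesis by (simp only:)
qed

lemma ncchisq_cdf_uniform_limit:
  assumes m: "m \<ge> 1" and lam: "\<And>k. lam k \<ge> 0" "l \<ge> 0" "lam \<longlonglongrightarrow> l"
  shows "uniform_limit UNIV (\<lambda>k. ncchisq_cdf m (lam k)) (ncchisq_cdf m l) sequentially"
proof -
  have "uniform_limit UNIV (\<lambda>k y. measure (std_normal_vector {..<m})
      {v \<in> space (std_normal_vector {..<m}). ncchisq_form m (lam k) v \<le> y}) (ncchisq_cdf m l) sequentially"
  proof (rule laplace_imp_uniform_limit_ncchisq_cdf[OF prob_space_std_normal_vector])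
    fix a :: real assume a_nonneg: "a \<ge> 0"
    then show "(\<lambda>k. \<integral>v. exp (- (a * ncchisq_form m (lam k) v)) \<partial>std_normal_vector {..<m})
      \<longlonglongrightarrow> exp (- (a * l / (1 + 2 * a))) / sqrt (1 + 2 * a) ^ m"
      unfolding laplace_ncchisq_form[OF m lam(1) a_nonneg] by (intro tendsto_intros lam) auto
  qed (use m lam ncchisq_form_nonneg in auto)
  then show ?thesis
    unfolding ncchisq_cdf_def[abs_def] ncchisq_form_def .
qed

section \<open>Normalised sums of bounded independent variables\<close>

lemma power_tendsto_exp:
  fixes c :: "nat \<Rightarrow> complex"
  assumes N: "filterlim N at_top sequentially" and lim: "(\<lambda>k. of_nat (N k) * (c k - 1)) \<longlonglongrightarrow> a"
  shows "(\<lambda>k. c k ^ N k) \<longlonglongrightarrow> exp a"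
proof -
  have N_real: "filterlim (\<lambda>k. real (N k)) at_top sequentially"
    by (rule filterlim_compose[OF filterlim_real_sequentially N])
  have N_pos: "\<forall>\<^sub>F k in sequentially. N k > 0"
    by (rule eventually_compose_filterlim[OF eventually_gt_at_top N])
  have "(\<lambda>k. of_nat (N k) * (c k - 1) / of_nat (N k)) \<longlonglongrightarrow> 0"
    using N_real by (intro tendsto_divide_0[OF lim]) (simp add: filterlim_at_infinity_conv_norm_at_top)
  moreover have "\<forall>\<^sub>F k in sequentially. of_nat (N k) * (c k - 1) / of_nat (N k) = c k - 1"
    using N_pos by eventually_elim simp
  ultimately have c_tendsto: "c \<longlonglongrightarrow> 1"
    by (simp add: tendsto_cong LIM_zero_iff)
  obtain q where q: "\<And>w. Ln w = q w * (w - 1)" "isCont q 1" "q 1 = (1 :: complex)"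
    using has_field_derivative_Ln[of 1] unfolding CARAT_DERIV by auto
  have "(\<lambda>k. q (c k) * (of_nat (N k) * (c k - 1))) \<longlonglongrightarrow> 1 * a"
    using isCont_tendsto_compose[OF q(2) c_tendsto] q(3) by (intro tendsto_mult lim) simp
  then have "(\<lambda>k. of_nat (N k) * Ln (c k)) \<longlonglongrightarrow> a"
    unfolding q(1) by (simp add: mult_ac)
  then have exp_lim: "(\<lambda>k. exp (of_nat (N k) * Ln (c k))) \<longlonglongrightarrow> exp a" by (intro tendsto_intros)
  have "\<forall>\<^sub>F k in sequentially. c k \<noteq> 0" using c_tendsto by (rule tendsto_imp_eventually_ne) simp
  then have "\<forall>\<^sub>F k in sequentially. exp (of_nat (N k) * Ln (c k)) = c k ^ N k"
    by eventually_elim (simp add: exp_of_nat_mult)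
  with exp_lim show ?thesis by (simp add: tendsto_cong)
qed

lemma (in prob_space) expectation_iexp_second_order:
  fixes X :: "'a \<Rightarrow> real"
  assumes [measurable]: "X \<in> borel_measurable M" and H: "\<And>\<omega>. \<omega> \<in> space M \<Longrightarrow> \<bar>X \<omega>\<bar> \<le> H"
  shows "cmod (expectation (\<lambda>\<omega>. iexp (t * X \<omega>))
      - (1 + \<i> * (t * expectation X) - t\<^sup>2 / 2 * expectation (\<lambda>\<omega>. (X \<omega>)\<^sup>2))) \<le> (\<bar>t\<bar> * H) ^ 3 / 6"
proof -
  let ?P = "\<lambda>\<omega>. 1 + \<i> * complex_of_real (t * X \<omega>) - complex_of_real (t\<^sup>2 / 2 * (X \<omega>)\<^sup>2)"
  have integrable_X: "integrable M X" using H by (intro bounded_integrable[of _ H]) auto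
  have "(X \<omega>)\<^sup>2 \<le> H\<^sup>2" if "\<omega> \<in> space M" for \<omega>
    using power_mono[OF H[OF that] abs_ge_zero, of 2] by simp
  then have square_integrable: "integrable M (\<lambda>\<omega>. (X \<omega>)\<^sup>2)" by (intro bounded_integrable[of _ "H\<^sup>2"]) auto
  have integrable: "integrable M (\<lambda>\<omega>. complex_of_real (t * X \<omega>))"
    "integrable M (\<lambda>\<omega>. complex_of_real (t\<^sup>2 / 2 * (X \<omega>)\<^sup>2))"
    by (intro integrable_of_real integrable_mult_right integrable_X square_integrable)+
  have integrable_P: "integrable M ?P"
    by (intro Bochner_Integration.integrable_diff Bochner_Integration.integrable_add integrable_const
        integrable_mult_right integrable)
  have expectation_P: "expectation ?P = 1 + \<i> * (t * expectation X) - t\<^sup>2 / 2 * expectation (\<lambda>\<omega>. (X \<omega>)\<^sup>2)"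
    using integrable
    by (simp only: Bochner_Integration.integral_diff Bochner_Integration.integral_add integrable_const
        Bochner_Integration.integrable_add integrable_mult_right integral_mult_right_zero integral_complex_of_real)
      (simp add: prob_space)
  have "cmod (iexp (t * X \<omega>) - ?P \<omega>) \<le> (\<bar>t\<bar> * H) ^ 3 / 6" if "\<omega> \<in> space M" for \<omega>
  proof -
    have "{..2::nat} = {0, 1, 2}" by auto
    then have "?P \<omega> = (\<Sum>k\<le>2. (\<i> * complex_of_real (t * X \<omega>)) ^ k / fact k)"
      by (simp add: power_mult_distrib)
    then have "cmod (iexp (t * X \<omega>) - ?P \<omega>) \<le> \<bar>t * X \<omega>\<bar> ^ 3 / 6"
      using iexp_approx1[of "t * X \<omega>" 2] by (simp add: fact_numeral numeral_3_eq_3)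
    also have "\<dots> \<le> (\<bar>t\<bar> * H) ^ 3 / 6"
      unfolding abs_mult using H[OF that] by (intro divide_right_mono power_mono mult_left_mono) auto
    finally show ?thesis .
  qed
  then show ?thesis
    unfolding expectation_P[symmetric]
    by (intro norm_expectation_diff_le integrable_P bounded_integrable[of _ 1]) auto
qed

lemma bounded_iid_char_limit:
  fixes G :: "nat \<Rightarrow> 'a measure" and h :: "'a \<Rightarrow> real"
  assumes G: "\<And>k. prob_space (G k)" and h: "\<And>k. h \<in> borel_measurable (G k)" "\<And>x. \<bar>h x\<bar> \<le> H"
    and N: "filterlim N at_top sequentially" "\<And>k. N k \<ge> 1"
    and mean: "(\<lambda>k. sqrt (real (N k)) * (\<integral>x. h x \<partial>G k)) \<longlonglongrightarrow> m"
    and var: "(\<lambda>k. \<integral>x. (h x)\<^sup>2 \<partial>G k) \<longlonglongrightarrow> v"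
  shows "(\<lambda>k. (\<integral>x. iexp (h x / sqrt (real (N k))) \<partial>G k) ^ N k) \<longlonglongrightarrow> exp (\<i> * m - v / 2)"
proof (rule power_tendsto_exp[OF N(1)])
  define c where "c k = (\<integral>x. iexp (h x / sqrt (real (N k))) \<partial>G k)" for k
  define a where "a k = \<i> * (sqrt (real (N k)) * (\<integral>x. h x \<partial>G k)) - (\<integral>x. (h x)\<^sup>2 \<partial>G k) / 2" for k
  have bound: "cmod (of_nat (N k) * (c k - 1) - a k) \<le> H ^ 3 / 6 / sqrt (real (N k))" for k
  proof -
    interpret prob_space "G k" by (rule G)
    define r where "r = sqrt (real (N k))"
    have r_pos: "r > 0" "real (N k) = r * r" using N(2)[of k] by (auto simp: r_def)
    have N_r: "of_nat (N k) = complex_of_real r * complex_of_real r"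
      by (simp flip: r_pos(2) of_real_mult)
    define e where "e = 1 / r * expectation h"
    define w where "w = (1 / r)\<^sup>2 * expectation (\<lambda>x. (h x)\<^sup>2)"
    let ?d = "c k - (1 + \<i> * e - w / 2)"
    have "r * expectation h = r * r * e" "expectation (\<lambda>x. (h x)\<^sup>2) = r * r * w"
      using r_pos(1) by (simp_all add: e_def w_def power2_eq_square)
    then have a_eq: "a k = \<i> * complex_of_real (r * r * e) - complex_of_real (r * r * w / 2)"
      unfolding a_def r_def[symmetric] by (simp only:)
    have "of_nat (N k) * (c k - 1) - a k = of_nat (N k) * ?d"
      unfolding a_eq N_r of_real_mult of_real_divide by (simp add: algebra_simps)
    then have "cmod (of_nat (N k) * (c k - 1) - a k) = real (N k) * cmod ?d"
      by (simp add: norm_mult)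
    also have "\<dots> \<le> real (N k) * ((\<bar>1 / r\<bar> * H) ^ 3 / 6)"
      using expectation_iexp_second_order[of h H "1 / r", OF h]
      by (intro mult_left_mono) (simp_all add: c_def e_def w_def r_def)
    also have "\<dots> = H ^ 3 / 6 / r"
      unfolding r_pos(2) using r_pos(1) by (simp add: power_divide power3_eq_cube)
    finally show ?thesis by (simp add: r_def)
  qed
  have "filterlim (\<lambda>k. sqrt (real (N k))) at_top sequentially"
    by (intro filterlim_compose[OF sqrt_at_top] filterlim_compose[OF filterlim_real_sequentially N(1)])
  then have lim: "(\<lambda>k. H ^ 3 / 6 / sqrt (real (N k))) \<longlonglongrightarrow> 0"
    by (rule real_tendsto_divide_at_top[OF tendsto_const])
  have "(\<lambda>k. of_nat (N k) * (c k - 1) - a k) \<longlonglongrightarrow> 0"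
    by (rule Lim_null_comparison[OF always_eventually[OF allI[OF bound]] lim])
  moreover have "a \<longlonglongrightarrow> \<i> * m - v / 2"
    unfolding a_def by (intro tendsto_diff tendsto_mult tendsto_const tendsto_of_real tendsto_divide mean var) simp
  ultimately show "(\<lambda>k. of_nat (N k) * ((\<integral>x. iexp (h x / sqrt (real (N k))) \<partial>G k) - 1)) \<longlonglongrightarrow> \<i> * m - v / 2"
    using tendsto_add[of "\<lambda>k. of_nat (N k) * (c k - 1) - a k" 0 _ a] by (simp add: c_def)
qed

section \<open>Contaminated noise\<close>

definition noise :: "(int \<Rightarrow> 'a \<Rightarrow> real) \<Rightarrow> (int \<Rightarrow> 'a \<Rightarrow> real) \<Rightarrow> (int \<Rightarrow> 'a \<Rightarrow> real) \<Rightarrow>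
    int + int + int \<Rightarrow> 'a \<Rightarrow> real" where
  "noise eps z xi k = (case k of Inl t \<Rightarrow> eps t | Inr (Inl t) \<Rightarrow> z t | Inr (Inr t) \<Rightarrow> xi t)"

definition noise_algebra :: "'a measure \<Rightarrow> (int \<Rightarrow> 'a \<Rightarrow> real) \<Rightarrow> (int \<Rightarrow> 'a \<Rightarrow> real) \<Rightarrow>
    (int \<Rightarrow> 'a \<Rightarrow> real) \<Rightarrow> (int + int + int) set \<Rightarrow> 'a measure" where
  "noise_algebra M eps z xi J = vimage_algebra (space M)
     (\<lambda>\<omega>. \<lambda>k\<in>J. noise eps z xi k \<omega>) (PiM J (\<lambda>_. borel))"

locale contam_noise = prob_space M
  for M :: "'a measure" and G GE :: "real measure" and g :: real
    and eps z xi :: "int \<Rightarrow> 'a \<Rightarrow> real" +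
  assumes G: "is_real_distr G" and GE: "is_real_distr GE"
    and indep: "indep_vars (\<lambda>_. borel) (noise eps z xi) UNIV"
    and eps_distr: "\<And>t. distr M borel (eps t) = G"
    and xi_distr: "\<And>t. distr M borel (xi t) = GE"
    and z01: "\<And>t \<omega>. \<omega> \<in> space M \<Longrightarrow> z t \<omega> \<in> {0, 1}"
    and z_prob: "\<And>t. measure M {\<omega>\<in>space M. z t \<omega> = 1} = g"
begin

abbreviation "\<F> \<equiv> noise_algebra M eps z xi"

lemma noise_measurable[measurable]: "noise eps z xi k \<in> borel_measurable M"
  using indep by (simp add: indep_vars_def)

lemma eps_measurable[measurable]: "eps t \<in> borel_measurable M"
  using noise_measurable[of "Inl t"] by (simp add: noise_def)

lemma z_measurable[measurable]: "z t \<in> borel_measurable M"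
  using noise_measurable[of "Inr (Inl t)"] by (simp add: noise_def)

lemma xi_measurable[measurable]: "xi t \<in> borel_measurable M"
  using noise_measurable[of "Inr (Inr t)"] by (simp add: noise_def)

lemma space_\<F>[simp]: "space (\<F> J) = space M"
  by (simp add: noise_algebra_def)

lemma noise_measurable_\<F>:
  assumes "k \<in> J"
  shows "noise eps z xi k \<in> borel_measurable (\<F> J)"
proof -
  have "(\<lambda>\<omega>. \<lambda>k\<in>J. noise eps z xi k \<omega>) \<in> measurable (\<F> J) (PiM J (\<lambda>_. borel))"
    unfolding noise_algebra_def by (rule measurable_vimage_algebra1) (auto simp: space_PiM)
  from measurable_compose[OF this measurable_component_singleton[OF assms]] show ?thesis
    using assms by simp
qed

lemma eps_measurable_\<F>: "Inl t \<in> J \<Longrightarrow> eps t \<in> borel_measurable (\<F> J)"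
  using noise_measurable_\<F>[of "Inl t"] by (simp add: noise_def)

lemma z_measurable_\<F>: "Inr (Inl t) \<in> J \<Longrightarrow> z t \<in> borel_measurable (\<F> J)"
  using noise_measurable_\<F>[of "Inr (Inl t)"] by (simp add: noise_def)

lemma xi_measurable_\<F>: "Inr (Inr t) \<in> J \<Longrightarrow> xi t \<in> borel_measurable (\<F> J)"
  using noise_measurable_\<F>[of "Inr (Inr t)"] by (simp add: noise_def)

lemma measurable_\<F>_mono:
  assumes "X \<in> measurable (\<F> J) N" "J \<subseteq> J'"
  shows "X \<in> measurable (\<F> J') N"
proof -
  have "(\<lambda>\<omega>. \<omega>) \<in> measurable (\<F> J') (\<F> J)"
    unfolding noise_algebra_def[of _ _ _ _ J]
    using assms(2) by (intro measurable_vimage_algebra2) (auto intro!: measurable_restrict noise_measurable_\<F>)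
  from measurable_compose[OF this assms(1)] show ?thesis .
qed

lemma measurable_\<F>_imp_measurable:
  assumes "X \<in> measurable (\<F> J) N"
  shows "X \<in> measurable M N"
proof -
  have "(\<lambda>\<omega>. \<omega>) \<in> measurable M (\<F> J)"
    unfolding noise_algebra_def[of _ _ _ _ J]
    by (intro measurable_vimage_algebra2) (auto intro!: measurable_restrict)
  from measurable_compose[OF this assms(1)] show ?thesis .
qed

lemma preimages_subset_\<F>:
  assumes "X \<in> measurable (\<F> J) S"
  shows "{X -` C \<inter> space M |C. C \<in> sets S}
    \<subseteq> {(\<lambda>\<omega>. \<lambda>k\<in>J. noise eps z xi k \<omega>) -` D \<inter> space M |D. D \<in> sets (PiM J (\<lambda>_. borel))}"
proof -
  have "sets (\<F> J) = {(\<lambda>\<omega>. \<lambda>k\<in>J. noise eps z xi k \<omega>) -` D \<inter> space M |D. D \<in> sets (PiM J (\<lambda>_. borel))}"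
    unfolding noise_algebra_def by (rule sets_vimage_algebra2) (auto simp: space_PiM)
  then show ?thesis
    using measurable_sets[OF assms] by auto
qed

lemma indep_var_\<F>:
  assumes disjoint: "A \<inter> B = {}" and X: "X \<in> measurable (\<F> A) S" and Y: "Y \<in> measurable (\<F> B) T"
  shows "indep_var S X T Y"
proof -
  have "indep_var (PiM A (\<lambda>_. borel)) (\<lambda>\<omega>. \<lambda>k\<in>A. noise eps z xi k \<omega>)
      (PiM B (\<lambda>_. borel)) (\<lambda>\<omega>. \<lambda>k\<in>B. noise eps z xi k \<omega>)"
    using disjoint by (intro indep_var_restrict[OF indep]) auto
  then show ?thesis
    unfolding indep_var_eq indep_set_def
    using measurable_\<F>_imp_measurable[OF X] measurable_\<F>_imp_measurable[OF Y]
    by (auto elim!: indep_sets_mono_sets split: bool.split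
        intro!: sigma_sets_mono'[OF preimages_subset_\<F>[OF X], THEN subsetD]
          sigma_sets_mono'[OF preimages_subset_\<F>[OF Y], THEN subsetD])
qed

lemma expectation_mult_\<F>:
  fixes X Y :: "'a \<Rightarrow> 'b::{second_countable_topology, real_normed_field, banach}"
  assumes "A \<inter> B = {}" "X \<in> borel_measurable (\<F> A)" "Y \<in> borel_measurable (\<F> B)"
    and "integrable M X" "integrable M Y"
  shows "expectation (\<lambda>\<omega>. X \<omega> * Y \<omega>) = expectation X * expectation Y"
    and "integrable M (\<lambda>\<omega>. X \<omega> * Y \<omega>)"
  using indep_var_lebesgue_integral[OF indep_var_\<F>[OF assms(1-3)] assms(4,5)]
    indep_var_integrable[OF indep_var_\<F>[OF assms(1-3)] assms(4,5)] by auto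

lemma L1_bound_centered_sum:
  fixes X :: "'t \<Rightarrow> 'a \<Rightarrow> real"
  assumes T: "finite T" and disjoint: "\<And>s t. s \<noteq> t \<Longrightarrow> J s \<inter> J t = {}"
    and X: "\<And>t. X t \<in> borel_measurable (\<F> (J t))" and integrable: "\<And>t. integrable M (X t)"
      "\<And>t. integrable M (\<lambda>\<omega>. (X t \<omega>)\<^sup>2)"
    and mean: "\<And>t. expectation (X t) = c" and second_moment: "\<And>t. expectation (\<lambda>\<omega>. (X t \<omega>)\<^sup>2) \<le> q"
  shows "L1_bound M (\<lambda>\<omega>. \<Sum>t\<in>T. X t \<omega> - c) (sqrt (real (card T)) * sqrt q)"
proof (rule L1_bound_orthogonal_sum[OF T])
  note [measurable] = measurable_\<F>_imp_measurable[OF X]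
  show "(\<lambda>\<omega>. X t \<omega> - c) \<in> borel_measurable M" for t by measurable
  show "integrable M (\<lambda>\<omega>. (X t \<omega> - c)\<^sup>2)" for t
    using integrable by (simp add: power2_diff)
  show "expectation (\<lambda>\<omega>. (X t \<omega> - c)\<^sup>2) \<le> q" for t
  proof -
    have "expectation (\<lambda>\<omega>. (X t \<omega> - c)\<^sup>2) = variance (X t)" by (simp add: mean)
    also have "\<dots> \<le> expectation (\<lambda>\<omega>. (X t \<omega>)\<^sup>2)" by (simp add: variance_eq integrable)
    finally show ?thesis using second_moment[of t] by linarith
  qed
  have centered: "(\<lambda>\<omega>. X t \<omega> - c) \<in> borel_measurable (\<F> (J t))" "integrable M (\<lambda>\<omega>. X t \<omega> - c)"
    "expectation (\<lambda>\<omega>. X t \<omega> - c) = 0" for t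
    using X[of t] integrable by (auto simp: mean prob_space)
  show "expectation (\<lambda>\<omega>. (X s \<omega> - c) * (X t \<omega> - c)) = 0" if "s \<noteq> t" for s t
    using expectation_mult_\<F>(1)[OF disjoint[OF that] centered(1,1,2,2)] by (simp add: centered)
qed

lemma expectation_eps:
  fixes h :: "real \<Rightarrow> 'b::{banach, second_countable_topology}"
  assumes [measurable]: "h \<in> borel_measurable borel"
  shows "expectation (\<lambda>\<omega>. h (eps t \<omega>)) = (\<integral>x. h x \<partial>G)"
  unfolding eps_distr[of t, symmetric] by (subst integral_distr) auto

lemma L1_bound_centered_eps_sum:
  fixes h :: "real \<Rightarrow> real"
  assumes h[measurable]: "h \<in> borel_measurable borel" and bounded: "\<And>e. \<bar>h e\<bar> \<le> 1"
  shows "L1_bound M (\<lambda>\<omega>. \<Sum>t=1..int n. h (eps t \<omega>) - (\<integral>e. h e \<partial>G)) (sqrt (real n))"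
proof -
  have "L1_bound M (\<lambda>\<omega>. \<Sum>t=1..int n. h (eps t \<omega>) - (\<integral>e. h e \<partial>G)) (sqrt (real (card {1..int n})) * sqrt 1)"
  proof (rule L1_bound_centered_sum[where J="\<lambda>t. {Inl t}"])
    show "(\<lambda>\<omega>. h (eps t \<omega>)) \<in> borel_measurable (\<F> {Inl t})" for t
      by (rule measurable_compose[OF eps_measurable_\<F> h]) simp
    show "integrable M (\<lambda>\<omega>. h (eps t \<omega>))" for t
      using bounded by (intro bounded_integrable[of _ 1]) auto
    show integrable: "integrable M (\<lambda>\<omega>. (h (eps t \<omega>))\<^sup>2)" for t
      using bounded by (intro bounded_integrable[of _ 1]) (auto simp: abs_square_le_1)
    show "expectation (\<lambda>\<omega>. (h (eps t \<omega>))\<^sup>2) \<le> 1" for t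
      using integral_mono[OF integrable, of "\<lambda>_. 1" t] bounded by (simp add: abs_square_le_1 prob_space)
  qed (auto simp: expectation_eps[OF h])
  then show ?thesis by simp
qed

lemma expectation_prod_eps:
  fixes h :: "real \<Rightarrow> complex"
  assumes h[measurable]: "h \<in> borel_measurable borel" and bounded: "\<And>y. norm (h y) \<le> 1" and "finite T"
  shows "expectation (\<lambda>\<omega>. \<Prod>t\<in>T. h (eps t \<omega>)) = (\<integral>y. h y \<partial>G) ^ card T"
  using \<open>finite T\<close>
proof (induction T rule: finite_induct)
  case (insert t T)
  have "expectation (\<lambda>\<omega>. h (eps t \<omega>) * (\<Prod>t\<in>T. h (eps t \<omega>)))
      = expectation (\<lambda>\<omega>. h (eps t \<omega>)) * expectation (\<lambda>\<omega>. \<Prod>t\<in>T. h (eps t \<omega>))"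
  proof (rule expectation_mult_\<F>(1)[of "{Inl t}" "Inl ` T"])
    show "(\<lambda>\<omega>. h (eps t \<omega>)) \<in> borel_measurable (\<F> {Inl t})"
      using eps_measurable_\<F>[of t "{Inl t}"] by simp
    show "(\<lambda>\<omega>. \<Prod>t\<in>T. h (eps t \<omega>)) \<in> borel_measurable (\<F> (Inl ` T))"
      using eps_measurable_\<F>[of _ "Inl ` T"] by (intro borel_measurable_prod) simp
    show "integrable M (\<lambda>\<omega>. h (eps t \<omega>))"
      by (rule bounded_integrable[of _ 1]) (use bounded in auto)
    show "integrable M (\<lambda>\<omega>. \<Prod>t\<in>T. h (eps t \<omega>))"
      by (rule bounded_integrable[of _ 1]) (use bounded in \<open>auto simp: prod_norm[symmetric] intro!: prod_le_1\<close>)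
  qed (use insert in auto)
  with insert show ?case by (simp add: expectation_eps)
qed (simp add: prob_space)

end

lemma AR_contam_model_imp_contam_noise:
  assumes "AR_contam_model p \<beta> G GE g M eps z xi u"
  shows "contam_noise M G GE g eps z xi"
proof -
  have "noise eps z xi = (\<lambda>k. case k of Inl t \<Rightarrow> eps t | Inr (Inl t) \<Rightarrow> z t | Inr (Inr t) \<Rightarrow> xi t)"
    by (auto simp: noise_def fun_eq_iff)
  with assms show ?thesis
    unfolding AR_contam_model_def contam_noise_def contam_noise_axioms_def by auto
qed

section \<open>The causal representation of the autoregression\<close>

lemma summable_inverse_fps_of_poly:
  fixes Q :: "complex poly"
  assumes root: "\<And>w. poly Q w = 0 \<Longrightarrow> norm w > 1"
  shows "summable (\<lambda>n. norm (fps_nth (inverse (fps_of_poly Q)) n))"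
proof -
  define r where "r = Min (insert 2 (norm ` {w. poly Q w = 0}))"
  have "Q \<noteq> 0" using root[of 0] by auto
  then have finite_roots: "finite {w. poly Q w = 0}" by (rule poly_roots_finite)
  have r: "r > 1" unfolding r_def using finite_roots root by (subst Min_gr_iff) auto
  have "eval_fps (fps_of_poly Q) w \<noteq> 0" if "ereal (norm w) < ereal r" for w
  proof
    assume "eval_fps (fps_of_poly Q) w = 0"
    then have "r \<le> norm w" unfolding r_def using finite_roots by (intro Min_le) auto
    with that show False by simp
  qed
  then have "min (ereal r) (fps_conv_radius (fps_of_poly Q)) \<le> fps_conv_radius (inverse (fps_of_poly Q))"
    by (rule fps_conv_radius_inverse)
  then have "ereal r \<le> fps_conv_radius (inverse (fps_of_poly Q))" by simp
  then have "conv_radius (fps_nth (inverse (fps_of_poly Q))) > 1"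
    using r unfolding fps_conv_radius_def by (auto intro: less_le_trans[of 1 "ereal r"])
  then show ?thesis
    using abs_summable_in_conv_radius[of 1 "fps_nth (inverse (fps_of_poly Q))"] by (simp add: one_ereal_def)
qed

definition ar_poly :: "nat \<Rightarrow> (nat \<Rightarrow> real) \<Rightarrow> complex poly" where
  "ar_poly p \<beta> = 1 - (\<Sum>i=1..p. monom (of_real (\<beta> i)) i)"

lemma coeff_ar_poly: "coeff (ar_poly p \<beta>) k = (if k = 0 then 1 else if k \<le> p then - of_real (\<beta> k) else 0)"
  by (auto simp: ar_poly_def coeff_sum if_distrib[where f="\<lambda>x. x = _"] cong: if_cong)

lemma causal_coeffs_root_norm_gt_1:
  assumes "causal_coeffs p \<beta>" and root: "poly (ar_poly p \<beta>) w = 0"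
  shows "norm w > 1"
proof -
  have poly: "poly (ar_poly p \<beta>) w = 1 - (\<Sum>i=1..p. of_real (\<beta> i) * w ^ i)"
    by (simp add: ar_poly_def poly_sum poly_monom)
  have "w \<noteq> 0" using root by (auto simp: poly)
  have "(inverse w) ^ (p - i) = inverse w ^ p * w ^ i" if "i \<in> {1..p}" for i
    using that \<open>w \<noteq> 0\<close> by (simp add: power_diff field_simps)
  then have "(\<Sum>i=1..p. of_real (\<beta> i) * (inverse w) ^ (p - i)) = (\<Sum>i=1..p. inverse w ^ p * (of_real (\<beta> i) * w ^ i))"
    by (intro sum.cong) auto
  then have "(inverse w) ^ p - (\<Sum>i=1..p. of_real (\<beta> i) * (inverse w) ^ (p - i)) = inverse w ^ p * poly (ar_poly p \<beta>) w"
    unfolding poly by (simp add: sum_distrib_left right_diff_distrib)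
  then have "cmod (inverse w) < 1"
    using assms unfolding causal_coeffs_def by auto
  then show ?thesis using \<open>w \<noteq> 0\<close> by (simp add: norm_inverse norm_divide field_simps)
qed

lemma causal_coeffs_sum_ne_1:
  assumes "causal_coeffs p \<beta>"
  shows "(\<Sum>i=1..p. \<beta> i) \<noteq> 1"
proof
  assume "(\<Sum>i=1..p. \<beta> i) = 1"
  then have "(\<Sum>i=1..p. complex_of_real (\<beta> i)) = 1" by (metis of_real_1 of_real_sum)
  then show False using assms unfolding causal_coeffs_def by (auto dest!: spec[of _ 1])
qed

definition ma_coeffs :: "nat \<Rightarrow> (nat \<Rightarrow> real) \<Rightarrow> (int \<Rightarrow> real) \<Rightarrow> bool" where
  "ma_coeffs p \<beta> \<psi> \<longleftrightarrow> (\<forall>k<0. \<psi> k = 0) \<and> \<psi> 0 = 1 \<and>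
     (\<forall>k\<ge>1. \<psi> k = (\<Sum>i=1..p. \<beta> i * \<psi> (k - int i))) \<and> summable (\<lambda>n. \<bar>\<psi> (int n)\<bar>)"

lemma ex_ma_coeffs:
  assumes "causal_coeffs p \<beta>"
  shows "\<exists>\<psi>. ma_coeffs p \<beta> \<psi>"
proof -
  define f where "f = inverse (fps_of_poly (ar_poly p \<beta>))"
  have summable: "summable (\<lambda>n. norm (fps_nth f n))"
    unfolding f_def by (intro summable_inverse_fps_of_poly causal_coeffs_root_norm_gt_1[OF assms])
  have f_0: "fps_nth f 0 = 1"
    unfolding f_def by (simp add: coeff_ar_poly)
  have f_recursion: "fps_nth f k = (\<Sum>i=1..k. (if i \<le> p then of_real (\<beta> i) else 0) * fps_nth f (k - i))"
    if "k \<ge> 1" for k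
  proof -
    have "fps_of_poly (ar_poly p \<beta>) * f = 1"
      unfolding f_def by (rule inverse_mult_eq_1') (simp add: coeff_ar_poly)
    then have "0 = fps_nth (fps_of_poly (ar_poly p \<beta>) * f) k" using that by simp
    also have "\<dots> = (\<Sum>i=0..k. coeff (ar_poly p \<beta>) i * fps_nth f (k - i))"
      by (simp add: fps_mult_nth)
    also have "\<dots> = fps_nth f k + (\<Sum>i=1..k. coeff (ar_poly p \<beta>) i * fps_nth f (k - i))"
      by (subst sum.atLeast_Suc_atMost) (auto simp: coeff_ar_poly)
    also have "(\<Sum>i=1..k. coeff (ar_poly p \<beta>) i * fps_nth f (k - i))
        = - (\<Sum>i=1..k. (if i \<le> p then of_real (\<beta> i) else 0) * fps_nth f (k - i))"
      unfolding sum_negf[symmetric] by (intro sum.cong) (auto simp: coeff_ar_poly)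
    finally show ?thesis by simp
  qed
  define \<psi> :: "int \<Rightarrow> real" where "\<psi> k = (if k < 0 then 0 else Re (fps_nth f (nat k)))" for k
  have "\<psi> k = (\<Sum>i=1..p. \<beta> i * \<psi> (k - int i))" if "k \<ge> 1" for k
  proof -
    have "\<psi> k = (\<Sum>i=1..nat k. (if i \<le> p then \<beta> i else 0) * Re (fps_nth f (nat k - i)))"
      using f_recursion[of "nat k"] that unfolding \<psi>_def by (auto intro!: sum.cong)
    also have "\<dots> = (\<Sum>i\<in>{1..nat k} \<inter> {1..p}. \<beta> i * \<psi> (k - int i))"
      using that by (intro sum.mono_neutral_cong_right) (auto simp: \<psi>_def nat_diff_distrib')
    also have "\<dots> = (\<Sum>i=1..p. \<beta> i * \<psi> (k - int i))"
      by (intro sum.mono_neutral_cong_left) (auto simp: \<psi>_def)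
    finally show ?thesis .
  qed
  moreover have "summable (\<lambda>n. \<bar>\<psi> (int n)\<bar>)"
    by (rule summable_comparison_test'[OF summable, of 0]) (auto simp: \<psi>_def abs_Re_le_cmod)
  ultimately show ?thesis
    using f_0 by (intro exI[of _ \<psi>]) (auto simp: ma_coeffs_def \<psi>_def)
qed

lemma sum_shift_one:
  fixes f :: "nat \<Rightarrow> 'b::ab_group_add"
  shows "(\<Sum>l=1..i. f (l - 1)) = (\<Sum>l=1..i. f l) + f 0 - f i"
  by (induction i) (auto simp: algebra_simps)

lemma AR_recursion_unrolled:
  fixes u e :: "int \<Rightarrow> real"
  assumes recursion: "\<And>t. u t = (\<Sum>i=1..p. \<beta> i * u (t - int i)) + e t" and \<psi>: "ma_coeffs p \<beta> \<psi>"
  shows "u t - (\<Sum>k<Suc K. \<psi> (int k) * e (t - int k))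
    = (\<Sum>i=1..p. \<Sum>l=1..i. \<beta> i * \<psi> (int (Suc K) - int l) * u (t - int (Suc K) + int l - int i))"
proof (induction K)
  case 0
  have "(\<Sum>l=1..i. \<beta> i * \<psi> (1 - int l) * u (t - 1 + int l - int i)) = \<beta> i * u (t - int i)" if "i \<in> {1..p}" for i
  proof -
    have "(\<Sum>l=1..i. \<beta> i * \<psi> (1 - int l) * u (t - 1 + int l - int i))
        = (\<Sum>l\<in>{1}. \<beta> i * \<psi> (1 - int l) * u (t - 1 + int l - int i))"
      using that \<psi> by (intro sum.mono_neutral_right) (auto simp: ma_coeffs_def)
    then show ?thesis using \<psi> by (simp add: ma_coeffs_def)
  qed
  then show ?case using recursion[of t] \<psi> by (simp add: ma_coeffs_def)
next
  case (Suc K)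
  define k where "k = int (Suc K)"
  define f where "f i l = \<beta> i * \<psi> (k - int l) * u (t - k + int l - int i)" for i l
  have "(\<Sum>i=1..p. \<Sum>l=1..i. \<beta> i * \<psi> (k + 1 - int l) * u (t - (k + 1) + int l - int i))
      = (\<Sum>i=1..p. \<Sum>l=1..i. f i (l - 1))"
    unfolding f_def by (intro sum.cong refl) (simp add: algebra_simps)
  also have "\<dots> = (\<Sum>i=1..p. \<Sum>l=1..i. f i l)
      + (\<psi> k * (\<Sum>i=1..p. \<beta> i * u (t - k - int i)) - (\<Sum>i=1..p. \<beta> i * \<psi> (k - int i)) * u (t - k))"
    unfolding sum_shift_one
    by (simp add: f_def algebra_simps sum.distrib sum_subtractf sum_distrib_left sum_distrib_right)
  also have "(\<Sum>i=1..p. \<beta> i * \<psi> (k - int i)) = \<psi> k"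
    using \<psi> by (simp add: ma_coeffs_def k_def)
  also have "(\<Sum>i=1..p. \<beta> i * u (t - k - int i)) = u (t - k) - e (t - k)"
    using recursion[of "t - k"] by simp
  finally have "(\<Sum>i=1..p. \<Sum>l=1..i. \<beta> i * \<psi> (k + 1 - int l) * u (t - (k + 1) + int l - int i))
      = (\<Sum>i=1..p. \<Sum>l=1..i. f i l) - \<psi> k * e (t - k)"
    by (simp add: algebra_simps)
  moreover have "int (Suc (Suc K)) = k + 1" by (simp add: k_def)
  ultimately show ?case
    using Suc.IH unfolding f_def k_def by (simp only: sum.lessThan_Suc[of _ "Suc K"])
qed

lemma shifted_sum_diff:
  fixes u :: "int \<Rightarrow> real"
  shows "(\<Sum>t=1..int n. u (t - j - int i)) - (\<Sum>t=1..int n. u (t - j))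
    = (\<Sum>l<i. u (- j - int l) - u (int n - j - int l))"
proof (induction i)
  case (Suc i)
  have telescope: "(\<Sum>t=1..int n. w (t - 1)) - (\<Sum>t=1..int n. w t) = w 0 - w (int n)" for w :: "int \<Rightarrow> real"
  proof (induction n)
    case (Suc n)
    have "{1..int (Suc n)} = insert (int (Suc n)) {1..int n}" by auto
    then show ?case using Suc by simp
  qed simp
  have "(\<Sum>t=1..int n. u (t - j - int (Suc i))) - (\<Sum>t=1..int n. u (t - j - int i))
      = u (- j - int i) - u (int n - j - int i)"
    using telescope[of "\<lambda>t. u (t - j - int i)"] by (simp add: algebra_simps)
  with Suc show ?case by simp
qed simp

lemma AR_partial_sum_eq:
  fixes u e :: "int \<Rightarrow> real"
  assumes recursion: "\<And>t. u t = (\<Sum>i=1..p. \<beta> i * u (t - int i)) + e t"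
  shows "(1 - (\<Sum>i=1..p. \<beta> i)) * (\<Sum>t=1..int n. u (t - j))
    = (\<Sum>t=1..int n. e (t - j)) + (\<Sum>i=1..p. \<Sum>l<i. \<beta> i * (u (- j - int l) - u (int n - j - int l)))"
proof -
  let ?A = "\<Sum>t=1..int n. u (t - j)"
  have "?A = (\<Sum>t=1..int n. \<Sum>i=1..p. \<beta> i * u (t - j - int i)) + (\<Sum>t=1..int n. e (t - j))"
    by (subst recursion) (simp add: sum.distrib)
  also have "(\<Sum>t=1..int n. \<Sum>i=1..p. \<beta> i * u (t - j - int i)) = (\<Sum>i=1..p. \<beta> i * (\<Sum>t=1..int n. u (t - j - int i)))"
    by (subst sum.swap) (simp add: sum_distrib_left)
  also have "\<dots> = (\<Sum>i=1..p. \<beta> i * (?A + (\<Sum>l<i. u (- j - int l) - u (int n - j - int l))))"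
    by (intro sum.cong refl arg_cong2[where f=times]) (use shifted_sum_diff[of u j _ n] in \<open>simp add: algebra_simps\<close>)
  also have "\<dots> = (\<Sum>i=1..p. \<beta> i) * ?A + (\<Sum>i=1..p. \<beta> i * (\<Sum>l<i. u (- j - int l) - u (int n - j - int l)))"
    by (simp add: distrib_left sum.distrib sum_distrib_right)
  finally show ?thesis by (simp add: left_diff_distrib sum_distrib_left[of "\<beta> _"])
qed

locale causal_AR = contam_noise M G GE g eps z xi
  for M :: "'a measure" and G GE :: "real measure" and g :: real and eps z xi :: "int \<Rightarrow> 'a \<Rightarrow> real" +
  fixes p :: nat and \<beta> :: "nat \<Rightarrow> real" and u :: "int \<Rightarrow> 'a \<Rightarrow> real" and \<psi> :: "int \<Rightarrow> real" and S :: real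
  assumes \<psi>: "ma_coeffs p \<beta> \<psi>" and sum_ne_1: "(\<Sum>i=1..p. \<beta> i) \<noteq> 1"
    and G_mean: "zero_mean_finite_var G" and G_var: "(\<integral>x. x\<^sup>2 \<partial>G) \<le> S"
    and u_measurable[measurable]: "\<And>t. u t \<in> borel_measurable M"
    and u_rec: "\<And>t \<omega>. \<omega> \<in> space M \<Longrightarrow> u t \<omega> = (\<Sum>i=1..p. \<beta> i * u (t - int i) \<omega>) + eps t \<omega>"
    and u_stationary: "strictly_stationary M u"
begin

definition causal_sum :: "int \<Rightarrow> 'a \<Rightarrow> real" where
  "causal_sum t \<omega> = (\<Sum>k. \<psi> (int k) * eps (t - int k) \<omega>)"

definition causal_partial :: "nat \<Rightarrow> int \<Rightarrow> 'a \<Rightarrow> real" where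
  "causal_partial K t \<omega> = (\<Sum>k<K. \<psi> (int k) * eps (t - int k) \<omega>)"

definition \<Psi> :: real where "\<Psi> = (\<Sum>n. \<bar>\<psi> (int n)\<bar>)"

lemma \<psi>_summable: "summable (\<lambda>n. \<bar>\<psi> (int n)\<bar>)"
  using \<psi> by (simp add: ma_coeffs_def)

lemma \<Psi>_nonneg: "0 \<le> \<Psi>"
  unfolding \<Psi>_def by (rule suminf_nonneg[OF \<psi>_summable]) simp

lemma eps_moments:
  "integrable M (eps t)" "expectation (eps t) = 0" "integrable M (\<lambda>\<omega>. (eps t \<omega>)\<^sup>2)"
  "expectation (\<lambda>\<omega>. (eps t \<omega>)\<^sup>2) \<le> S"
  using G_mean G_var unfolding zero_mean_finite_var_def eps_distr[of t, symmetric]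
  by (auto simp: integrable_distr_eq integral_distr)

lemma S_nonneg: "0 \<le> S"
  by (rule order_trans[OF _ eps_moments(4)]) simp

lemma eps_orthogonal:
  assumes "s \<noteq> t"
  shows "expectation (\<lambda>\<omega>. eps s \<omega> * eps t \<omega>) = 0"
proof -
  have "expectation (\<lambda>\<omega>. eps s \<omega> * eps t \<omega>) = expectation (eps s) * expectation (eps t)"
    by (rule expectation_mult_\<F>(1)[of "{Inl s}" "{Inl t}"])
      (use assms eps_moments in \<open>auto intro!: eps_measurable_\<F>\<close>)
  then show ?thesis by (simp add: eps_moments)
qed

lemma L1_bound_eps_sum:
  assumes "finite T"
  shows "L1_bound M (\<lambda>\<omega>. \<Sum>t\<in>T. eps t \<omega>) (sqrt (real (card T)) * sqrt S)"
  by (intro L1_bound_orthogonal_sum assms eps_measurable eps_moments eps_orthogonal)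

lemma causal_sum_measurable_past: "causal_sum t \<in> borel_measurable (\<F> (Inl ` {..t}))"
proof -
  have [measurable]: "eps (t - int k) \<in> borel_measurable (\<F> (Inl ` {..t}))" for k
    by (rule eps_measurable_\<F>) auto
  show ?thesis unfolding causal_sum_def[abs_def] by measurable
qed

lemma causal_sum_measurable[measurable]: "causal_sum t \<in> borel_measurable M"
  by (rule measurable_\<F>_imp_measurable[OF causal_sum_measurable_past])

lemma causal_partial_measurable[measurable]: "causal_partial K t \<in> borel_measurable M"
  unfolding causal_partial_def[abs_def] by measurable

lemma AE_causal_partial_tendsto: "AE \<omega> in M. (\<lambda>K. causal_partial K t \<omega>) \<longlonglongrightarrow> causal_sum t \<omega>"
proof -
  have "expectation (\<lambda>\<omega>. \<bar>eps (t - int k) \<omega>\<bar>) = (\<integral>x. \<bar>x\<bar> \<partial>G)" for k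
    by (rule expectation_eps) simp
  then have "AE \<omega> in M. summable (\<lambda>k. \<bar>\<psi> (int k)\<bar> * \<bar>eps (t - int k) \<omega>\<bar>)"
    using eps_moments summable_mult2[OF \<psi>_summable] by (intro AE_summable_of_summable_integral) simp_all
  then show ?thesis
  proof eventually_elim
    case (elim \<omega>)
    then have "summable (\<lambda>k. \<psi> (int k) * eps (t - int k) \<omega>)"
      by (simp add: summable_rabs_cancel abs_mult)
    then show ?case unfolding causal_partial_def causal_sum_def by (rule summable_LIMSEQ)
  qed
qed

lemma causal_partial_second_moment:
  "integrable M (\<lambda>\<omega>. (causal_partial K t \<omega>)\<^sup>2)"
  "expectation (\<lambda>\<omega>. (causal_partial K t \<omega>)\<^sup>2) \<le> \<Psi>\<^sup>2 * S"
proof -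
  let ?D = "\<lambda>k \<omega>. \<psi> (int k) * eps (t - int k) \<omega>"
  have "expectation (\<lambda>\<omega>. ?D j \<omega> * ?D k \<omega>) = 0" if "j \<noteq> k" for j k
    using eps_orthogonal[of "t - int j" "t - int k"] that
    by (simp add: mult.assoc mult.left_commute[of _ "\<psi> (int k)"])
  note sq = second_moment_orthogonal_sum[of "{..<K}" ?D, folded causal_partial_def, OF _ _ _ this]
  show "integrable M (\<lambda>\<omega>. (causal_partial K t \<omega>)\<^sup>2)"
    using eps_moments by (intro sq(2)) (auto simp: power_mult_distrib)
  have "expectation (\<lambda>\<omega>. (causal_partial K t \<omega>)\<^sup>2) = (\<Sum>k<K. expectation (\<lambda>\<omega>. (?D k \<omega>)\<^sup>2))"
    using eps_moments by (intro sq(1)) (auto simp: power_mult_distrib)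
  also have "\<dots> \<le> (\<Sum>k<K. (\<psi> (int k))\<^sup>2 * S)"
    using eps_moments by (intro sum_mono) (simp add: power_mult_distrib mult_left_mono)
  also have "\<dots> = (L2_set (\<lambda>k. \<psi> (int k)) {..<K})\<^sup>2 * S"
    by (simp add: L2_set_def sum_nonneg sum_distrib_right)
  also have "\<dots> \<le> \<Psi>\<^sup>2 * S"
  proof (intro mult_right_mono power_mono S_nonneg L2_set_nonneg)
    have "L2_set (\<lambda>k. \<psi> (int k)) {..<K} \<le> (\<Sum>k<K. \<bar>\<psi> (int k)\<bar>)" by (rule L2_set_le_sum_abs)
    also have "\<dots> \<le> \<Psi>" unfolding \<Psi>_def by (intro sum_le_suminf \<psi>_summable) auto
    finally show "L2_set (\<lambda>k. \<psi> (int k)) {..<K} \<le> \<Psi>" .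
  qed
  finally show "expectation (\<lambda>\<omega>. (causal_partial K t \<omega>)\<^sup>2) \<le> \<Psi>\<^sup>2 * S" .
qed

lemma causal_sum_second_moment:
  "integrable M (\<lambda>\<omega>. (causal_sum t \<omega>)\<^sup>2)" "expectation (\<lambda>\<omega>. (causal_sum t \<omega>)\<^sup>2) \<le> \<Psi>\<^sup>2 * S"
  using square_integrable_limit[OF _ _ AE_causal_partial_tendsto causal_partial_second_moment] by auto

lemma expectation_min_one_stationary:
  "expectation (\<lambda>\<omega>. min 1 \<bar>c * u t \<omega>\<bar>) = expectation (\<lambda>\<omega>. min 1 \<bar>c * u 0 \<omega>\<bar>)"
proof -
  have "distr (distr M (PiM {..<1} (\<lambda>_. borel)) (\<lambda>\<omega>. \<lambda>i\<in>{..<1}. u (s + int i) \<omega>)) borel (\<lambda>f. f 0)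
      = distr M borel (u s)" for s
    by (subst distr_distr) (auto simp: comp_def)
  from this[of t] this[of 0] have "distr M borel (u t) = distr M borel (u 0)"
    using u_stationary unfolding strictly_stationary_def by metis
  moreover have "expectation (\<lambda>\<omega>. min 1 \<bar>c * u r \<omega>\<bar>) = (\<integral>x. min 1 \<bar>c * x\<bar> \<partial>distr M borel (u r))" for r
    by (subst integral_distr) auto
  ultimately show ?thesis by simp
qed

lemma expectation_min_one_remainder_le:
  "expectation (\<lambda>\<omega>. min 1 \<bar>u t \<omega> - causal_partial (Suc K) t \<omega>\<bar>)
    \<le> (\<Sum>i=1..p. \<Sum>l=1..i. expectation (\<lambda>\<omega>. min 1 \<bar>\<beta> i * \<psi> (int (Suc K) - int l) * u 0 \<omega>\<bar>))"
proof -
  let ?h = "\<lambda>i l \<omega>. \<beta> i * \<psi> (int (Suc K) - int l) * u (t - int (Suc K) + int l - int i) \<omega>"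
  have integrable: "integrable M (\<lambda>\<omega>. min 1 \<bar>?h i l \<omega>\<bar>)" for i l
    by (rule bounded_integrable[of _ 1]) auto
  have pointwise: "min 1 \<bar>u t \<omega> - causal_partial (Suc K) t \<omega>\<bar> \<le> (\<Sum>i=1..p. \<Sum>l=1..i. min 1 \<bar>?h i l \<omega>\<bar>)"
    if "\<omega> \<in> space M" for \<omega>
  proof -
    have "u t \<omega> - causal_partial (Suc K) t \<omega> = (\<Sum>i=1..p. \<Sum>l=1..i. ?h i l \<omega>)"
      unfolding causal_partial_def
      using AR_recursion_unrolled[of "\<lambda>t. u t \<omega>" \<beta> p "\<lambda>t. eps t \<omega>" \<psi> t K, OF u_rec[OF that] \<psi>] .
    also have "min 1 \<bar>\<dots>\<bar> \<le> (\<Sum>i=1..p. min 1 \<bar>\<Sum>l=1..i. ?h i l \<omega>\<bar>)"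
      by (rule min_one_abs_sum_le) simp
    also have "\<dots> \<le> (\<Sum>i=1..p. \<Sum>l=1..i. min 1 \<bar>?h i l \<omega>\<bar>)"
      by (intro sum_mono min_one_abs_sum_le) simp
    finally show ?thesis .
  qed
  have "expectation (\<lambda>\<omega>. min 1 \<bar>u t \<omega> - causal_partial (Suc K) t \<omega>\<bar>)
      \<le> expectation (\<lambda>\<omega>. \<Sum>i=1..p. \<Sum>l=1..i. min 1 \<bar>?h i l \<omega>\<bar>)"
  proof (rule integral_mono)
    show "integrable M (\<lambda>\<omega>. min 1 \<bar>u t \<omega> - causal_partial (Suc K) t \<omega>\<bar>)"
      by (rule bounded_integrable[of _ 1]) auto
    show "integrable M (\<lambda>\<omega>. \<Sum>i=1..p. \<Sum>l=1..i. min 1 \<bar>?h i l \<omega>\<bar>)"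
      by (intro Bochner_Integration.integrable_sum integrable)
  qed (rule pointwise)
  also have "\<dots> = (\<Sum>i=1..p. expectation (\<lambda>\<omega>. \<Sum>l=1..i. min 1 \<bar>?h i l \<omega>\<bar>))"
    by (intro Bochner_Integration.integral_sum Bochner_Integration.integrable_sum integrable)
  also have "\<dots> = (\<Sum>i=1..p. \<Sum>l=1..i. expectation (\<lambda>\<omega>. min 1 \<bar>?h i l \<omega>\<bar>))"
    by (intro sum.cong refl Bochner_Integration.integral_sum integrable)
  also have "\<dots> = (\<Sum>i=1..p. \<Sum>l=1..i. expectation (\<lambda>\<omega>. min 1 \<bar>\<beta> i * \<psi> (int (Suc K) - int l) * u 0 \<omega>\<bar>))"
    by (intro sum.cong refl expectation_min_one_stationary)
  finally show ?thesis .
qed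

lemma AE_eq_causal_sum: "AE \<omega> in M. u t \<omega> = causal_sum t \<omega>"
proof -
  have integrable: "integrable M (\<lambda>\<omega>. min 1 \<bar>u t \<omega> - causal_sum t \<omega>\<bar>)"
    by (intro bounded_integrable[of _ 1]) auto
  have "(\<lambda>K. \<psi> (int (Suc K) - int l)) \<longlonglongrightarrow> 0" for l
  proof (rule LIMSEQ_offset)
    have "(\<lambda>n. \<psi> (int n)) \<longlonglongrightarrow> 0"
      using summable_LIMSEQ_zero[OF \<psi>_summable] by (simp add: tendsto_rabs_zero_iff)
    from LIMSEQ_Suc[OF this] show "(\<lambda>n. \<psi> (int (Suc (n + l)) - int l)) \<longlonglongrightarrow> 0"
      by (simp add: add.commute)
  qed
  then have "(\<lambda>K. \<Sum>i=1..p. \<Sum>l=1..i. expectation (\<lambda>\<omega>. min 1 \<bar>\<beta> i * \<psi> (int (Suc K) - int l) * u 0 \<omega>\<bar>))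
      \<longlonglongrightarrow> (\<Sum>i=1..p. \<Sum>l=1..i. 0)"
    by (intro tendsto_sum expectation_min_one_tendsto_0 u_measurable tendsto_mult_right_zero)
  then have bound: "(\<lambda>K. \<Sum>i=1..p. \<Sum>l=1..i. expectation (\<lambda>\<omega>. min 1 \<bar>\<beta> i * \<psi> (int (Suc K) - int l) * u 0 \<omega>\<bar>))
      \<longlonglongrightarrow> 0" by simp
  have "(\<lambda>K. expectation (\<lambda>\<omega>. min 1 \<bar>u t \<omega> - causal_partial (Suc K) t \<omega>\<bar>))
      \<longlonglongrightarrow> expectation (\<lambda>\<omega>. min 1 \<bar>u t \<omega> - causal_sum t \<omega>\<bar>)"
  proof (rule integral_dominated_convergence[where w="\<lambda>_. 1"])
    show "AE \<omega> in M. (\<lambda>K. min 1 \<bar>u t \<omega> - causal_partial (Suc K) t \<omega>\<bar>) \<longlonglongrightarrow> min 1 \<bar>u t \<omega> - causal_sum t \<omega>\<bar>"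
      using AE_causal_partial_tendsto[of t]
    proof eventually_elim
      case (elim \<omega>)
      from LIMSEQ_Suc[OF this] show ?case by (intro tendsto_intros)
    qed
  qed auto
  from LIMSEQ_le[OF this bound] have "expectation (\<lambda>\<omega>. min 1 \<bar>u t \<omega> - causal_sum t \<omega>\<bar>) \<le> 0"
    using expectation_min_one_remainder_le by blast
  then have "expectation (\<lambda>\<omega>. min 1 \<bar>u t \<omega> - causal_sum t \<omega>\<bar>) = 0"
    by (intro antisym Bochner_Integration.integral_nonneg) auto
  then have "AE \<omega> in M. min 1 \<bar>u t \<omega> - causal_sum t \<omega>\<bar> = 0"
    using integral_nonneg_eq_0_iff_AE[OF integrable] by auto
  then show ?thesis
    by eventually_elim (auto simp: min_def split: if_splits)
qed

lemma L1_bound_u: "L1_bound M (u t) (\<Psi> * sqrt S)"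
proof (rule L1_bound_dominated_AE)
  show "AE \<omega> in M. \<bar>u t \<omega>\<bar> \<le> \<bar>causal_sum t \<omega>\<bar>"
    using AE_eq_causal_sum[of t] by eventually_elim simp
  have "L1_bound M (causal_sum t) (sqrt (\<Psi>\<^sup>2 * S))"
    by (intro L1_bound_of_second_moment causal_sum_measurable causal_sum_second_moment)
  then show "L1_bound M (\<lambda>\<omega>. \<bar>causal_sum t \<omega>\<bar>) (\<Psi> * sqrt S)"
    using \<Psi>_nonneg by (intro L1_bound_abs) (simp add: real_sqrt_mult)
qed measurable

lemma L1_bound_causal_sum_partial_sum:
  assumes n: "n \<ge> 1"
  shows "L1_bound M (\<lambda>\<omega>. \<Sum>t=1..int n. causal_sum (t - j) \<omega>)
    ((sqrt S + (\<Sum>i=1..p. \<Sum>l<i. \<bar>\<beta> i\<bar> * (2 * \<Psi> * sqrt S))) / \<bar>1 - (\<Sum>i=1..p. \<beta> i)\<bar> * sqrt (real n))"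
proof -
  define d where "d = 1 - (\<Sum>i=1..p. \<beta> i)"
  define b where "b = (\<Sum>i=1..p. \<Sum>l<i. \<bar>\<beta> i\<bar> * (2 * \<Psi> * sqrt S))"
  define R where "R \<omega> = (\<Sum>t=1..int n. eps (t - j) \<omega>)
      + (\<Sum>i=1..p. \<Sum>l<i. \<beta> i * (u (- j - int l) \<omega> + - 1 * u (int n - j - int l) \<omega>))" for \<omega>
  have d: "d \<noteq> 0" using sum_ne_1 by (simp add: d_def)
  have b_nonneg: "0 \<le> b" unfolding b_def using \<Psi>_nonneg S_nonneg by (intro sum_nonneg) auto
  have eps: "L1_bound M (\<lambda>\<omega>. \<Sum>t=1..int n. eps (t - j) \<omega>) (sqrt (real n) * sqrt S)"
  proof -
    have "(\<Sum>t=1..int n. eps (t - j) \<omega>) = (\<Sum>t\<in>{1-j..int n-j}. eps t \<omega>)" for \<omega>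
      by (rule sum.reindex_bij_witness[of _ "\<lambda>t. t + j" "\<lambda>t. t - j"]) auto
    then show ?thesis using L1_bound_eps_sum[of "{1-j..int n-j}"] by simp
  qed
  have "L1_bound M R (sqrt (real n) * sqrt S + (\<Sum>i=1..p. \<Sum>l<i. \<bar>\<beta> i\<bar> * (\<Psi> * sqrt S + \<bar>- 1\<bar> * (\<Psi> * sqrt S))))"
    unfolding R_def by (intro L1_bound_add L1_bound_sum L1_bound_cmult L1_bound_u eps)
  also have "(\<Sum>i=1..p. \<Sum>l<i. \<bar>\<beta> i\<bar> * (\<Psi> * sqrt S + \<bar>- 1\<bar> * (\<Psi> * sqrt S))) = b"
    by (simp add: b_def mult_ac)
  finally have "L1_bound M R ((sqrt S + b) * sqrt (real n))"
    using mult_left_mono[of 1 "sqrt (real n)" b] b_nonneg n by (rule_tac L1_bound_weaken) (auto simp: algebra_simps)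
  from L1_bound_abs[OF L1_bound_cmult[OF this, of "1 / d"]]
  have "L1_bound M (\<lambda>\<omega>. \<bar>1 / d * R \<omega>\<bar>) ((sqrt S + b) / \<bar>d\<bar> * sqrt (real n))" by simp
  then show ?thesis
    unfolding b_def[symmetric] d_def[symmetric]
  proof (rule L1_bound_dominated_AE[rotated 2])
    have "AE \<omega> in M. \<forall>t. u t \<omega> = causal_sum t \<omega>"
      unfolding AE_all_countable using AE_eq_causal_sum by blast
    then show "AE \<omega> in M. \<bar>\<Sum>t=1..int n. causal_sum (t - j) \<omega>\<bar> \<le> \<bar>1 / d * R \<omega>\<bar>"
      using AE_space
    proof eventually_elim
      case (elim \<omega>)
      have "d * (\<Sum>t=1..int n. u (t - j) \<omega>) = R \<omega>"
        using AR_partial_sum_eq[of "\<lambda>t. u t \<omega>" \<beta> p "\<lambda>t. eps t \<omega>" j n, OF u_rec[OF elim(2)]]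
        by (simp add: d_def R_def)
      then show ?case using d elim(1) by (simp add: field_simps)
    qed
  qed measurable
qed

end

definition causal_version :: "real \<Rightarrow> 'a measure \<Rightarrow> (int \<Rightarrow> 'a \<Rightarrow> real) \<Rightarrow> (int \<Rightarrow> 'a \<Rightarrow> real) \<Rightarrow>
    (int \<Rightarrow> 'a \<Rightarrow> real) \<Rightarrow> (int \<Rightarrow> 'a \<Rightarrow> real) \<Rightarrow> bool" where
  "causal_version K M eps z xi v \<longleftrightarrow>
     (\<forall>t. v t \<in> borel_measurable (noise_algebra M eps z xi (Inl ` {..t}))) \<and>
     (\<forall>t. integrable M (\<lambda>\<omega>. (v t \<omega>)\<^sup>2) \<and> (\<integral>\<omega>. (v t \<omega>)\<^sup>2 \<partial>M) \<le> K) \<and>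
     (\<forall>n j. n \<ge> 1 \<longrightarrow> L1_bound M (\<lambda>\<omega>. \<Sum>t=1..int n. v (t - j) \<omega>) (K * sqrt (real n)))"

lemma AR_causal_representation:
  assumes causal: "causal_coeffs p \<beta>"
  shows "\<exists>K\<ge>0. \<forall>(M :: 'a measure) G GE g eps z xi u.
    AR_contam_model p \<beta> G GE g M eps z xi u \<longrightarrow> (\<integral>x. x\<^sup>2 \<partial>G) \<le> S \<longrightarrow>
    (\<exists>v. causal_version K M eps z xi v \<and> (AE \<omega> in M. \<forall>t. u t \<omega> = v t \<omega>))"
proof -
  obtain \<psi> where \<psi>: "ma_coeffs p \<beta> \<psi>" using ex_ma_coeffs[OF causal] by blast
  define K1 where "K1 = (\<Sum>n. \<bar>\<psi> (int n)\<bar>)\<^sup>2 * S"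
  define K2 where "K2 = (sqrt S + (\<Sum>i=1..p. \<Sum>l<i. \<bar>\<beta> i\<bar> * (2 * (\<Sum>n. \<bar>\<psi> (int n)\<bar>) * sqrt S)))
    / \<bar>1 - (\<Sum>i=1..p. \<beta> i)\<bar>"
  show ?thesis
  proof (intro exI[of _ "max 0 (max K1 K2)"] conjI allI impI)
    fix M :: "'a measure" and G GE g eps z xi u
    assume model: "AR_contam_model p \<beta> G GE g M eps z xi u" and S: "(\<integral>x. x\<^sup>2 \<partial>G) \<le> S"
    interpret contam_noise M G GE g eps z xi by (rule AR_contam_model_imp_contam_noise[OF model])
    interpret causal_AR M G GE g eps z xi p \<beta> u \<psi> S
      using model S \<psi> causal_coeffs_sum_ne_1[OF causal] by unfold_locales (auto simp: AR_contam_model_def)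
    have "causal_version (max 0 (max K1 K2)) M eps z xi causal_sum"
      unfolding causal_version_def
    proof (intro conjI allI impI)
      fix n :: nat and j :: int assume "n \<ge> 1"
      from L1_bound_causal_sum_partial_sum[OF this, of j]
      have "L1_bound M (\<lambda>\<omega>. \<Sum>t=1..int n. causal_sum (t - j) \<omega>) (K2 * sqrt (real n))"
        unfolding K2_def \<Psi>_def .
      then show "L1_bound M (\<lambda>\<omega>. \<Sum>t=1..int n. causal_sum (t - j) \<omega>) (max 0 (max K1 K2) * sqrt (real n))"
        by (rule L1_bound_weaken) (intro mult_right_mono; simp)
    qed (use causal_sum_measurable_past causal_sum_second_moment in \<open>auto simp: K1_def \<Psi>_def le_max_iff_disj\<close>)
    moreover have "AE \<omega> in M. \<forall>t. u t \<omega> = causal_sum t \<omega>"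
      unfolding AE_all_countable using AE_eq_causal_sum by blast
    ultimately show "\<exists>v. causal_version (max 0 (max K1 K2)) M eps z xi v \<and> (AE \<omega> in M. \<forall>t. u t \<omega> = v t \<omega>)"
      by blast
  qed simp
qed

section \<open>Shifted empirical processes\<close>

lemma is_real_distr_iff_real_distribution: "is_real_distr D \<longleftrightarrow> real_distribution D"
  by (auto simp: is_real_distr_def real_distribution_def real_distribution_axioms_def)

lemma (in real_distribution) cdf_measurable[measurable]: "cdf M \<in> borel_measurable borel"
  by (intro borel_measurable_mono) (auto simp: mono_def intro: cdf_nondecreasing)

lemma (in real_distribution) abs_cdf_diff_le_1: "\<bar>cdf M x - cdf M y\<bar> \<le> 1"
  using cdf_nonneg[of x] cdf_nonneg[of y] cdf_bounded_prob[of x] cdf_bounded_prob[of y] by linarith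

definition below :: "real \<Rightarrow> real \<Rightarrow> real" where
  "below e a = (if e \<le> a then 1 else 0)"

lemma below_bounds[simp]: "0 \<le> below e a" "below e a \<le> 1" "\<bar>below e a\<bar> \<le> 1" "\<bar>below e a - below e a'\<bar> \<le> 1"
  by (auto simp: below_def)

lemma below_measurable[measurable]:
  assumes [measurable]: "f \<in> borel_measurable N" "h \<in> borel_measurable N"
  shows "(\<lambda>\<omega>. below (f \<omega>) (h \<omega>)) \<in> borel_measurable N"
  unfolding below_def by measurable

lemma abs_below_diff_le:
  assumes "\<bar>a - a0\<bar> \<le> r"
  shows "\<bar>below e a - below e a0\<bar> \<le> below e (a0 + r) - below e (a0 - r)"
  using assms by (auto simp: below_def)

lemma (in real_distribution) expectation_below: "(\<integral>e. below e y \<partial>M) = cdf M y"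
proof -
  have "(\<integral>e. below e y \<partial>M) = (\<integral>e. indicator {..y} e \<partial>M)"
    by (intro Bochner_Integration.integral_cong) (auto simp: below_def)
  then show ?thesis by (simp add: cdf_def)
qed

definition truncated_mean :: "real measure \<Rightarrow> real \<Rightarrow> real" where
  "truncated_mean D a = (\<integral>x. min 1 (a * \<bar>x\<bar>) \<partial>D)"

definition smooth_cdf :: "real measure \<Rightarrow> (real \<Rightarrow> real) \<Rightarrow> real \<Rightarrow> real \<Rightarrow> bool" where
  "smooth_cdf D f L B \<longleftrightarrow> 0 \<le> L \<and> 0 \<le> B \<and> (\<forall>x y. \<bar>cdf D x - cdf D y\<bar> \<le> L * \<bar>x - y\<bar>) \<and>
     (\<forall>x h. \<bar>cdf D (x + h) - cdf D x - f x * h\<bar> \<le> B * h\<^sup>2) \<and> (\<forall>x. \<bar>f x\<bar> \<le> L)"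

locale contam_array = contam_noise M G GE g eps z xi
  for M :: "'a measure" and G GE :: "real measure" and g :: real
    and eps z xi :: "int \<Rightarrow> 'a \<Rightarrow> real" +
  fixes v :: "int \<Rightarrow> 'a \<Rightarrow> real" and p :: nat and b :: "nat \<Rightarrow> real" and n :: nat
    and K L B :: real and f :: "real \<Rightarrow> real"
  assumes v: "causal_version K M eps z xi v" and n: "n \<ge> 1" and smooth: "smooth_cdf G f L B"
begin

sublocale G: real_distribution G
  using G by (simp add: is_real_distr_iff_real_distribution)

sublocale GE: real_distribution GE
  using GE by (simp add: is_real_distr_iff_real_distribution)

lemma sqrt_n_pos: "0 < sqrt (real n)"
  using n by simp

lemma L_nonneg: "0 \<le> L" and B_nonneg: "0 \<le> B"
  and G_lipschitz: "\<bar>cdf G x - cdf G y\<bar> \<le> L * \<bar>x - y\<bar>"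
  and G_taylor: "\<bar>cdf G (x + h) - cdf G x - f x * h\<bar> \<le> B * h\<^sup>2"
  and f_bound: "\<bar>f x\<bar> \<le> L"
  using smooth by (auto simp: smooth_cdf_def)

lemma L1_bound_normalised_sum:
  assumes "\<And>t. L1_bound M (X t) c"
  shows "L1_bound M (\<lambda>\<omega>. (\<Sum>t=1..int n. X t \<omega>) / sqrt (real n)) (sqrt (real n) * c)"
proof -
  have "L1_bound M (\<lambda>\<omega>. (\<Sum>t=1..int n. X t \<omega>) / sqrt (real n)) ((\<Sum>t=1..int n. c) / sqrt (real n))"
    by (intro L1_bound_divide L1_bound_sum assms sqrt_n_pos)
  then show ?thesis by (simp add: real_div_sqrt flip: times_divide_eq_left)
qed

definition past :: "int \<Rightarrow> (int + int + int) set" where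
  "past t = Inl ` {..<t} \<union> range Inr"

lemma past_simps[simp]: "Inl t \<notin> past t" "Inr k \<in> past t" "r < t \<Longrightarrow> Inl r \<in> past t"
  by (auto simp: past_def)

lemma integrable_mult_le_1:
  assumes [measurable]: "X \<in> borel_measurable M" "Y \<in> borel_measurable M"
    and X: "\<And>\<omega>. \<omega> \<in> space M \<Longrightarrow> \<bar>X \<omega>\<bar> \<le> C" and Y: "\<And>\<omega>. \<bar>Y \<omega>\<bar> \<le> 1"
  shows "integrable M (\<lambda>\<omega>. X \<omega> * Y \<omega> :: real)"
proof (rule bounded_integrable[of _ C])
  fix \<omega> assume "\<omega> \<in> space M"
  from mult_mono[OF X[OF this] Y order_trans[OF abs_ge_zero X[OF this]] abs_ge_zero, of \<omega>]
  show "norm (X \<omega> * Y \<omega>) \<le> C" by (simp add: abs_mult)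
qed measurable

lemma expectation_below_eps:
  assumes \<phi>: "\<phi> \<in> borel_measurable (\<F> (past t))" and a: "a \<in> borel_measurable (\<F> (past t))"
    and bounded: "\<And>\<omega>. \<omega> \<in> space M \<Longrightarrow> \<bar>\<phi> \<omega>\<bar> \<le> C"
  shows "expectation (\<lambda>\<omega>. \<phi> \<omega> * below (eps t \<omega>) (a \<omega>)) = expectation (\<lambda>\<omega>. \<phi> \<omega> * cdf G (a \<omega>))"
proof -
  let ?N = "borel \<Otimes>\<^sub>M borel :: (real \<times> real) measure"
  let ?D = "distr M ?N (\<lambda>\<omega>. (\<phi> \<omega>, a \<omega>))" and ?E = "distr M ?N (\<lambda>\<omega>. (eps t \<omega>, 0))"
  let ?h = "\<lambda>e w :: real \<times> real. fst w * below (fst e) (snd w)"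
  have [measurable]: "\<phi> \<in> borel_measurable M" "a \<in> borel_measurable M"
    using \<phi> a by (auto intro: measurable_\<F>_imp_measurable)
  have eps: "eps t \<in> borel_measurable (\<F> {Inl t})" by (rule eps_measurable_\<F>) simp
  have "indep_var ?N (\<lambda>\<omega>. (eps t \<omega>, 0)) ?N (\<lambda>\<omega>. (\<phi> \<omega>, a \<omega>))"
    by (rule indep_var_\<F>[of "{Inl t}" "past t"]) (use \<phi> a eps in \<open>auto intro!: measurable_Pair\<close>)
  then have joint: "?E \<Otimes>\<^sub>M ?D = distr M (?N \<Otimes>\<^sub>M ?N) (\<lambda>\<omega>. ((eps t \<omega>, 0), (\<phi> \<omega>, a \<omega>)))"
    unfolding indep_var_distribution_eq by simp
  interpret D: prob_space ?D by (rule prob_space_distr) measurable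
  interpret E: prob_space ?E by (rule prob_space_distr) measurable
  interpret P: pair_prob_space ?E ?D ..
  have below_int: "(\<integral>e. below (fst e) y \<partial>?E) = cdf G y" for y
  proof -
    have "(\<integral>e. below (fst e) y \<partial>?E) = (\<integral>e. below e y \<partial>distr M borel (eps t))"
      by (simp add: integral_distr)
    then show ?thesis by (simp add: eps_distr G.expectation_below)
  qed
  have "integrable M (\<lambda>\<omega>. \<phi> \<omega> * below (eps t \<omega>) (a \<omega>))"
    by (rule integrable_mult_le_1[OF _ _ bounded]) auto
  then have integrable: "integrable (?E \<Otimes>\<^sub>M ?D) (case_prod ?h)"
    unfolding joint by (subst integrable_distr_eq) auto
  have "expectation (\<lambda>\<omega>. \<phi> \<omega> * below (eps t \<omega>) (a \<omega>)) = integral\<^sup>L (?E \<Otimes>\<^sub>M ?D) (case_prod ?h)"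
    unfolding joint by (subst integral_distr) auto
  also have "\<dots> = (\<integral>w. (\<integral>e. ?h e w \<partial>?E) \<partial>?D)"
    by (rule P.integral_snd[OF integrable, symmetric])
  also have "\<dots> = (\<integral>w. fst w * cdf G (snd w) \<partial>?D)"
    by (simp add: below_int)
  also have "\<dots> = expectation (\<lambda>\<omega>. \<phi> \<omega> * cdf G (a \<omega>))"
    by (subst integral_distr) auto
  finally show ?thesis .
qed

definition predictable :: "(int \<Rightarrow> 'a \<Rightarrow> real) \<Rightarrow> bool" where
  "predictable a \<longleftrightarrow> (\<forall>t. a t \<in> borel_measurable (\<F> (past t)))"

lemma predictable_measurable_past:
  assumes "predictable a" "r \<le> t"
  shows "a r \<in> borel_measurable (\<F> (past t))"
  by (rule measurable_\<F>_mono[of _ "past r"]) (use assms in \<open>auto simp: predictable_def past_def\<close>)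

lemma predictable_measurable: "predictable a \<Longrightarrow> a t \<in> borel_measurable M"
  unfolding predictable_def by (auto intro: measurable_\<F>_imp_measurable)

lemma predictable_const: "predictable (\<lambda>_ _. y)"
  by (simp add: predictable_def)

lemma predictable_add: "predictable a \<Longrightarrow> predictable a' \<Longrightarrow> predictable (\<lambda>t \<omega>. a t \<omega> + a' t \<omega>)"
  unfolding predictable_def by (intro allI borel_measurable_add) auto

lemma predictable_diff: "predictable a \<Longrightarrow> predictable a' \<Longrightarrow> predictable (\<lambda>t \<omega>. a t \<omega> - a' t \<omega>)"
  unfolding predictable_def by (intro allI borel_measurable_diff) auto

definition increment :: "(int \<Rightarrow> 'a \<Rightarrow> real) \<Rightarrow> (int \<Rightarrow> 'a \<Rightarrow> real) \<Rightarrow> int \<Rightarrow> 'a \<Rightarrow> real" where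
  "increment a a' t \<omega> = below (eps t \<omega>) (a t \<omega>) - below (eps t \<omega>) (a' t \<omega>)"

definition drift :: "(int \<Rightarrow> 'a \<Rightarrow> real) \<Rightarrow> (int \<Rightarrow> 'a \<Rightarrow> real) \<Rightarrow> int \<Rightarrow> 'a \<Rightarrow> real" where
  "drift a a' t \<omega> = cdf G (a t \<omega>) - cdf G (a' t \<omega>)"

definition mart_diff :: "(int \<Rightarrow> 'a \<Rightarrow> real) \<Rightarrow> (int \<Rightarrow> 'a \<Rightarrow> real) \<Rightarrow> int \<Rightarrow> 'a \<Rightarrow> real" where
  "mart_diff a a' t \<omega> = increment a a' t \<omega> - drift a a' t \<omega>"

lemma abs_increment_le_1: "\<bar>increment a a' t \<omega>\<bar> \<le> 1"
  by (simp add: increment_def)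

lemma abs_drift_le_1: "\<bar>drift a a' t \<omega>\<bar> \<le> 1"
  by (simp add: drift_def G.abs_cdf_diff_le_1)

lemma abs_mart_diff_le_2: "\<bar>mart_diff a a' t \<omega>\<bar> \<le> 2"
  using abs_increment_le_1[of a a' t \<omega>] abs_drift_le_1[of a a' t \<omega>] unfolding mart_diff_def by linarith

context
  fixes a a' :: "int \<Rightarrow> 'a \<Rightarrow> real"
  assumes a: "predictable a" and a': "predictable a'"
begin

lemma drift_measurable_past:
  assumes "r \<le> t"
  shows "drift a a' r \<in> borel_measurable (\<F> (past t))"
proof -
  note [measurable] = predictable_measurable_past[OF a assms] predictable_measurable_past[OF a' assms]
  show ?thesis unfolding drift_def[abs_def] by measurable
qed

lemma mart_diff_measurable_past:
  assumes "r < t"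
  shows "mart_diff a a' r \<in> borel_measurable (\<F> (past t))"
proof -
  have [measurable]: "eps r \<in> borel_measurable (\<F> (past t))"
    using assms by (intro eps_measurable_\<F>) simp
  note [measurable] = drift_measurable_past[OF less_imp_le[OF assms]]
    predictable_measurable_past[OF a less_imp_le[OF assms]] predictable_measurable_past[OF a' less_imp_le[OF assms]]
  show ?thesis unfolding mart_diff_def[abs_def] increment_def by measurable
qed

lemma increment_measurable: "increment a a' t \<in> borel_measurable M"
proof -
  note [measurable] = predictable_measurable[OF a] predictable_measurable[OF a']
  show ?thesis unfolding increment_def[abs_def] by measurable
qed

lemma drift_measurable: "drift a a' t \<in> borel_measurable M"
  by (rule measurable_\<F>_imp_measurable[OF drift_measurable_past[OF order_refl]])

lemma mart_diff_measurable: "mart_diff a a' t \<in> borel_measurable M"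
  unfolding mart_diff_def[abs_def] by (intro borel_measurable_diff increment_measurable drift_measurable)

lemma expectation_mult_increment:
  assumes \<phi>: "\<phi> \<in> borel_measurable (\<F> (past t))" and bounded: "\<And>\<omega>. \<omega> \<in> space M \<Longrightarrow> \<bar>\<phi> \<omega>\<bar> \<le> C"
  shows "expectation (\<lambda>\<omega>. \<phi> \<omega> * increment a a' t \<omega>) = expectation (\<lambda>\<omega>. \<phi> \<omega> * drift a a' t \<omega>)"
proof -
  note [measurable] = measurable_\<F>_imp_measurable[OF \<phi>] predictable_measurable[OF a] predictable_measurable[OF a']
  have cdf_le: "\<bar>cdf G y\<bar> \<le> 1" for y using G.cdf_nonneg[of y] G.cdf_bounded_prob[of y] by simp
  note integrable = integrable_mult_le_1[OF measurable_\<F>_imp_measurable[OF \<phi>] _ bounded]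
  have ints: "integrable M (\<lambda>\<omega>. \<phi> \<omega> * below (eps t \<omega>) (a t \<omega>))" "integrable M (\<lambda>\<omega>. \<phi> \<omega> * below (eps t \<omega>) (a' t \<omega>))"
    "integrable M (\<lambda>\<omega>. \<phi> \<omega> * cdf G (a t \<omega>))" "integrable M (\<lambda>\<omega>. \<phi> \<omega> * cdf G (a' t \<omega>))"
    by (rule integrable; simp add: cdf_le)+
  have "expectation (\<lambda>\<omega>. \<phi> \<omega> * increment a a' t \<omega>)
      = expectation (\<lambda>\<omega>. \<phi> \<omega> * below (eps t \<omega>) (a t \<omega>)) - expectation (\<lambda>\<omega>. \<phi> \<omega> * below (eps t \<omega>) (a' t \<omega>))"
    unfolding increment_def right_diff_distrib by (rule Bochner_Integration.integral_diff[OF ints(1,2)])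
  also have "\<dots> = expectation (\<lambda>\<omega>. \<phi> \<omega> * cdf G (a t \<omega>)) - expectation (\<lambda>\<omega>. \<phi> \<omega> * cdf G (a' t \<omega>))"
    using predictable_measurable_past[OF a order_refl] predictable_measurable_past[OF a' order_refl]
    by (simp add: expectation_below_eps[OF \<phi> _ bounded])
  also have "\<dots> = expectation (\<lambda>\<omega>. \<phi> \<omega> * drift a a' t \<omega>)"
    unfolding drift_def right_diff_distrib
    by (rule Bochner_Integration.integral_diff[OF ints(3,4), symmetric])
  finally show ?thesis .
qed

lemma mart_diff_orthogonal:
  assumes "r \<noteq> t"
  shows "expectation (\<lambda>\<omega>. mart_diff a a' r \<omega> * mart_diff a a' t \<omega>) = 0"
proof -
  have less: "expectation (\<lambda>\<omega>. mart_diff a a' r \<omega> * mart_diff a a' t \<omega>) = 0" if "r < t" for r t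
  proof -
    note integrable = integrable_mult_le_1[OF mart_diff_measurable[of r] _ abs_mart_diff_le_2]
    have "expectation (\<lambda>\<omega>. mart_diff a a' r \<omega> * mart_diff a a' t \<omega>)
      = expectation (\<lambda>\<omega>. mart_diff a a' r \<omega> * increment a a' t \<omega>)
          - expectation (\<lambda>\<omega>. mart_diff a a' r \<omega> * drift a a' t \<omega>)"
      unfolding mart_diff_def[of _ _ t] right_diff_distrib
      by (rule Bochner_Integration.integral_diff[OF integrable[OF increment_measurable abs_increment_le_1]
            integrable[OF drift_measurable abs_drift_le_1]])
    then show ?thesis
      using expectation_mult_increment[OF mart_diff_measurable_past[OF that] abs_mart_diff_le_2] by simp
  qed
  show ?thesis
    using less[of r t] less[of t r] assms by (cases "r < t") (auto simp: mult.commute)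
qed

lemma mart_diff_second_moment:
  "expectation (\<lambda>\<omega>. (mart_diff a a' t \<omega>)\<^sup>2) \<le> expectation (\<lambda>\<omega>. \<bar>drift a a' t \<omega>\<bar>)"
proof -
  let ?I = "increment a a' t" and ?D = "drift a a' t" and ?\<sigma> = "\<lambda>\<omega>. sgn (a t \<omega> - a' t \<omega>)"
  note [measurable] = predictable_measurable_past[OF a order_refl] predictable_measurable_past[OF a' order_refl]
  have \<sigma>: "?\<sigma> \<in> borel_measurable (\<F> (past t))" by measurable
  have \<sigma>_le: "\<bar>?\<sigma> \<omega>\<bar> \<le> 1" for \<omega> by (auto simp: sgn_if)
  have square: "(mart_diff a a' t \<omega>)\<^sup>2 = ?\<sigma> \<omega> * ?I \<omega> - 2 * (?D \<omega> * ?I \<omega>) + ?D \<omega> * ?D \<omega>" for \<omega>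
  proof -
    have "?\<sigma> \<omega> * ?I \<omega> = (?I \<omega>)\<^sup>2" by (auto simp: increment_def below_def sgn_if)
    then show ?thesis unfolding mart_diff_def by (simp only: power2_eq_square) (simp only: algebra_simps)
  qed
  note integrable = integrable_mult_le_1[OF _ increment_measurable _ abs_increment_le_1, where C=1]
    integrable_mult_le_1[OF _ drift_measurable _ abs_drift_le_1, where C=1]
  have ints: "integrable M (\<lambda>\<omega>. ?\<sigma> \<omega> * ?I \<omega>)" "integrable M (\<lambda>\<omega>. ?D \<omega> * ?I \<omega>)"
    "integrable M (\<lambda>\<omega>. ?D \<omega> * ?D \<omega>)" "integrable M (\<lambda>\<omega>. ?\<sigma> \<omega> * ?D \<omega>)"
    by (intro integrable measurable_\<F>_imp_measurable[OF \<sigma>] drift_measurable \<sigma>_le abs_drift_le_1)+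
  have "expectation (\<lambda>\<omega>. (mart_diff a a' t \<omega>)\<^sup>2) = expectation (\<lambda>\<omega>. ?\<sigma> \<omega> * ?I \<omega>)
      - 2 * expectation (\<lambda>\<omega>. ?D \<omega> * ?I \<omega>) + expectation (\<lambda>\<omega>. ?D \<omega> * ?D \<omega>)"
    unfolding square using ints by simp
  also have "\<dots> = expectation (\<lambda>\<omega>. ?\<sigma> \<omega> * ?D \<omega>) - expectation (\<lambda>\<omega>. ?D \<omega> * ?D \<omega>)"
    using expectation_mult_increment[OF \<sigma> \<sigma>_le]
      expectation_mult_increment[OF drift_measurable_past[OF order_refl] abs_drift_le_1]
    by simp
  also have "\<dots> \<le> expectation (\<lambda>\<omega>. ?\<sigma> \<omega> * ?D \<omega>)"
    by simp
  also have "\<dots> \<le> expectation (\<lambda>\<omega>. \<bar>?D \<omega>\<bar>)"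
    by (intro integral_mono ints bounded_integrable[of _ 1] borel_measurable_abs drift_measurable)
      (auto simp: sgn_if abs_drift_le_1)
  finally show ?thesis .
qed

lemma L1_bound_mart_diff_sum:
  assumes drift: "\<And>t. L1_bound M (drift a a' t) q"
  shows "L1_bound M (\<lambda>\<omega>. (\<Sum>t=1..int n. mart_diff a a' t \<omega>) / sqrt (real n)) (sqrt q)"
proof -
  have "L1_bound M (\<lambda>\<omega>. \<Sum>t=1..int n. mart_diff a a' t \<omega>) (sqrt (real (card {1..int n})) * sqrt q)"
  proof (rule L1_bound_orthogonal_sum)
    show "integrable M (\<lambda>\<omega>. (mart_diff a a' t \<omega>)\<^sup>2)" for t
    proof (rule bounded_integrable[of _ "2\<^sup>2"])
      fix \<omega> show "norm ((mart_diff a a' t \<omega>)\<^sup>2) \<le> 2\<^sup>2"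
        using power_mono[OF abs_mart_diff_le_2[of a a' t \<omega>] abs_ge_zero, of 2] by simp
    qed (intro borel_measurable_power mart_diff_measurable)
    show "expectation (\<lambda>\<omega>. (mart_diff a a' t \<omega>)\<^sup>2) \<le> q" for t
      using mart_diff_second_moment[of t] drift[of t] by (simp add: L1_bound_def)
  qed (simp_all add: mart_diff_measurable mart_diff_orthogonal)
  from L1_bound_divide[OF this sqrt_n_pos] show ?thesis using sqrt_n_pos by simp
qed

end

text \<open>The residual at time \<open>t\<close> is \<open>eps t - contam t - lin_err \<tau> t\<close>, where \<open>\<tau>\<close> is the estimation error
  multiplied by \<open>sqrt n\<close> and \<open>b 0 = -1\<close>, \<open>b j = \<beta> j\<close>.\<close>

definition outlier :: "int \<Rightarrow> 'a \<Rightarrow> real" where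
  "outlier t \<omega> = z t \<omega> * xi t \<omega>"

definition contam :: "int \<Rightarrow> 'a \<Rightarrow> real" where
  "contam t \<omega> = (\<Sum>j=0..p. b j * outlier (t - int j) \<omega>)"

definition lin_err :: "(nat \<Rightarrow> real) \<Rightarrow> int \<Rightarrow> 'a \<Rightarrow> real" where
  "lin_err \<tau> t \<omega> = (\<Sum>i=1..p. \<tau> i * (v (t - int i) \<omega> + outlier (t - int i) \<omega>)) / sqrt (real n)"

definition clean_err :: "(nat \<Rightarrow> real) \<Rightarrow> int \<Rightarrow> 'a \<Rightarrow> real" where
  "clean_err \<tau> t \<omega> = (\<Sum>i=1..p. \<tau> i * v (t - int i) \<omega>) / sqrt (real n)"

definition threshold :: "real \<Rightarrow> (nat \<Rightarrow> real) \<Rightarrow> int \<Rightarrow> 'a \<Rightarrow> real" where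
  "threshold y \<tau> t \<omega> = y + contam t \<omega> + lin_err \<tau> t \<omega>"

definition hits :: "int \<Rightarrow> 'a \<Rightarrow> real" where
  "hits t \<omega> = (\<Sum>j=0..p. z (t - int j) \<omega>)"

definition lag_v :: "int \<Rightarrow> 'a \<Rightarrow> real" where
  "lag_v t \<omega> = (\<Sum>i=1..p. \<bar>v (t - int i) \<omega>\<bar>)"

definition lag_size :: "int \<Rightarrow> 'a \<Rightarrow> real" where
  "lag_size t \<omega> = (\<Sum>i=1..p. \<bar>v (t - int i) \<omega>\<bar> + \<bar>outlier (t - int i) \<omega>\<bar>)"

definition outlier_mod :: "real \<Rightarrow> int \<Rightarrow> 'a \<Rightarrow> real" where
  "outlier_mod D t \<omega> = (\<Sum>i=1..p. min 1 (L * D / sqrt (real n) * \<bar>outlier (t - int i) \<omega>\<bar>))"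

definition lag_mod :: "real \<Rightarrow> int \<Rightarrow> 'a \<Rightarrow> real" where
  "lag_mod D t \<omega> = L * D / sqrt (real n) * lag_v t \<omega> + outlier_mod D t \<omega>"

definition lag_bound :: "real \<Rightarrow> real" where
  "lag_bound D = L * D / sqrt (real n) * (real p * sqrt K) + real p * (g * truncated_mean GE (L * D / sqrt (real n)))"

definition tau_size :: "(nat \<Rightarrow> real) \<Rightarrow> real" where
  "tau_size \<tau> = (\<Sum>i=1..p. \<bar>\<tau> i\<bar>)"

lemma tau_size_nonneg: "0 \<le> tau_size \<tau>"
  unfolding tau_size_def by (intro sum_nonneg) auto

lemma abs_le_tau_size: "i \<in> {1..p} \<Longrightarrow> \<bar>\<tau> i\<bar> \<le> tau_size \<tau>"
  unfolding tau_size_def by (rule member_le_sum) auto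

lemma v_measurable_past: "r < t \<Longrightarrow> v r \<in> borel_measurable (\<F> (past t))"
  by (rule measurable_\<F>_mono[of _ "Inl ` {..r}"]) (use v in \<open>auto simp: causal_version_def past_def\<close>)

lemma outlier_measurable_past: "outlier r \<in> borel_measurable (\<F> (past t))"
proof -
  have [measurable]: "z r \<in> borel_measurable (\<F> (past t))" "xi r \<in> borel_measurable (\<F> (past t))"
    by (auto intro!: z_measurable_\<F> xi_measurable_\<F>)
  show ?thesis unfolding outlier_def[abs_def] by measurable
qed

lemma predictable_threshold: "predictable (threshold y \<tau>)"
  unfolding predictable_def
proof
  fix t
  note [measurable] = outlier_measurable_past[of _ t]
  have [measurable]: "v (t - int i) \<in> borel_measurable (\<F> (past t))" if "i \<in> {1..p}" for i
    using that by (intro v_measurable_past) auto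
  show "threshold y \<tau> t \<in> borel_measurable (\<F> (past t))"
    unfolding threshold_def[abs_def] contam_def lin_err_def by measurable
qed

lemma predictable_lag_size: "predictable (\<lambda>t \<omega>. \<eta> * lag_size t \<omega> / sqrt (real n))"
  unfolding predictable_def
proof
  fix t
  note [measurable] = outlier_measurable_past[of _ t]
  have [measurable]: "v (t - int i) \<in> borel_measurable (\<F> (past t))" if "i \<in> {1..p}" for i
    using that by (intro v_measurable_past) auto
  show "(\<lambda>\<omega>. \<eta> * lag_size t \<omega> / sqrt (real n)) \<in> borel_measurable (\<F> (past t))"
    unfolding lag_size_def by measurable
qed

lemma v_measurable[measurable]: "v t \<in> borel_measurable M"
  using v unfolding causal_version_def by (auto intro: measurable_\<F>_imp_measurable)

lemma outlier_measurable[measurable]: "outlier t \<in> borel_measurable M"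
  unfolding outlier_def[abs_def] by measurable

lemma contam_measurable[measurable]: "contam t \<in> borel_measurable M"
  unfolding contam_def[abs_def] by measurable

lemma clean_err_measurable[measurable]: "clean_err \<tau> t \<in> borel_measurable M"
  unfolding clean_err_def[abs_def] by measurable

lemma threshold_measurable[measurable]: "threshold y \<tau> t \<in> borel_measurable M"
  by (rule predictable_measurable[OF predictable_threshold])

lemma v_second_moment: "integrable M (\<lambda>\<omega>. (v t \<omega>)\<^sup>2)" "expectation (\<lambda>\<omega>. (v t \<omega>)\<^sup>2) \<le> K"
  using v unfolding causal_version_def by auto

lemma K_nonneg: "0 \<le> K"
  by (rule order_trans[OF _ v_second_moment(2)]) simp

lemma L1_bound_v: "L1_bound M (\<lambda>\<omega>. \<bar>v t \<omega>\<bar>) (sqrt K)"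
  by (intro L1_bound_abs L1_bound_of_second_moment v_measurable v_second_moment)

lemma L1_bound_v_square: "L1_bound M (\<lambda>\<omega>. (v t \<omega>)\<^sup>2) K"
  using v_second_moment by (simp add: L1_bound_def)

lemma L1_bound_v_sum: "L1_bound M (\<lambda>\<omega>. \<Sum>t=1..int n. v (t - j) \<omega>) (K * sqrt (real n))"
  using v n by (simp add: causal_version_def)

lemma z_nonneg: "\<omega> \<in> space M \<Longrightarrow> 0 \<le> z t \<omega>" and z_le_1: "\<omega> \<in> space M \<Longrightarrow> z t \<omega> \<le> 1"
  using z01[of \<omega> t] by auto

lemma integrable_z: "integrable M (z t)"
  by (rule bounded_integrable[of _ 1]) (auto simp: z_nonneg z_le_1)

lemma expectation_z: "expectation (z t) = g"
proof -
  have "expectation (z t) = expectation (indicator {\<omega>\<in>space M. z t \<omega> = 1})"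
    by (intro Bochner_Integration.integral_cong refl) (auto simp: indicator_def dest: z01[of _ t])
  also have "\<dots> = measure M {\<omega>\<in>space M. z t \<omega> = 1}"
    by (subst Bochner_Integration.integral_indicator) (auto simp: Int_def intro!: arg_cong[where f="measure M"])
  finally show ?thesis by (simp add: z_prob)
qed

lemma g_nonneg: "0 \<le> g"
  using measure_nonneg[of M "{\<omega>\<in>space M. z 0 \<omega> = 1}"] unfolding z_prob .

lemma z_mult_independent:
  assumes J: "Inr (Inl t) \<notin> J" and X: "X \<in> borel_measurable (\<F> J)" and integrable: "integrable M X"
  shows "integrable M (\<lambda>\<omega>. z t \<omega> * X \<omega>)" "expectation (\<lambda>\<omega>. z t \<omega> * X \<omega>) = g * expectation X"
proof -
  have disj: "{Inr (Inl t)} \<inter> J = {}" using J by auto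
  have z: "z t \<in> borel_measurable (\<F> {Inr (Inl t)})" by (rule z_measurable_\<F>) simp
  show "integrable M (\<lambda>\<omega>. z t \<omega> * X \<omega>)" "expectation (\<lambda>\<omega>. z t \<omega> * X \<omega>) = g * expectation X"
    using expectation_mult_\<F>[OF disj z X integrable_z integrable] by (auto simp: expectation_z)
qed

lemma z_mult_xi:
  fixes h :: "real \<Rightarrow> real"
  assumes [measurable]: "h \<in> borel_measurable borel" and bounded: "\<And>x. \<bar>h x\<bar> \<le> C"
  shows "integrable M (\<lambda>\<omega>. z t \<omega> * h (xi t \<omega>))"
    and "expectation (\<lambda>\<omega>. z t \<omega> * h (xi t \<omega>)) = g * (\<integral>x. h x \<partial>GE)"
proof -
  have [measurable]: "xi t \<in> borel_measurable (\<F> {Inr (Inr t)})" by (rule xi_measurable_\<F>) simp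
  have "expectation (\<lambda>\<omega>. h (xi t \<omega>)) = (\<integral>x. h x \<partial>GE)"
    unfolding xi_distr[of t, symmetric] by (subst integral_distr) auto
  moreover have "integrable M (\<lambda>\<omega>. h (xi t \<omega>))"
    using bounded by (intro bounded_integrable[of _ C]) auto
  ultimately show "integrable M (\<lambda>\<omega>. z t \<omega> * h (xi t \<omega>))" "expectation (\<lambda>\<omega>. z t \<omega> * h (xi t \<omega>)) = g * (\<integral>x. h x \<partial>GE)"
    using z_mult_independent[of t "{Inr (Inr t)}" "\<lambda>\<omega>. h (xi t \<omega>)"] by auto
qed

lemma L1_bound_z_mult_v: "L1_bound M (\<lambda>\<omega>. z t \<omega> * \<bar>v r \<omega>\<bar>) (g * sqrt K)"
proof -
  have [measurable]: "v r \<in> borel_measurable (\<F> (Inl ` {..r}))"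
    using v by (simp add: causal_version_def)
  have "(\<lambda>\<omega>. \<bar>v r \<omega>\<bar>) \<in> borel_measurable (\<F> (Inl ` {..r}))" by measurable
  from z_mult_independent[of t, OF _ this L1_bound_integrable[OF L1_bound_v]]
  have prod: "integrable M (\<lambda>\<omega>. z t \<omega> * \<bar>v r \<omega>\<bar>)"
    "expectation (\<lambda>\<omega>. z t \<omega> * \<bar>v r \<omega>\<bar>) = g * expectation (\<lambda>\<omega>. \<bar>v r \<omega>\<bar>)" by auto
  have "expectation (\<lambda>\<omega>. \<bar>z t \<omega> * \<bar>v r \<omega>\<bar>\<bar>) = expectation (\<lambda>\<omega>. z t \<omega> * \<bar>v r \<omega>\<bar>)"
    by (intro Bochner_Integration.integral_cong refl) (simp add: z_nonneg)
  also have "\<dots> \<le> g * sqrt K"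
    using L1_bound_v[of r] g_nonneg by (simp add: prod(2) L1_bound_def mult_left_mono)
  finally show ?thesis using prod(1) by (simp add: L1_bound_def)
qed

lemma L1_bound_z_mult_z:
  assumes "r \<noteq> t"
  shows "L1_bound M (\<lambda>\<omega>. z t \<omega> * z r \<omega>) (g * g)"
proof -
  have "z r \<in> borel_measurable (\<F> {Inr (Inl r)})" by (rule z_measurable_\<F>) simp
  note prod = z_mult_independent[of t, OF _ this integrable_z]
  have "expectation (\<lambda>\<omega>. \<bar>z t \<omega> * z r \<omega>\<bar>) = expectation (\<lambda>\<omega>. z t \<omega> * z r \<omega>)"
    by (intro Bochner_Integration.integral_cong refl) (simp add: z_nonneg)
  then show ?thesis using prod assms by (simp add: L1_bound_def expectation_z)
qed

lemma L1_bound_truncated_outlier: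
  assumes a_nonneg: "0 \<le> a"
  shows "L1_bound M (\<lambda>\<omega>. min 1 (a * \<bar>outlier t \<omega>\<bar>)) (g * truncated_mean GE a)"
proof -
  have "expectation (\<lambda>\<omega>. \<bar>min 1 (a * \<bar>outlier t \<omega>\<bar>)\<bar>) = expectation (\<lambda>\<omega>. z t \<omega> * min 1 (a * \<bar>xi t \<omega>\<bar>))"
    using z01[of _ t] a_nonneg by (intro Bochner_Integration.integral_cong refl) (fastforce simp: outlier_def)
  also have "\<dots> = g * truncated_mean GE a"
    unfolding truncated_mean_def using a_nonneg by (intro z_mult_xi(2)[of _ 1]) auto
  finally show ?thesis
    using a_nonneg by (auto simp: L1_bound_def intro!: bounded_integrable[of _ 1])
qed

lemma L1_bound_hits: "L1_bound M (hits t) ((real p + 1) * g)"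
proof -
  have "L1_bound M (z r) g" for r
  proof -
    have "expectation (\<lambda>\<omega>. \<bar>z r \<omega>\<bar>) = expectation (z r)"
      by (intro Bochner_Integration.integral_cong refl) (simp add: z_nonneg)
    then show ?thesis by (simp add: L1_bound_def integrable_z expectation_z)
  qed
  then have "L1_bound M (hits t) (\<Sum>j=0..p. g)"
    unfolding hits_def[abs_def] by (rule L1_bound_sum)
  then show ?thesis by (simp add: add.commute)
qed

lemma hits_nonneg: "\<omega> \<in> space M \<Longrightarrow> 0 \<le> hits t \<omega>"
  unfolding hits_def by (intro sum_nonneg z_nonneg)

lemma lag_v_nonneg: "0 \<le> lag_v t \<omega>"
  unfolding lag_v_def by (intro sum_nonneg) auto

lemma outlier_mod_nonneg: "0 \<le> D \<Longrightarrow> 0 \<le> outlier_mod D t \<omega>"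
  unfolding outlier_mod_def using L_nonneg by (intro sum_nonneg) auto

lemma hits_cases:
  assumes \<omega>: "\<omega> \<in> space M"
  obtains (clean) "\<And>j. j \<in> {0..p} \<Longrightarrow> outlier (t - int j) \<omega> = 0"
  | (hit) "1 \<le> hits t \<omega>"
proof (cases "\<forall>j\<in>{0..p}. z (t - int j) \<omega> = 0")
  case True
  then show ?thesis by (intro clean) (auto simp: outlier_def)
next
  case False
  then obtain j where j: "j \<in> {0..p}" "z (t - int j) \<omega> \<noteq> 0" by auto
  then have "1 = z (t - int j) \<omega>" using z01[OF \<omega>, of "t - int j"] by auto
  also have "\<dots> \<le> hits t \<omega>"
    unfolding hits_def using j(1) by (intro member_le_sum z_nonneg \<omega>) auto
  finally show ?thesis by (rule hit)
qed

lemma contam_clean: "(\<And>j. j \<in> {0..p} \<Longrightarrow> outlier (t - int j) \<omega> = 0) \<Longrightarrow> contam t \<omega> = 0"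
  unfolding contam_def by (intro sum.neutral) auto

lemma lin_err_clean: "(\<And>j. j \<in> {0..p} \<Longrightarrow> outlier (t - int j) \<omega> = 0) \<Longrightarrow> lin_err \<tau> t \<omega> = clean_err \<tau> t \<omega>"
  unfolding lin_err_def clean_err_def by (intro arg_cong2[where f="(/)"] sum.cong) auto

lemma abs_lin_err_diff_le:
  assumes close: "\<And>i. i \<in> {1..p} \<Longrightarrow> \<bar>\<tau>' i - \<tau> i\<bar> \<le> \<eta>"
  shows "\<bar>lin_err \<tau>' t \<omega> - lin_err \<tau> t \<omega>\<bar> \<le> \<eta> * lag_size t \<omega> / sqrt (real n)"
proof -
  have "lin_err \<tau>' t \<omega> - lin_err \<tau> t \<omega>
      = (\<Sum>i=1..p. (\<tau>' i - \<tau> i) * (v (t - int i) \<omega> + outlier (t - int i) \<omega>)) / sqrt (real n)"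
    unfolding lin_err_def by (simp add: left_diff_distrib sum_subtractf diff_divide_distrib)
  moreover have "\<bar>\<Sum>i=1..p. (\<tau>' i - \<tau> i) * (v (t - int i) \<omega> + outlier (t - int i) \<omega>)\<bar> \<le> \<eta> * lag_size t \<omega>"
    unfolding lag_size_def sum_distrib_left
  proof (rule order_trans[OF sum_abs], rule sum_mono)
    fix i assume i: "i \<in> {1..p}"
    show "\<bar>(\<tau>' i - \<tau> i) * (v (t - int i) \<omega> + outlier (t - int i) \<omega>)\<bar>
        \<le> \<eta> * (\<bar>v (t - int i) \<omega>\<bar> + \<bar>outlier (t - int i) \<omega>\<bar>)"
      unfolding abs_mult using close[OF i] by (intro mult_mono abs_triangle_ineq) auto
  qed
  ultimately show ?thesis
    by (simp add: divide_right_mono)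
qed

lemma abs_lin_err_le: "\<bar>lin_err \<tau> t \<omega>\<bar> \<le> tau_size \<tau> * lag_size t \<omega> / sqrt (real n)"
  using abs_lin_err_diff_le[of \<tau> "\<lambda>_. 0" "tau_size \<tau>" t \<omega>] by (simp add: abs_le_tau_size lin_err_def)

lemma abs_clean_err_le: "\<bar>clean_err \<tau> t \<omega>\<bar> \<le> tau_size \<tau> / sqrt (real n) * lag_v t \<omega>"
proof -
  have "\<bar>\<Sum>i=1..p. \<tau> i * v (t - int i) \<omega>\<bar> \<le> tau_size \<tau> * lag_v t \<omega>"
    unfolding lag_v_def sum_distrib_left
    by (rule order_trans[OF sum_abs]) (auto simp: abs_mult intro!: sum_mono mult_right_mono abs_le_tau_size)
  then show ?thesis
    unfolding clean_err_def by (simp add: divide_right_mono)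
qed

lemma clean_err_square_le: "(clean_err \<tau> t \<omega>)\<^sup>2 \<le> (tau_size \<tau>)\<^sup>2 / real n * (\<Sum>i=1..p. (v (t - int i) \<omega>)\<^sup>2)"
proof -
  have "(\<Sum>i=1..p. (\<tau> i)\<^sup>2) = (L2_set \<tau> {1..p})\<^sup>2" by (simp add: L2_set_def sum_nonneg)
  also have "\<dots> \<le> (tau_size \<tau>)\<^sup>2"
    unfolding tau_size_def by (intro power_mono L2_set_le_sum_abs L2_set_nonneg)
  finally have "(\<Sum>i=1..p. (\<tau> i)\<^sup>2) * (\<Sum>i=1..p. (v (t - int i) \<omega>)\<^sup>2) \<le> (tau_size \<tau>)\<^sup>2 * (\<Sum>i=1..p. (v (t - int i) \<omega>)\<^sup>2)"
    by (intro mult_right_mono sum_nonneg) auto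
  with Cauchy_Schwarz_ineq_sum[of \<tau> "\<lambda>i. v (t - int i) \<omega>" "{1..p}"] show ?thesis
    unfolding clean_err_def by (simp add: power_divide divide_right_mono)
qed

lemma abs_cdf_diff_le_lag_mod:
  assumes D_nonneg: "0 \<le> D" and close: "\<bar>a - a'\<bar> \<le> D * lag_size t \<omega> / sqrt (real n)"
  shows "\<bar>cdf G a - cdf G a'\<bar> \<le> lag_mod D t \<omega>"
proof -
  define c where "c = L * D / sqrt (real n)"
  have c_nonneg: "0 \<le> c" using L_nonneg D_nonneg by (simp add: c_def)
  let ?S = "\<Sum>i=1..p. c * \<bar>outlier (t - int i) \<omega>\<bar>"
  have "\<bar>cdf G a - cdf G a'\<bar> \<le> L * \<bar>a - a'\<bar>" by (rule G_lipschitz)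
  also have "\<dots> \<le> L * (D * lag_size t \<omega> / sqrt (real n))" using close L_nonneg by (rule mult_left_mono)
  also have "\<dots> = c * lag_v t \<omega> + ?S"
    by (simp add: c_def lag_size_def lag_v_def sum.distrib add_divide_distrib distrib_left mult_ac
        flip: sum_distrib_left)
      (simp add: sum_distrib_left sum_divide_distrib)
  finally have "\<bar>cdf G a - cdf G a'\<bar> \<le> c * lag_v t \<omega> + ?S" .
  moreover have "0 \<le> c * lag_v t \<omega>" using c_nonneg lag_v_nonneg by simp
  moreover have "0 \<le> ?S" using c_nonneg by (intro sum_nonneg) auto
  ultimately have "\<bar>cdf G a - cdf G a'\<bar> \<le> c * lag_v t \<omega> + min 1 \<bar>?S\<bar>"
    using G.abs_cdf_diff_le_1[of a a'] by (simp add: min_def)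
  also have "min 1 \<bar>?S\<bar> \<le> (\<Sum>i=1..p. min 1 \<bar>c * \<bar>outlier (t - int i) \<omega>\<bar>\<bar>)"
    by (rule min_one_abs_sum_le) simp
  also have "\<dots> = outlier_mod D t \<omega>"
    using c_nonneg by (simp add: outlier_mod_def c_def[symmetric] abs_mult)
  finally show ?thesis by (simp add: lag_mod_def c_def)
qed

lemma L1_bound_lag_v: "L1_bound M (lag_v t) (real p * sqrt K)"
proof -
  have "L1_bound M (lag_v t) (\<Sum>i=1..p. sqrt K)"
    unfolding lag_v_def[abs_def] by (intro L1_bound_sum L1_bound_v)
  then show ?thesis by simp
qed

lemma L1_bound_outlier_mod:
  assumes "0 \<le> D"
  shows "L1_bound M (outlier_mod D t) (real p * (g * truncated_mean GE (L * D / sqrt (real n))))"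
proof -
  have "L1_bound M (outlier_mod D t) (\<Sum>i=1..p. g * truncated_mean GE (L * D / sqrt (real n)))"
    unfolding outlier_mod_def[abs_def] using assms L_nonneg by (intro L1_bound_sum L1_bound_truncated_outlier) auto
  then show ?thesis by simp
qed

lemma L1_bound_lag_mod:
  assumes "0 \<le> D"
  shows "L1_bound M (lag_mod D t) (lag_bound D)"
proof -
  have "L1_bound M (lag_mod D t) (\<bar>L * D / sqrt (real n)\<bar> * (real p * sqrt K)
      + real p * (g * truncated_mean GE (L * D / sqrt (real n))))"
    unfolding lag_mod_def[abs_def]
    by (intro L1_bound_add L1_bound_cmult L1_bound_lag_v L1_bound_outlier_mod assms)
  then show ?thesis using assms L_nonneg by (simp add: lag_bound_def)
qed

lemma L1_bound_drift_threshold: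
  "L1_bound M (drift (threshold y \<tau>) (\<lambda>_ _. y) t) (lag_bound (tau_size \<tau>) + (real p + 1) * g)"
proof (rule L1_bound_dominated)
  show "drift (threshold y \<tau>) (\<lambda>_ _. y) t \<in> borel_measurable M"
    by (rule drift_measurable[OF predictable_threshold predictable_const])
  show "L1_bound M (\<lambda>\<omega>. lag_mod (tau_size \<tau>) t \<omega> + hits t \<omega>) (lag_bound (tau_size \<tau>) + (real p + 1) * g)"
    by (intro L1_bound_add L1_bound_lag_mod L1_bound_hits tau_size_nonneg)
  fix \<omega> assume \<omega>: "\<omega> \<in> space M"
  have "\<bar>cdf G (threshold y \<tau> t \<omega>) - cdf G (y + contam t \<omega>)\<bar> \<le> lag_mod (tau_size \<tau>) t \<omega>"
    by (rule abs_cdf_diff_le_lag_mod[OF tau_size_nonneg]) (use abs_lin_err_le in \<open>simp add: threshold_def\<close>)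
  moreover have "\<bar>cdf G (y + contam t \<omega>) - cdf G y\<bar> \<le> hits t \<omega>"
    using \<omega>
  proof (cases rule: hits_cases[of \<omega> t])
    case clean
    then have "contam t \<omega> = 0" by (rule contam_clean)
    then show ?thesis using hits_nonneg[OF \<omega>] by simp
  next
    case hit
    with G.abs_cdf_diff_le_1[of "y + contam t \<omega>" y] show ?thesis by linarith
  qed
  ultimately show "\<bar>drift (threshold y \<tau>) (\<lambda>_ _. y) t \<omega>\<bar> \<le> lag_mod (tau_size \<tau>) t \<omega> + hits t \<omega>"
    unfolding drift_def by linarith
qed

definition outlier_shift :: "real \<Rightarrow> nat \<Rightarrow> real \<Rightarrow> real" where
  "outlier_shift y j w = cdf G (y + b j * w) - cdf G y"

definition mean_outlier_shift :: "real \<Rightarrow> nat \<Rightarrow> real" where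
  "mean_outlier_shift y j = (\<integral>w. outlier_shift y j w \<partial>GE)"

lemma outlier_shift_measurable[measurable]: "outlier_shift y j \<in> borel_measurable borel"
  unfolding outlier_shift_def[abs_def] by measurable

lemma abs_outlier_shift_le_1: "\<bar>outlier_shift y j w\<bar> \<le> 1"
  unfolding outlier_shift_def by (rule G.abs_cdf_diff_le_1)

lemma z_mult_outlier_shift_le: "\<omega> \<in> space M \<Longrightarrow> \<bar>z t \<omega> * outlier_shift y j w\<bar> \<le> z t \<omega>"
  using z01[of \<omega> t] abs_outlier_shift_le_1[of y j w] by auto

text \<open>\<open>separation_err\<close> is the cost of separating the contamination from the estimation error in the drift,
  \<open>multiplicity_err\<close> that of treating the contaminated positions one at a time; both are bounded by
  products of two small factors.\<close>

definition separation_err :: "real \<Rightarrow> (nat \<Rightarrow> real) \<Rightarrow> int \<Rightarrow> 'a \<Rightarrow> real" where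
  "separation_err y \<tau> t \<omega> = (cdf G (threshold y \<tau> t \<omega>) - cdf G (y + contam t \<omega>))
     - (cdf G (y + clean_err \<tau> t \<omega>) - cdf G y)"

definition multiplicity_err :: "real \<Rightarrow> int \<Rightarrow> 'a \<Rightarrow> real" where
  "multiplicity_err y t \<omega> = (cdf G (y + contam t \<omega>) - cdf G y)
     - (\<Sum>j=0..p. z (t - int j) \<omega> * outlier_shift y j (xi (t - int j) \<omega>))"

lemma abs_separation_err_le:
  assumes \<omega>: "\<omega> \<in> space M"
  shows "\<bar>separation_err y \<tau> t \<omega>\<bar>
    \<le> 2 * L * tau_size \<tau> / sqrt (real n) * (hits t \<omega> * lag_v t \<omega>) + outlier_mod (tau_size \<tau>) t \<omega>"
  using \<omega>
proof (cases rule: hits_cases[of \<omega> t])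
  case clean
  have "contam t \<omega> = 0" "lin_err \<tau> t \<omega> = clean_err \<tau> t \<omega>"
    using contam_clean[OF clean] lin_err_clean[OF clean] by simp_all
  then have "separation_err y \<tau> t \<omega> = 0"
    by (simp add: separation_err_def threshold_def)
  moreover have "0 \<le> 2 * L * tau_size \<tau> / sqrt (real n) * (hits t \<omega> * lag_v t \<omega>)"
    using L_nonneg tau_size_nonneg lag_v_nonneg hits_nonneg[OF \<omega>]
    by (intro mult_nonneg_nonneg divide_nonneg_nonneg) auto
  ultimately show ?thesis using outlier_mod_nonneg[OF tau_size_nonneg] by simp
next
  case hit
  define c where "c = L * tau_size \<tau> / sqrt (real n)"
  have c_nonneg: "0 \<le> c" using L_nonneg tau_size_nonneg by (simp add: c_def)
  have "\<bar>cdf G (threshold y \<tau> t \<omega>) - cdf G (y + contam t \<omega>)\<bar> \<le> lag_mod (tau_size \<tau>) t \<omega>"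
    by (rule abs_cdf_diff_le_lag_mod[OF tau_size_nonneg]) (use abs_lin_err_le in \<open>simp add: threshold_def\<close>)
  moreover have "\<bar>cdf G (y + clean_err \<tau> t \<omega>) - cdf G y\<bar> \<le> c * lag_v t \<omega>"
    using G_lipschitz[of "y + clean_err \<tau> t \<omega>" y] mult_left_mono[OF abs_clean_err_le L_nonneg, of \<tau> t \<omega>]
    by (simp add: c_def)
  ultimately have "\<bar>separation_err y \<tau> t \<omega>\<bar> \<le> 2 * c * lag_v t \<omega> + outlier_mod (tau_size \<tau>) t \<omega>"
    unfolding separation_err_def lag_mod_def c_def[symmetric] by linarith
  also have "2 * c * lag_v t \<omega> \<le> 2 * c * (hits t \<omega> * lag_v t \<omega>)"
    using mult_right_mono[OF hit lag_v_nonneg, of t \<omega>] c_nonneg by (intro mult_left_mono) auto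
  finally show ?thesis by (simp add: c_def mult.assoc)
qed

lemma L1_bound_separation_err:
  "L1_bound M (separation_err y \<tau> t) (g * (2 * L * tau_size \<tau> / sqrt (real n) * ((real p + 1) * real p * sqrt K)
     + real p * truncated_mean GE (L * tau_size \<tau> / sqrt (real n))))"
proof (rule L1_bound_dominated)
  show "separation_err y \<tau> t \<in> borel_measurable M"
    unfolding separation_err_def[abs_def] by measurable
  have "L1_bound M (\<lambda>\<omega>. \<Sum>j=0..p. \<Sum>i=1..p. z (t - int j) \<omega> * \<bar>v (t - int i) \<omega>\<bar>) (\<Sum>j=0..p. \<Sum>i=1..p. g * sqrt K)"
    by (intro L1_bound_sum L1_bound_z_mult_v)
  then have "L1_bound M (\<lambda>\<omega>. hits t \<omega> * lag_v t \<omega>) ((real p + 1) * real p * (g * sqrt K))"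
    by (simp add: hits_def lag_v_def sum_product algebra_simps)
  from L1_bound_add[OF L1_bound_cmult[OF this, of "2 * L * tau_size \<tau> / sqrt (real n)"]
      L1_bound_outlier_mod[OF tau_size_nonneg]]
  show "L1_bound M (\<lambda>\<omega>. 2 * L * tau_size \<tau> / sqrt (real n) * (hits t \<omega> * lag_v t \<omega>) + outlier_mod (tau_size \<tau>) t \<omega>)
      (g * (2 * L * tau_size \<tau> / sqrt (real n) * ((real p + 1) * real p * sqrt K)
        + real p * truncated_mean GE (L * tau_size \<tau> / sqrt (real n))))"
    using L_nonneg tau_size_nonneg by (simp add: distrib_left mult_ac)
qed (rule abs_separation_err_le)

lemma L1_bound_clean_shift_sum:
  "L1_bound M (\<lambda>\<omega>. \<Sum>t=1..int n. cdf G (y + clean_err \<tau> t \<omega>) - cdf G y)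
    (L * tau_size \<tau> * K + B * (tau_size \<tau>)\<^sup>2 * real p * K)"
proof -
  let ?r = "sqrt (real n)"
  have remainder: "L1_bound M (\<lambda>\<omega>. cdf G (y + clean_err \<tau> t \<omega>) - cdf G y - f y * clean_err \<tau> t \<omega>)
      (B * ((tau_size \<tau>)\<^sup>2 / real n) * (real p * K))" for t
  proof (rule L1_bound_dominated)
    fix \<omega>
    have "\<bar>cdf G (y + clean_err \<tau> t \<omega>) - cdf G y - f y * clean_err \<tau> t \<omega>\<bar> \<le> B * (clean_err \<tau> t \<omega>)\<^sup>2" by (rule G_taylor)
    also have "\<dots> \<le> B * ((tau_size \<tau>)\<^sup>2 / real n * (\<Sum>i=1..p. (v (t - int i) \<omega>)\<^sup>2))"
      using B_nonneg by (intro mult_left_mono clean_err_square_le)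
    finally show "\<bar>cdf G (y + clean_err \<tau> t \<omega>) - cdf G y - f y * clean_err \<tau> t \<omega>\<bar>
        \<le> B * ((tau_size \<tau>)\<^sup>2 / real n) * (\<Sum>i=1..p. (v (t - int i) \<omega>)\<^sup>2)" by simp
  next
    have "L1_bound M (\<lambda>\<omega>. B * ((tau_size \<tau>)\<^sup>2 / real n) * (\<Sum>i=1..p. (v (t - int i) \<omega>)\<^sup>2))
        (\<bar>B * ((tau_size \<tau>)\<^sup>2 / real n)\<bar> * (\<Sum>i=1..p. K))"
      by (intro L1_bound_cmult L1_bound_sum L1_bound_v_square)
    then show "L1_bound M (\<lambda>\<omega>. B * ((tau_size \<tau>)\<^sup>2 / real n) * (\<Sum>i=1..p. (v (t - int i) \<omega>)\<^sup>2))
        (B * ((tau_size \<tau>)\<^sup>2 / real n) * (real p * K))"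
      using B_nonneg by (simp add: abs_mult)
  qed measurable
  have "f y * (\<Sum>t=1..int n. clean_err \<tau> t \<omega>) = (\<Sum>i=1..p. f y * \<tau> i / ?r * (\<Sum>t=1..int n. v (t - int i) \<omega>))" for \<omega>
    unfolding clean_err_def sum_divide_distrib[symmetric]
    by (subst sum.swap) (simp add: sum_distrib_left sum_divide_distrib mult_ac)
  moreover have "L1_bound M (\<lambda>\<omega>. \<Sum>i=1..p. f y * \<tau> i / ?r * (\<Sum>t=1..int n. v (t - int i) \<omega>))
      (\<Sum>i=1..p. \<bar>f y * \<tau> i / ?r\<bar> * (K * ?r))"
    by (intro L1_bound_sum L1_bound_cmult L1_bound_v_sum)
  moreover have "(\<Sum>i=1..p. \<bar>f y * \<tau> i / ?r\<bar> * (K * ?r)) = \<bar>f y\<bar> * tau_size \<tau> * K"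
    using sqrt_n_pos by (simp add: tau_size_def abs_mult sum_distrib_left sum_distrib_right mult_ac)
  ultimately have linear: "L1_bound M (\<lambda>\<omega>. f y * (\<Sum>t=1..int n. clean_err \<tau> t \<omega>)) (L * tau_size \<tau> * K)"
    using K_nonneg tau_size_nonneg f_bound[of y]
    by (auto intro!: L1_bound_weaken[of _ _ "\<bar>f y\<bar> * tau_size \<tau> * K"] mult_right_mono)
  have "L1_bound M (\<lambda>\<omega>. f y * (\<Sum>t=1..int n. clean_err \<tau> t \<omega>)
      + (\<Sum>t=1..int n. cdf G (y + clean_err \<tau> t \<omega>) - cdf G y - f y * clean_err \<tau> t \<omega>))
      (L * tau_size \<tau> * K + (\<Sum>t=1..int n. B * ((tau_size \<tau>)\<^sup>2 / real n) * (real p * K)))"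
    by (intro L1_bound_add L1_bound_sum linear remainder)
  then show ?thesis
    using n by (simp add: sum_subtractf sum_distrib_left mult_ac)
qed

lemma abs_multiplicity_err_le_const:
  assumes \<omega>: "\<omega> \<in> space M"
  shows "\<bar>multiplicity_err y t \<omega>\<bar> \<le> real p + 2"
proof -
  have "\<bar>\<Sum>j=0..p. z (t - int j) \<omega> * outlier_shift y j (xi (t - int j) \<omega>)\<bar> \<le> (\<Sum>j=0..p. 1)"
    by (rule order_trans[OF sum_abs])
      (intro sum_mono order_trans[OF z_mult_outlier_shift_le[OF \<omega>] z_le_1[OF \<omega>]])
  then show ?thesis
    using G.abs_cdf_diff_le_1[of "y + contam t \<omega>" y] unfolding multiplicity_err_def by simp
qed

lemma multiplicity_err_single:
  assumes \<omega>: "\<omega> \<in> space M" and j: "j \<in> {0..p}"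
    and others: "\<And>k. k \<in> {0..p} - {j} \<Longrightarrow> z (t - int k) \<omega> = 0"
  shows "multiplicity_err y t \<omega> = 0"
proof -
  have "contam t \<omega> = (\<Sum>j\<in>{j}. b j * outlier (t - int j) \<omega>)"
    unfolding contam_def using j others by (intro sum.mono_neutral_right) (auto simp: outlier_def)
  moreover have "(\<Sum>j=0..p. z (t - int j) \<omega> * outlier_shift y j (xi (t - int j) \<omega>))
      = (\<Sum>j\<in>{j}. z (t - int j) \<omega> * outlier_shift y j (xi (t - int j) \<omega>))"
    using j others by (intro sum.mono_neutral_right) auto
  ultimately show ?thesis
    using z01[OF \<omega>, of "t - int j"] by (auto simp: multiplicity_err_def outlier_def outlier_shift_def)
qed

lemma abs_multiplicity_err_le:
  assumes \<omega>: "\<omega> \<in> space M"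
  shows "\<bar>multiplicity_err y t \<omega>\<bar> \<le> (real p + 2) * (\<Sum>j=0..p. \<Sum>k\<in>{0..p} - {j}. z (t - int j) \<omega> * z (t - int k) \<omega>)"
    (is "_ \<le> _ * ?P")
proof -
  have nonneg: "0 \<le> z r \<omega> * z q \<omega>" for r q using z_nonneg[OF \<omega>] by simp
  consider (several) j k where "j \<in> {0..p}" "k \<in> {0..p} - {j}" "z (t - int j) \<omega> = 1" "z (t - int k) \<omega> = 1"
    | (at_most_one) j where "j \<in> {0..p}" "\<And>k. k \<in> {0..p} - {j} \<Longrightarrow> z (t - int k) \<omega> = 0"
    using z01[OF \<omega>] by (metis Diff_iff atLeastAtMost_iff empty_iff insert_iff le0 order_refl)
  then show ?thesis
  proof cases
    case several
    have "1 = z (t - int j) \<omega> * z (t - int k) \<omega>" using several by simp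
    also have "\<dots> \<le> (\<Sum>k\<in>{0..p} - {j}. z (t - int j) \<omega> * z (t - int k) \<omega>)"
      using several z_nonneg[OF \<omega>]
      by (intro member_le_sum[of k "{0..p} - {j}" "\<lambda>k. z (t - int j) \<omega> * z (t - int k) \<omega>"]) auto
    also have "\<dots> \<le> ?P"
      using several nonneg
      by (intro member_le_sum[of j "{0..p}" "\<lambda>j. \<Sum>k\<in>{0..p} - {j}. z (t - int j) \<omega> * z (t - int k) \<omega>"])
        (auto intro: sum_nonneg)
    finally have "(real p + 2) * 1 \<le> (real p + 2) * ?P" by (intro mult_left_mono) auto
    then have "real p + 2 \<le> (real p + 2) * ?P" by (simp only: mult_1_right)
    then show ?thesis by (rule order_trans[OF abs_multiplicity_err_le_const[OF \<omega>]])
  next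
    case at_most_one
    then have "multiplicity_err y t \<omega> = 0" by (rule multiplicity_err_single[OF \<omega>])
    then show ?thesis using nonneg by (simp add: sum_nonneg)
  qed
qed

lemma L1_bound_multiplicity_err:
  "L1_bound M (multiplicity_err y t) (g * ((real p + 2) * (real p + 1) * real p * g))"
proof (rule L1_bound_dominated)
  show "multiplicity_err y t \<in> borel_measurable M"
    unfolding multiplicity_err_def[abs_def] by measurable
  have "L1_bound M (\<lambda>\<omega>. (real p + 2) * (\<Sum>j=0..p. \<Sum>k\<in>{0..p} - {j}. z (t - int j) \<omega> * z (t - int k) \<omega>))
      (\<bar>real p + 2\<bar> * (\<Sum>j=0..p. \<Sum>k\<in>{0..p} - {j}. g * g))"
    by (intro L1_bound_cmult L1_bound_sum L1_bound_z_mult_z) auto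
  then show "L1_bound M (\<lambda>\<omega>. (real p + 2) * (\<Sum>j=0..p. \<Sum>k\<in>{0..p} - {j}. z (t - int j) \<omega> * z (t - int k) \<omega>))
      (g * ((real p + 2) * (real p + 1) * real p * g))"
    by (simp add: algebra_simps)
qed (rule abs_multiplicity_err_le)

lemma L1_bound_outlier_shift_sum:
  "L1_bound M (\<lambda>\<omega>. \<Sum>t=1..int n. z (t - int j) \<omega> * outlier_shift y j (xi (t - int j) \<omega>) - g * mean_outlier_shift y j)
    (sqrt (real n) * sqrt g)"
proof -
  let ?X = "\<lambda>t \<omega>. z (t - int j) \<omega> * outlier_shift y j (xi (t - int j) \<omega>)"
  let ?J = "\<lambda>t. {Inr (Inl (t - int j)), Inr (Inr (t - int j))}"
  have "L1_bound M (\<lambda>\<omega>. \<Sum>t=1..int n. ?X t \<omega> - g * mean_outlier_shift y j) (sqrt (real (card {1..int n})) * sqrt g)"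
  proof (rule L1_bound_centered_sum[where J="?J"])
    show "?X t \<in> borel_measurable (\<F> (?J t))" for t
    proof -
      have [measurable]: "z (t - int j) \<in> borel_measurable (\<F> (?J t))" "xi (t - int j) \<in> borel_measurable (\<F> (?J t))"
        by (auto intro: z_measurable_\<F> xi_measurable_\<F>)
      show ?thesis by measurable
    qed
    show "integrable M (?X t)" "expectation (?X t) = g * mean_outlier_shift y j" for t
      unfolding mean_outlier_shift_def by (rule z_mult_xi[OF outlier_shift_measurable abs_outlier_shift_le_1])+
    have square_le: "(?X t \<omega>)\<^sup>2 \<le> z (t - int j) \<omega>" if "\<omega> \<in> space M" for t \<omega>
      using z01[OF that, of "t - int j"] abs_outlier_shift_le_1[of y j "xi (t - int j) \<omega>"]
      by (auto simp: abs_square_le_1)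
    show integrable: "integrable M (\<lambda>\<omega>. (?X t \<omega>)\<^sup>2)" for t
      by (rule bounded_integrable[of _ 1]) (auto intro: order_trans[OF square_le z_le_1])
    show "expectation (\<lambda>\<omega>. (?X t \<omega>)\<^sup>2) \<le> g" for t
      using integral_mono[OF integrable integrable_z square_le] by (simp add: expectation_z)
  qed auto
  then show ?thesis by simp
qed

definition shift_dev :: "real \<Rightarrow> (nat \<Rightarrow> real) \<Rightarrow> 'a \<Rightarrow> real" where
  "shift_dev y \<tau> \<omega> = (\<Sum>t=1..int n. increment (threshold y \<tau>) (\<lambda>_ _. y) t \<omega>) / sqrt (real n)
     - sqrt (real n) * g * (\<Sum>j=0..p. mean_outlier_shift y j)"

definition shift_bound :: "real \<Rightarrow> real" where
  "shift_bound C = sqrt (lag_bound C + (real p + 1) * g)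
     + sqrt (real n) * (g * (2 * L * C / sqrt (real n) * ((real p + 1) * real p * sqrt K)
         + real p * truncated_mean GE (L * C / sqrt (real n))))
     + (L * C * K + B * C\<^sup>2 * real p * K) / sqrt (real n)
     + sqrt (real n) * (g * ((real p + 2) * (real p + 1) * real p * g))
     + (real p + 1) * sqrt g"

lemma shift_dev_decomposition:
  "shift_dev y \<tau> \<omega> = (\<Sum>t=1..int n. mart_diff (threshold y \<tau>) (\<lambda>_ _. y) t \<omega>) / sqrt (real n)
    + (\<Sum>t=1..int n. separation_err y \<tau> t \<omega>) / sqrt (real n)
    + (\<Sum>t=1..int n. cdf G (y + clean_err \<tau> t \<omega>) - cdf G y) / sqrt (real n)
    + (\<Sum>t=1..int n. multiplicity_err y t \<omega>) / sqrt (real n)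
    + (\<Sum>j=0..p. \<Sum>t=1..int n. z (t - int j) \<omega> * outlier_shift y j (xi (t - int j) \<omega>) - g * mean_outlier_shift y j)
      / sqrt (real n)"
proof -
  let ?N = "\<lambda>j t. z (t - int j) \<omega> * outlier_shift y j (xi (t - int j) \<omega>) - g * mean_outlier_shift y j"
  have "increment (threshold y \<tau>) (\<lambda>_ _. y) t \<omega> = mart_diff (threshold y \<tau>) (\<lambda>_ _. y) t \<omega> + separation_err y \<tau> t \<omega>
      + (cdf G (y + clean_err \<tau> t \<omega>) - cdf G y) + multiplicity_err y t \<omega> + (\<Sum>j=0..p. ?N j t)
      + (\<Sum>j=0..p. g * mean_outlier_shift y j)" for t
    unfolding mart_diff_def drift_def separation_err_def multiplicity_err_def by (simp add: sum_subtractf)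
  then have "(\<Sum>t=1..int n. increment (threshold y \<tau>) (\<lambda>_ _. y) t \<omega>)
    = (\<Sum>t=1..int n. mart_diff (threshold y \<tau>) (\<lambda>_ _. y) t \<omega>) + (\<Sum>t=1..int n. separation_err y \<tau> t \<omega>)
      + (\<Sum>t=1..int n. cdf G (y + clean_err \<tau> t \<omega>) - cdf G y) + (\<Sum>t=1..int n. multiplicity_err y t \<omega>)
      + (\<Sum>t=1..int n. \<Sum>j=0..p. ?N j t) + real n * (g * (\<Sum>j=0..p. mean_outlier_shift y j))"
    by (simp only: sum.distrib) (simp add: sum_distrib_left)
  also have "(\<Sum>t=1..int n. \<Sum>j=0..p. ?N j t) = (\<Sum>j=0..p. \<Sum>t=1..int n. ?N j t)"
    by (rule sum.swap)
  finally show ?thesis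
    unfolding shift_dev_def by (simp only: add_divide_distrib) (simp add: real_div_sqrt flip: times_divide_eq_left)
qed

lemma L1_bound_shift_dev: "L1_bound M (shift_dev y \<tau>) (shift_bound (tau_size \<tau>))"
proof -
  have outlier: "L1_bound M (\<lambda>\<omega>. (\<Sum>j=0..p. \<Sum>t=1..int n. z (t - int j) \<omega> * outlier_shift y j (xi (t - int j) \<omega>)
      - g * mean_outlier_shift y j) / sqrt (real n)) ((real p + 1) * sqrt g)"
  proof -
    have "L1_bound M (\<lambda>\<omega>. (\<Sum>j=0..p. \<Sum>t=1..int n. z (t - int j) \<omega> * outlier_shift y j (xi (t - int j) \<omega>)
        - g * mean_outlier_shift y j) / sqrt (real n)) ((\<Sum>j=0..p. sqrt (real n) * sqrt g) / sqrt (real n))"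
      by (intro L1_bound_divide L1_bound_sum L1_bound_outlier_shift_sum sqrt_n_pos)
    also have "(\<Sum>j=0..p. sqrt (real n) * sqrt g) / sqrt (real n) = (real p + 1) * sqrt g"
      using sqrt_n_pos by (simp add: add.commute)
    finally show ?thesis .
  qed
  show ?thesis
    unfolding shift_dev_decomposition[abs_def] shift_bound_def
    by (intro L1_bound_add L1_bound_mart_diff_sum predictable_threshold predictable_const L1_bound_drift_threshold
        L1_bound_normalised_sum L1_bound_separation_err L1_bound_divide[OF L1_bound_clean_shift_sum sqrt_n_pos]
        L1_bound_multiplicity_err outlier)
qed

text \<open>Moving \<open>\<tau>\<close> by at most \<open>\<eta>\<close> moves the threshold by at most \<open>\<eta> * lag_size t / sqrt n\<close>, so that
  by monotonicity the counts between the two extreme thresholds control all such \<open>\<tau>\<close> simultaneously.\<close>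

definition upper_threshold :: "real \<Rightarrow> (nat \<Rightarrow> real) \<Rightarrow> real \<Rightarrow> int \<Rightarrow> 'a \<Rightarrow> real" where
  "upper_threshold y \<tau> \<eta> t \<omega> = threshold y \<tau> t \<omega> + \<eta> * lag_size t \<omega> / sqrt (real n)"

definition lower_threshold :: "real \<Rightarrow> (nat \<Rightarrow> real) \<Rightarrow> real \<Rightarrow> int \<Rightarrow> 'a \<Rightarrow> real" where
  "lower_threshold y \<tau> \<eta> t \<omega> = threshold y \<tau> t \<omega> - \<eta> * lag_size t \<omega> / sqrt (real n)"

definition bracket_mart :: "real \<Rightarrow> (nat \<Rightarrow> real) \<Rightarrow> real \<Rightarrow> 'a \<Rightarrow> real" where
  "bracket_mart y \<tau> \<eta> \<omega>
     = (\<Sum>t=1..int n. mart_diff (upper_threshold y \<tau> \<eta>) (lower_threshold y \<tau> \<eta>) t \<omega>) / sqrt (real n)"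

definition bracket_drift :: "real \<Rightarrow> 'a \<Rightarrow> real" where
  "bracket_drift \<eta> \<omega> = (\<Sum>t=1..int n. lag_mod (2 * \<eta>) t \<omega>) / sqrt (real n)"

lemma predictable_upper_threshold: "predictable (upper_threshold y \<tau> \<eta>)"
  unfolding upper_threshold_def[abs_def] by (intro predictable_add predictable_threshold predictable_lag_size)

lemma predictable_lower_threshold: "predictable (lower_threshold y \<tau> \<eta>)"
  unfolding lower_threshold_def[abs_def] by (intro predictable_diff predictable_threshold predictable_lag_size)

lemma abs_drift_bracket_le:
  assumes \<eta>_nonneg: "0 \<le> \<eta>"
  shows "\<bar>drift (upper_threshold y \<tau> \<eta>) (lower_threshold y \<tau> \<eta>) t \<omega>\<bar> \<le> lag_mod (2 * \<eta>) t \<omega>"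
proof -
  have "0 \<le> \<eta> * lag_size t \<omega> / sqrt (real n)"
    unfolding lag_size_def using \<eta>_nonneg by (intro divide_nonneg_nonneg mult_nonneg_nonneg sum_nonneg) auto
  then show ?thesis
    unfolding drift_def using \<eta>_nonneg
    by (intro abs_cdf_diff_le_lag_mod) (auto simp: upper_threshold_def lower_threshold_def)
qed

lemma L1_bound_bracket_mart:
  assumes \<eta>_nonneg: "0 \<le> \<eta>"
  shows "L1_bound M (bracket_mart y \<tau> \<eta>) (sqrt (lag_bound (2 * \<eta>)))"
proof -
  have "L1_bound M (drift (upper_threshold y \<tau> \<eta>) (lower_threshold y \<tau> \<eta>) t) (lag_bound (2 * \<eta>))" for t
    by (rule L1_bound_dominated[OF _ abs_drift_bracket_le[OF \<eta>_nonneg] L1_bound_lag_mod])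
      (use \<eta>_nonneg drift_measurable[OF predictable_upper_threshold predictable_lower_threshold] in auto)
  from L1_bound_mart_diff_sum[OF predictable_upper_threshold predictable_lower_threshold this]
  show ?thesis unfolding bracket_mart_def .
qed

lemma L1_bound_bracket_drift: "0 \<le> \<eta> \<Longrightarrow> L1_bound M (bracket_drift \<eta>) (sqrt (real n) * lag_bound (2 * \<eta>))"
  unfolding bracket_drift_def by (intro L1_bound_normalised_sum L1_bound_lag_mod) simp

lemma abs_shift_dev_le_bracket:
  assumes \<eta>_nonneg: "0 \<le> \<eta>" and close: "\<And>i. i \<in> {1..p} \<Longrightarrow> \<bar>\<tau>' i - \<tau> i\<bar> \<le> \<eta>"
  shows "\<bar>shift_dev y \<tau>' \<omega>\<bar> \<le> \<bar>shift_dev y \<tau> \<omega>\<bar> + \<bar>bracket_mart y \<tau> \<eta> \<omega>\<bar> + bracket_drift \<eta> \<omega>"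
proof -
  let ?I = "increment (upper_threshold y \<tau> \<eta>) (lower_threshold y \<tau> \<eta>)"
  have "\<bar>increment (threshold y \<tau>') (threshold y \<tau>) t \<omega>\<bar> \<le> ?I t \<omega>" for t
    unfolding increment_def upper_threshold_def lower_threshold_def
    using abs_lin_err_diff_le[of \<tau>' \<tau> \<eta> t \<omega>] close by (intro abs_below_diff_le) (simp add: threshold_def)
  then have "\<bar>\<Sum>t=1..int n. increment (threshold y \<tau>') (threshold y \<tau>) t \<omega>\<bar> \<le> (\<Sum>t=1..int n. ?I t \<omega>)"
    by (intro order_trans[OF sum_abs] sum_mono)
  also have "\<dots> \<le> (\<Sum>t=1..int n. mart_diff (upper_threshold y \<tau> \<eta>) (lower_threshold y \<tau> \<eta>) t \<omega> + lag_mod (2 * \<eta>) t \<omega>)"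
  proof (rule sum_mono)
    fix t show "?I t \<omega> \<le> mart_diff (upper_threshold y \<tau> \<eta>) (lower_threshold y \<tau> \<eta>) t \<omega> + lag_mod (2 * \<eta>) t \<omega>"
      using abs_drift_bracket_le[OF \<eta>_nonneg, of y \<tau> t \<omega>] unfolding mart_diff_def by linarith
  qed
  finally have "\<bar>\<Sum>t=1..int n. increment (threshold y \<tau>') (threshold y \<tau>) t \<omega>\<bar> / sqrt (real n)
      \<le> bracket_mart y \<tau> \<eta> \<omega> + bracket_drift \<eta> \<omega>"
    unfolding bracket_mart_def bracket_drift_def add_divide_distrib[symmetric] sum.distrib[symmetric]
    by (rule divide_right_mono) simp
  moreover have "shift_dev y \<tau>' \<omega> - shift_dev y \<tau> \<omega>
      = (\<Sum>t=1..int n. increment (threshold y \<tau>') (threshold y \<tau>) t \<omega>) / sqrt (real n)"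
    by (simp add: shift_dev_def increment_def sum_subtractf diff_divide_distrib)
  then have "\<bar>shift_dev y \<tau>' \<omega> - shift_dev y \<tau> \<omega>\<bar>
      = \<bar>\<Sum>t=1..int n. increment (threshold y \<tau>') (threshold y \<tau>) t \<omega>\<bar> / sqrt (real n)"
    by simp
  ultimately show ?thesis by linarith
qed

end

section \<open>Innovation distributions and cells\<close>

lemma smooth_cdf_of_twice_diff_bounded:
  assumes D: "is_real_distr D" and twice_diff: "twice_diff_bounded D"
  obtains f L B where "smooth_cdf D f L B"
proof -
  interpret real_distribution D using D by (simp add: is_real_distr_iff_real_distribution)
  obtain f f' B where cdf: "\<And>x. (cdf D has_real_derivative f x) (at x)"
    and f: "\<And>x. (f has_real_derivative f' x) (at x)" and B: "\<And>x. \<bar>f' x\<bar> \<le> B"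
    using twice_diff unfolding twice_diff_bounded_def by blast
  have B_nonneg: "0 \<le> B" using order_trans[OF abs_ge_zero B] .
  have f_lipschitz: "\<bar>f x - f y\<bar> \<le> B * \<bar>x - y\<bar>" for x y
    using field_differentiable_bound[of UNIV f f' B x y] f B by auto
  have taylor: "\<bar>cdf D (x + h) - cdf D x - f x * h\<bar> \<le> B * h\<^sup>2" for x h
  proof -
    have "norm ((cdf D (x + h) - f x * (x + h)) - (cdf D x - f x * x)) \<le> (B * \<bar>h\<bar>) * norm (x + h - x)"
    proof (rule field_differentiable_bound[where S="closed_segment x (x + h)" and f'="\<lambda>y. f y - f x"])
      fix y assume y: "y \<in> closed_segment x (x + h)"
      show "((\<lambda>y. cdf D y - f x * y) has_real_derivative f y - f x) (at y within closed_segment x (x + h))"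
        by (rule has_field_derivative_at_within) (auto intro!: derivative_eq_intros cdf)
      have "\<bar>y - x\<bar> \<le> \<bar>h\<bar>" using y by (auto simp: closed_segment_eq_real_ivl split: if_splits)
      then show "norm (f y - f x) \<le> B * \<bar>h\<bar>"
        using f_lipschitz[of y x] B_nonneg by (auto intro: order_trans mult_left_mono)
    qed auto
    then show ?thesis by (simp add: power2_eq_square algebra_simps)
  qed
  have f_bound: "\<bar>f x\<bar> \<le> 1 + B" for x
    using taylor[of x 1] abs_cdf_diff_le_1[of "x + 1" x] by simp
  have "\<bar>cdf D x - cdf D y\<bar> \<le> (1 + B) * \<bar>x - y\<bar>" for x y
    using field_differentiable_bound[of UNIV "cdf D" f "1 + B" x y] cdf f_bound by auto
  with B_nonneg taylor f_bound show thesis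
    by (intro that[of f "1 + B" B]) (simp add: smooth_cdf_def)
qed

context
  fixes P Q :: "real measure" and r :: real
  assumes P: "is_real_distr P" and Q: "is_real_distr Q" and r: "0 \<le> r" "r \<le> 1"
begin

interpretation P: real_distribution P using P by (simp add: is_real_distr_iff_real_distribution)
interpretation Q: real_distribution Q using Q by (simp add: is_real_distr_iff_real_distribution)

private definition component :: "bool \<Rightarrow> real measure" where
  "component b = (if b then Q else P)"

private lemma component_measurable: "component \<in> measurable (measure_pmf (bernoulli_pmf r)) (subprob_algebra borel)"
  using P.events_eq_borel Q.events_eq_borel
  by (simp add: component_def space_subprob_algebra P.subprob_space_axioms Q.subprob_space_axioms)

private lemma emeasure_bind_component:
  assumes "A \<in> sets borel"
  shows "emeasure (measure_pmf (bernoulli_pmf r) \<bind> component) A = ennreal ((1 - r) * measure P A + r * measure Q A)"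
proof -
  have "emeasure (measure_pmf (bernoulli_pmf r) \<bind> component) A
      = emeasure Q A * ennreal r + emeasure P A * ennreal (1 - r)"
    using assms r by (simp add: emeasure_bind[OF _ component_measurable] component_def)
  then show ?thesis
    using r by (simp add: P.emeasure_eq_measure Q.emeasure_eq_measure ennreal_mult'
        mult.commute add.commute)
qed

lemma mix_distr_eq_bind: "mix_distr r P Q = measure_pmf (bernoulli_pmf r) \<bind> (\<lambda>b. if b then Q else P)"
proof -
  let ?B = "measure_pmf (bernoulli_pmf r) \<bind> component"
  have sets: "sets ?B = sets borel"
    by (rule sets_bind[where N=borel]) (auto simp: component_def)
  have "mix_distr r P Q = measure_of (space ?B) (sets ?B) (emeasure ?B)"
    unfolding mix_distr_def sets sets_eq_imp_space_eq[OF sets] space_borel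
    by (rule measure_of_eq) (auto simp: emeasure_bind_component sets.sigma_sets_eq[of borel, simplified])
  then show ?thesis unfolding measure_of_of_measure component_def[abs_def] .
qed

lemma measure_mix_distr:
  assumes "A \<in> sets borel"
  shows "measure (mix_distr r P Q) A = (1 - r) * measure P A + r * measure Q A"
  unfolding mix_distr_eq_bind
  by (rule measure_eq_emeasure_eq_ennreal)
    (use emeasure_bind_component[OF assms] r in \<open>simp_all add: component_def[abs_def]\<close>)

lemma cdf_mix_distr: "cdf (mix_distr r P Q) y = (1 - r) * cdf P y + r * cdf Q y"
  unfolding cdf_def by (rule measure_mix_distr) simp

lemma nn_integral_mix_distr:
  assumes [measurable]: "f \<in> borel_measurable borel"
  shows "(\<integral>\<^sup>+x. f x \<partial>mix_distr r P Q) = (\<integral>\<^sup>+x. f x \<partial>Q) * ennreal r + (\<integral>\<^sup>+x. f x \<partial>P) * ennreal (1 - r)"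
  using r nn_integral_bind[OF assms component_measurable]
  by (simp add: mix_distr_eq_bind component_def[abs_def])

lemma mix_distr_second_moment_le:
  assumes "zero_mean_finite_var P" "zero_mean_finite_var Q" "zero_mean_finite_var (mix_distr r P Q)"
  shows "(\<integral>x. x\<^sup>2 \<partial>mix_distr r P Q) \<le> (\<integral>x. x\<^sup>2 \<partial>P) + (\<integral>x. x\<^sup>2 \<partial>Q)"
proof -
  have moment: "(\<integral>\<^sup>+x. ennreal (x\<^sup>2) \<partial>D) = ennreal (\<integral>x. x\<^sup>2 \<partial>D)" if "zero_mean_finite_var D" for D :: "real measure"
    using that by (intro nn_integral_eq_integral) (auto simp: zero_mean_finite_var_def)
  have "ennreal (\<integral>x. x\<^sup>2 \<partial>mix_distr r P Q) = ennreal (r * (\<integral>x. x\<^sup>2 \<partial>Q) + (1 - r) * (\<integral>x. x\<^sup>2 \<partial>P))"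
    using r nn_integral_mix_distr[of "\<lambda>x. ennreal (x\<^sup>2)"]
    by (simp add: moment assms ennreal_mult' mult.commute)
  then have "(\<integral>x. x\<^sup>2 \<partial>mix_distr r P Q) = r * (\<integral>x. x\<^sup>2 \<partial>Q) + (1 - r) * (\<integral>x. x\<^sup>2 \<partial>P)"
    using r by (subst (asm) ennreal_inj) auto
  also have "\<dots> \<le> 1 * (\<integral>x. x\<^sup>2 \<partial>Q) + 1 * (\<integral>x. x\<^sup>2 \<partial>P)"
    using r by (intro add_mono mult_right_mono) auto
  finally show ?thesis by simp
qed

lemma smooth_cdf_mix_distr:
  assumes P_smooth: "smooth_cdf P f L B" and Q_smooth: "smooth_cdf Q f' L' B'"
  shows "smooth_cdf (mix_distr r P Q) (\<lambda>y. (1 - r) * f y + r * f' y) (L + L') (B + B')"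
proof -
  have mix: "\<bar>(1 - r) * a + r * a'\<bar> \<le> c + c'" if "\<bar>a\<bar> \<le> c" "\<bar>a'\<bar> \<le> c'" for a a' c c'
  proof -
    have "\<bar>(1 - r) * a\<bar> \<le> 1 * c" "\<bar>r * a'\<bar> \<le> 1 * c'"
      unfolding abs_mult using that r by (intro mult_mono; simp)+
    then show ?thesis by linarith
  qed
  have "\<bar>(1 - r) * (cdf P x - cdf P y) + r * (cdf Q x - cdf Q y)\<bar> \<le> L * \<bar>x - y\<bar> + L' * \<bar>x - y\<bar>" for x y
    using P_smooth Q_smooth by (intro mix) (auto simp: smooth_cdf_def)
  moreover have "\<bar>(1 - r) * (cdf P (x + h) - cdf P x - f x * h) + r * (cdf Q (x + h) - cdf Q x - f' x * h)\<bar>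
      \<le> B * h\<^sup>2 + B' * h\<^sup>2" for x h
    using P_smooth Q_smooth by (intro mix) (auto simp: smooth_cdf_def)
  moreover have "\<bar>(1 - r) * f x + r * f' x\<bar> \<le> L + L'" for x
    using P_smooth Q_smooth by (intro mix) (auto simp: smooth_cdf_def)
  ultimately show ?thesis
    using P_smooth Q_smooth unfolding smooth_cdf_def cdf_mix_distr by (simp add: algebra_simps)
qed

end

lemma mix_distr_0:
  assumes "is_real_distr P"
  shows "mix_distr 0 P Q = P"
proof -
  interpret real_distribution P using assms by (simp add: is_real_distr_iff_real_distribution)
  show ?thesis
    using measure_of_of_measure[of P] by (simp add: mix_distr_def emeasure_eq_measure[abs_def])
qed

lemma rate_nonneg: "0 \<le> c \<Longrightarrow> 0 \<le> rate c n" and rate_le_1: "rate c n \<le> 1"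
  by (auto simp: rate_def)

lemma sqrt_mult_rate_tendsto:
  assumes N: "filterlim N at_top sequentially" and c: "c \<longlonglongrightarrow> c\<^sub>0"
  shows "(\<lambda>k. sqrt (real (N k)) * rate (c k) (N k)) \<longlonglongrightarrow> c\<^sub>0"
proof -
  have root: "filterlim (\<lambda>k. sqrt (real (N k))) at_top sequentially"
    by (intro filterlim_compose[OF sqrt_at_top] filterlim_compose[OF filterlim_real_sequentially N])
  have "\<forall>\<^sub>F k in sequentially. c k / sqrt (real (N k)) < 1"
    using order_tendstoD(2)[OF real_tendsto_divide_at_top[OF c root], of 1] by simp
  moreover have "\<forall>\<^sub>F k in sequentially. 0 < sqrt (real (N k))"
    using root unfolding filterlim_at_top_dense by blast
  ultimately have "\<forall>\<^sub>F k in sequentially. sqrt (real (N k)) * rate (c k) (N k) = c k"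
    by eventually_elim (simp add: rate_def)
  with c show ?thesis by (simp add: tendsto_cong)
qed

lemma symmetric_distr_cdf:
  assumes D: "is_real_distr D" and sym: "symmetric_distr D" and cont: "isCont (cdf D) (- y)"
  shows "cdf D (- y) = 1 - cdf D y"
proof -
  interpret real_distribution D using D by (simp add: is_real_distr_iff_real_distribution)
  have atom: "measure D {- y} = 0" using cont by (simp add: isCont_cdf)
  have "cdf D y = measure (distr D borel uminus) {..y}"
    using sym unfolding cdf_def symmetric_distr_def by simp
  also have "\<dots> = measure D ({- y} \<union> {- y<..})"
    by (subst measure_distr) (auto intro!: arg_cong[where f="measure D"])
  also have "\<dots> = measure D (space D - {..- y})"
    using atom by (subst finite_measure_Union) (auto intro!: arg_cong[where f="measure D"])
  also have "\<dots> = 1 - cdf D (- y)"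
    unfolding cdf_def by (rule prob_compl) auto
  finally show ?thesis by simp
qed

text \<open>Increments of \<open>F\<close> over the \<open>j\<close>-th cells; \<open>w\<close> stands for the limit of \<open>F\<close> at infinity, the limit
  at minus infinity is \<open>0\<close>.\<close>

definition plus_incr :: "(nat \<Rightarrow> real) \<Rightarrow> nat \<Rightarrow> real \<Rightarrow> (real \<Rightarrow> real) \<Rightarrow> nat \<Rightarrow> real" where
  "plus_incr x m w F j = (if j = m then w else F (x j)) - F (x (j - 1))"

definition minus_incr :: "(nat \<Rightarrow> real) \<Rightarrow> nat \<Rightarrow> (real \<Rightarrow> real) \<Rightarrow> nat \<Rightarrow> real" where
  "minus_incr x m F j = F (- x (j - 1)) - (if j = m then 0 else F (- x j))"

lemma plus_incr_sum: "plus_incr x m (\<Sum>t\<in>T. w t) (\<lambda>y. \<Sum>t\<in>T. F t y) j = (\<Sum>t\<in>T. plus_incr x m (w t) (F t) j)"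
  by (simp add: plus_incr_def sum_subtractf)

lemma minus_incr_sum: "minus_incr x m (\<lambda>y. \<Sum>t\<in>T. F t y) j = (\<Sum>t\<in>T. minus_incr x m (F t) j)"
  by (simp add: minus_incr_def sum_subtractf)

lemma delta_j_eq_incr:
  "delta_j p \<beta> P GE x m j = plus_incr x m 0 (Delta p \<beta> P GE) j - minus_incr x m (Delta p \<beta> P GE) j"
  by (auto simp: delta_j_def plus_incr_def minus_incr_def)

lemma oprob_plus_incr:
  assumes "\<And>y. oprob M (X y)"
  shows "oprob M (\<lambda>k \<omega>. plus_incr x m 0 (\<lambda>y. X y k \<omega>) j)"
  unfolding plus_incr_def using assms by (cases "j = m") (auto intro: oprob_diff oprob_uminus)

lemma oprob_minus_incr:
  assumes "\<And>y. oprob M (X y)"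
  shows "oprob M (\<lambda>k \<omega>. minus_incr x m (\<lambda>y. X y k \<omega>) j)"
  unfolding minus_incr_def using assms by (cases "j = m") (auto intro: oprob_diff)

locale bins =
  fixes x :: "nat \<Rightarrow> real" and m :: nat
  assumes m: "m \<ge> 1" and x0: "x 0 = 0" and xmono: "\<And>j. j + 1 < m \<Longrightarrow> x j < x (j + 1)"
begin

lemma x_mono: "i \<le> j \<Longrightarrow> j < m \<Longrightarrow> x i \<le> x j"
proof (induction rule: dec_induct)
  case (step k)
  then show ?case using xmono[of k] by simp
qed simp

lemma x_nonneg: "j < m \<Longrightarrow> 0 \<le> x j"
  using x_mono[of 0 j] x0 by simp

lemma bin_plus_pos:
  assumes "e \<in> bin_plus x m j" "j \<in> {1..m}"
  shows "0 < e"
proof -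
  have "0 \<le> x (j - 1)" using assms by (intro x_nonneg) auto
  with assms show ?thesis by (auto simp: bin_plus_def split: if_splits)
qed

lemma bin_minus_nonpos:
  assumes "e \<in> bin_minus x m j" "j \<in> {1..m}"
  shows "e \<le> 0"
proof -
  have "0 \<le> x (j - 1)" using assms by (intro x_nonneg) auto
  with assms show ?thesis by (auto simp: bin_minus_def split: if_splits)
qed

lemma indicator_bin_plus:
  assumes "j \<in> {1..m}"
  shows "indicator (bin_plus x m j) e = plus_incr x m 1 (below e) j"
proof -
  have "j \<noteq> m \<Longrightarrow> x (j - 1) \<le> x j" using assms by (intro x_mono) auto
  then show ?thesis by (cases "j = m") (auto simp: bin_plus_def plus_incr_def below_def indicator_def)
qed

lemma indicator_bin_minus:
  assumes "j \<in> {1..m}"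
  shows "indicator (bin_minus x m j) e = minus_incr x m (below e) j"
proof -
  have "j \<noteq> m \<Longrightarrow> x (j - 1) \<le> x j" using assms by (intro x_mono) auto
  then show ?thesis by (cases "j = m") (auto simp: bin_minus_def minus_incr_def below_def indicator_def)
qed

lemma bins_borel[measurable]: "bin_plus x m j \<in> sets borel" "bin_minus x m j \<in> sets borel"
  by (auto simp: bin_plus_def bin_minus_def)

lemma measure_bins:
  assumes "real_distribution D" and j: "j \<in> {1..m}"
  shows "measure D (bin_plus x m j) = plus_incr x m 1 (cdf D) j"
    "measure D (bin_minus x m j) = minus_incr x m (cdf D) j"
proof -
  interpret real_distribution D by fact
  have integrable: "integrable D (\<lambda>e. below e y)" for y by (rule bounded_integrable[of _ 1]) auto
  have "measure D (bin_plus x m j) = (\<integral>e. plus_incr x m 1 (below e) j \<partial>D)"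
    by (simp flip: indicator_bin_plus[OF j])
  then show "measure D (bin_plus x m j) = plus_incr x m 1 (cdf D) j"
    using integrable prob_space by (simp add: plus_incr_def expectation_below)
  have "measure D (bin_minus x m j) = (\<integral>e. minus_incr x m (below e) j \<partial>D)"
    by (simp flip: indicator_bin_minus[OF j])
  then show "measure D (bin_minus x m j) = minus_incr x m (cdf D) j"
    using integrable by (simp add: minus_incr_def expectation_below)
qed

lemma symmetric_distr_measure_bins:
  assumes D: "is_real_distr D" "symmetric_distr D" "\<And>y. isCont (cdf D) y" and j: "j \<in> {1..m}"
  shows "measure D (bin_minus x m j) = measure D (bin_plus x m j)"
  using D(1) by (simp add: measure_bins[OF _ j] is_real_distr_iff_real_distribution plus_incr_def minus_incr_def
      symmetric_distr_cdf[OF D])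

lemma card_bins:
  fixes R :: "'t \<Rightarrow> real"
  assumes T: "finite T" and j: "j \<in> {1..m}"
  shows "real (card {t\<in>T. R t \<in> bin_plus x m j}) = plus_incr x m (real (card T)) (\<lambda>y. \<Sum>t\<in>T. below (R t) y) j"
    "real (card {t\<in>T. R t \<in> bin_minus x m j}) = minus_incr x m (\<lambda>y. \<Sum>t\<in>T. below (R t) y) j"
proof -
  have card: "real (card {t\<in>T. R t \<in> S}) = (\<Sum>t\<in>T. indicator S (R t))" for S
    using T by (simp add: indicator_def sum.If_cases Int_def)
  have "plus_incr x m (real (card T)) (\<lambda>y. \<Sum>t\<in>T. below (R t) y) j = (\<Sum>t\<in>T. plus_incr x m 1 (below (R t)) j)"
    using plus_incr_sum[of x m "\<lambda>_. 1" T] by simp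
  then show "real (card {t\<in>T. R t \<in> bin_plus x m j}) = plus_incr x m (real (card T)) (\<lambda>y. \<Sum>t\<in>T. below (R t) y) j"
    by (simp add: card indicator_bin_plus[OF j])
  show "real (card {t\<in>T. R t \<in> bin_minus x m j}) = minus_incr x m (\<lambda>y. \<Sum>t\<in>T. below (R t) y) j"
    by (simp add: card indicator_bin_minus[OF j] minus_incr_sum)
qed

definition bin_sign :: "nat \<Rightarrow> real \<Rightarrow> real" where
  "bin_sign j e = indicator (bin_plus x m j) e - indicator (bin_minus x m j) e"

lemma bin_sign_measurable[measurable]: "bin_sign j \<in> borel_measurable borel"
  unfolding bin_sign_def[abs_def] by measurable

lemma abs_bin_sign_le_1: "\<bar>bin_sign j e\<bar> \<le> 1"
  by (auto simp: bin_sign_def indicator_def)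

lemma bin_sign_eq_incr:
  assumes "j \<in> {1..m}"
  shows "bin_sign j e = plus_incr x m 1 (below e) j - minus_incr x m (below e) j"
  by (simp add: bin_sign_def indicator_bin_plus[OF assms] indicator_bin_minus[OF assms])

lemma bin_sign_mult_eq_0:
  assumes i: "i \<in> {1..m}" and j: "j \<in> {1..m}" and "i \<noteq> j"
  shows "bin_sign i e * bin_sign j e = 0"
proof -
  have x_le: "x a \<le> x (b - 1)" if "a < b" "b \<in> {1..m}" for a b
    using that by (intro x_mono) auto
  have plus: "\<not> (e \<in> bin_plus x m a \<and> e \<in> bin_plus x m b)" and minus: "\<not> (e \<in> bin_minus x m a \<and> e \<in> bin_minus x m b)"
    if "a < b" "a \<in> {1..m}" "b \<in> {1..m}" for a b
    using x_le[OF that(1,3)] that by (auto simp: bin_plus_def bin_minus_def split: if_splits)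
  show ?thesis
    using bin_plus_pos[OF _ i] bin_plus_pos[OF _ j] bin_minus_nonpos[OF _ i] bin_minus_nonpos[OF _ j]
      plus[of i j] plus[of j i] minus[of i j] minus[of j i] assms
    unfolding bin_sign_def by (cases "i < j"; force simp: indicator_def)
qed

lemma bin_sign_square:
  assumes j: "j \<in> {1..m}"
  shows "(bin_sign j e)\<^sup>2 = indicator (bin_plus x m j) e + indicator (bin_minus x m j) e"
  using bin_plus_pos[OF _ j, of e] bin_minus_nonpos[OF _ j, of e] by (auto simp: bin_sign_def indicator_def)

lemma bin_sign_combination_square:
  "(\<Sum>j=1..m. \<theta> j * bin_sign j e)\<^sup>2
    = (\<Sum>j=1..m. (\<theta> j)\<^sup>2 * (indicator (bin_plus x m j) e + indicator (bin_minus x m j) e))"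
proof -
  have "(\<Sum>j=1..m. \<theta> j * bin_sign j e)\<^sup>2 = (\<Sum>i=1..m. \<Sum>j=1..m. \<theta> i * \<theta> j * (bin_sign i e * bin_sign j e))"
    unfolding power2_eq_square sum_product by (intro sum.cong refl) (simp only: mult_ac)
  also have "\<dots> = (\<Sum>i=1..m. \<Sum>j=1..m. if j = i then (\<theta> i * bin_sign i e)\<^sup>2 else 0)"
    by (intro sum.cong refl) (simp add: bin_sign_mult_eq_0 power2_eq_square mult_ac)
  also have "\<dots> = (\<Sum>i=1..m. (\<theta> i * bin_sign i e)\<^sup>2)"
    by simp
  finally show ?thesis by (simp only: power_mult_distrib) (simp add: bin_sign_square)
qed

end

section \<open>Limits along a sequence of models\<close>

definition noncentrality :: "nat \<Rightarrow> nat \<Rightarrow> (nat \<Rightarrow> real) \<Rightarrow> (nat \<Rightarrow> real) \<Rightarrow> real measure \<Rightarrow> real measure \<Rightarrow> real measure \<Rightarrow>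
    real \<Rightarrow> real \<Rightarrow> real" where
  "noncentrality p m \<beta> x P Q GE \<gamma> \<rho> = (\<Sum>j=1..m. (\<rho> * (measure Q (bin_plus x m j) - measure Q (bin_minus x m j))
     + \<gamma> * delta_j p \<beta> P GE x m j)\<^sup>2 / (2 * measure P (bin_plus x m j)))"

locale AR_seq = bins x m
  for x :: "nat \<Rightarrow> real" and m :: nat +
  fixes p :: nat and \<beta> :: "nat \<Rightarrow> real" and P Q GE :: "real measure"
    and N :: "nat \<Rightarrow> nat" and \<gamma> \<rho> :: "nat \<Rightarrow> real" and \<gamma>\<^sub>0 \<rho>\<^sub>0 :: real
    and M :: "nat \<Rightarrow> 'a measure" and eps z xi u :: "nat \<Rightarrow> int \<Rightarrow> 'a \<Rightarrow> real"
    and bh :: "nat \<Rightarrow> 'a \<Rightarrow> nat \<Rightarrow> real"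
  assumes causal: "causal_coeffs p \<beta>"
    and P: "is_real_distr P" and Q: "is_real_distr Q" and GE: "is_real_distr GE"
    and P_symmetric: "symmetric_distr P"
    and moments: "zero_mean_finite_var P" "zero_mean_finite_var Q"
    and twice_diff: "twice_diff_bounded P" "twice_diff_bounded Q"
    and cell_prob_pos: "\<And>j. j \<in> {1..m} \<Longrightarrow> 0 < measure P (bin_plus x m j)"
    and N: "filterlim N at_top sequentially" and N_ge_1: "\<And>k. N k \<ge> 1"
    and \<gamma>: "\<gamma> \<longlonglongrightarrow> \<gamma>\<^sub>0" "\<And>k. 0 \<le> \<gamma> k" and \<rho>: "\<rho> \<longlonglongrightarrow> \<rho>\<^sub>0" "\<And>k. 0 \<le> \<rho> k"
    and model: "\<And>k. AR_contam_model p \<beta> (mix_distr (rate (\<rho> k) (N k)) P Q) GE (rate (\<gamma> k) (N k))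
        (M k) (eps k) (z k) (xi k) (u k)"
    and bh_measurable: "\<And>k i. (\<lambda>\<omega>. bh k \<omega> i) \<in> borel_measurable (M k)"
    and tight: "Oprob M (\<lambda>k \<omega>. sqrt (real (N k)) * sqrt (\<Sum>i=1..p. (bh k \<omega> i - \<beta> i)\<^sup>2))"
begin

abbreviation "innov k \<equiv> mix_distr (rate (\<rho> k) (N k)) P Q"
abbreviation "contam_rate k \<equiv> rate (\<gamma> k) (N k)"
abbreviation "mix_rate k \<equiv> rate (\<rho> k) (N k)"
abbreviation "root_N k \<equiv> sqrt (real (N k))"
abbreviation "observed k \<omega> \<equiv> \<lambda>t. yobs (u k) (z k) (xi k) t \<omega>"

definition resid :: "nat \<Rightarrow> int \<Rightarrow> 'a \<Rightarrow> real" where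
  "resid k t \<omega> = residual p (bh k \<omega>) (observed k \<omega>) t"

definition count_shift :: "real \<Rightarrow> nat \<Rightarrow> 'a \<Rightarrow> real" where
  "count_shift y k \<omega> = (\<Sum>t=1..int (N k). below (resid k t \<omega>) y - below (eps k t \<omega>) y) / root_N k
     - \<gamma>\<^sub>0 * Delta p \<beta> P GE y"

definition lag_coeff :: "nat \<Rightarrow> real" where
  "lag_coeff j = (if j = 0 then -1 else \<beta> j)"

lemma prob_space_M: "prob_space (M k)"
  using model[of k] by (simp add: AR_contam_model_def)

lemma contam_noise_M: "contam_noise (M k) (innov k) GE (contam_rate k) (eps k) (z k) (xi k)"
  by (rule AR_contam_model_imp_contam_noise[OF model])

lemma eps_measurable[measurable]: "eps k t \<in> borel_measurable (M k)"
  using contam_noise.eps_measurable[OF contam_noise_M] .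

lemma real_distributions:
  "real_distribution P" "real_distribution Q" "real_distribution GE" "real_distribution (innov k)"
  using P Q GE model[of k] by (simp_all add: AR_contam_model_def is_real_distr_iff_real_distribution)

lemma root_N_pos: "0 < root_N k"
  using N_ge_1[of k] by simp

lemma divide_root_N_tendsto_0: "(\<lambda>k. a / root_N k) \<longlonglongrightarrow> 0"
  by (intro real_tendsto_divide_at_top[OF tendsto_const] filterlim_compose[OF sqrt_at_top]
      filterlim_compose[OF filterlim_real_sequentially N])

lemma tendsto_0_of_root_N_mult:
  assumes "(\<lambda>k. root_N k * a k) \<longlonglongrightarrow> l"
  shows "a \<longlonglongrightarrow> 0"
proof -
  have "(\<lambda>k. root_N k * a k * (1 / root_N k)) \<longlonglongrightarrow> l * 0"
    by (intro tendsto_mult assms divide_root_N_tendsto_0)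
  then show ?thesis using root_N_pos by (simp add: less_imp_neq[symmetric])
qed

lemmas contam_rate_scaled = sqrt_mult_rate_tendsto[OF N \<gamma>(1)]
lemmas mix_rate_scaled = sqrt_mult_rate_tendsto[OF N \<rho>(1)]
lemmas contam_rate_tendsto_0 = tendsto_0_of_root_N_mult[OF contam_rate_scaled]
lemmas mix_rate_tendsto_0 = tendsto_0_of_root_N_mult[OF mix_rate_scaled]
lemmas mix_rate_bounds = rate_nonneg[OF \<rho>(2)] rate_le_1

lemma cdf_innov_tendsto: "(\<lambda>k. cdf (innov k) y) \<longlonglongrightarrow> cdf P y"
proof -
  have "(\<lambda>k. (1 - mix_rate k) * cdf P y + mix_rate k * cdf Q y) \<longlonglongrightarrow> (1 - 0) * cdf P y + 0 * cdf Q y"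
    by (intro tendsto_intros mix_rate_tendsto_0)
  then show ?thesis by (simp add: cdf_mix_distr[OF P Q mix_rate_bounds])
qed

lemma truncated_mean_tendsto_0:
  assumes "0 \<le> a"
  shows "(\<lambda>k. truncated_mean GE (a / root_N k)) \<longlonglongrightarrow> 0"
proof -
  interpret GE: real_distribution GE by (rule real_distributions)
  have "(\<lambda>k. \<integral>x. min 1 \<bar>a / root_N k * x\<bar> \<partial>GE) \<longlonglongrightarrow> 0"
    by (rule GE.expectation_min_one_tendsto_0[OF _ divide_root_N_tendsto_0]) simp
  then show ?thesis using assms by (simp add: truncated_mean_def abs_mult)
qed

lemma outlier_shift_tendsto_Delta:
  "(\<lambda>k. \<Sum>j=0..p. \<integral>w. cdf (innov k) (y + lag_coeff j * w) - cdf (innov k) y \<partial>GE) \<longlonglongrightarrow> Delta p \<beta> P GE y"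
proof -
  interpret GE: real_distribution GE by (rule real_distributions)
  interpret P: real_distribution P by (rule real_distributions)
  interpret innov: real_distribution "innov k" for k by (rule real_distributions)
  have "(\<lambda>k. \<integral>w. cdf (innov k) (y + lag_coeff j * w) - cdf (innov k) y \<partial>GE)
      \<longlonglongrightarrow> (\<integral>w. cdf P (y + lag_coeff j * w) - cdf P y \<partial>GE)" for j
  proof (rule integral_dominated_convergence[where w="\<lambda>_. 1"])
    show "AE w in GE. (\<lambda>k. cdf (innov k) (y + lag_coeff j * w) - cdf (innov k) y)
        \<longlonglongrightarrow> cdf P (y + lag_coeff j * w) - cdf P y"
      by (intro AE_I2 tendsto_intros cdf_innov_tendsto)
  qed (auto simp: innov.abs_cdf_diff_le_1)
  then have "(\<lambda>k. \<Sum>j=0..p. \<integral>w. cdf (innov k) (y + lag_coeff j * w) - cdf (innov k) y \<partial>GE)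
      \<longlonglongrightarrow> (\<Sum>j=0..p. \<integral>w. cdf P (y + lag_coeff j * w) - cdf P y \<partial>GE)"
    by (rule tendsto_sum)
  moreover have "(\<integral>w. cdf P (y + lag_coeff j * w) - cdf P y \<partial>GE)
      = (\<integral>w. cdf P (y + lag_coeff j * w) \<partial>GE) - cdf P y" for j
  proof -
    have "integrable GE (\<lambda>w. cdf P (y + lag_coeff j * w))"
      using P.cdf_nonneg P.cdf_bounded_prob by (intro GE.bounded_integrable[of _ 1]) auto
    then show ?thesis using GE.prob_space by simp
  qed
  ultimately show ?thesis unfolding Delta_def lag_coeff_def by simp
qed

lemma ex_arrays:
  "\<exists>v K L B f. (\<forall>k. contam_array (M k) (innov k) GE (contam_rate k) (eps k) (z k) (xi k) (v k) (N k) K L B (f k)) \<and>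
    (\<forall>k. AE \<omega> in M k. \<forall>t. u k t \<omega> = v k t \<omega>)"
proof -
  obtain fP LP BP fQ LQ BQ where smooth: "smooth_cdf P fP LP BP" "smooth_cdf Q fQ LQ BQ"
    using smooth_cdf_of_twice_diff_bounded[OF P twice_diff(1)]
      smooth_cdf_of_twice_diff_bounded[OF Q twice_diff(2)] by metis
  define S where "S = (\<integral>x. x\<^sup>2 \<partial>P) + (\<integral>x. x\<^sup>2 \<partial>Q)"
  obtain K where K: "\<And>(M :: 'a measure) G GE g eps z xi u. AR_contam_model p \<beta> G GE g M eps z xi u \<Longrightarrow>
      (\<integral>x. x\<^sup>2 \<partial>G) \<le> S \<Longrightarrow> \<exists>v. causal_version K M eps z xi v \<and> (AE \<omega> in M. \<forall>t. u t \<omega> = v t \<omega>)"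
    using AR_causal_representation[OF causal, of S] by blast
  have "(\<integral>x. x\<^sup>2 \<partial>innov k) \<le> S" for k
    unfolding S_def using model[of k]
    by (intro mix_distr_second_moment_le P Q mix_rate_bounds moments) (simp add: AR_contam_model_def)
  from K[OF model this]
  have "\<forall>k. \<exists>v. causal_version K (M k) (eps k) (z k) (xi k) v \<and> (AE \<omega> in M k. \<forall>t. u k t \<omega> = v t \<omega>)"
    by blast
  from choice[OF this] obtain v where v: "\<And>k. causal_version K (M k) (eps k) (z k) (xi k) (v k)"
    "\<And>k. AE \<omega> in M k. \<forall>t. u k t \<omega> = v k t \<omega>" by blast
  have "contam_array (M k) (innov k) GE (contam_rate k) (eps k) (z k) (xi k) (v k) (N k) K (LP + LQ) (BP + BQ)
      (\<lambda>y. (1 - mix_rate k) * fP y + mix_rate k * fQ y)" for k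
    by (rule contam_array.intro[OF contam_noise_M contam_array_axioms.intro[OF v(1) N_ge_1
          smooth_cdf_mix_distr[OF P Q mix_rate_bounds smooth]]])
  with v(2) show ?thesis
    by (intro exI[of _ v] exI[of _ K] exI[of _ "LP + LQ"] exI[of _ "BP + BQ"]
        exI[of _ "\<lambda>k y. (1 - mix_rate k) * fP y + mix_rate k * fQ y"]) simp
qed

end

locale AR_seq_arrays = AR_seq x m p \<beta> P Q GE N \<gamma> \<rho> \<gamma>\<^sub>0 \<rho>\<^sub>0 M eps z xi u bh
  for x :: "nat \<Rightarrow> real" and m p :: nat and \<beta> :: "nat \<Rightarrow> real" and P Q GE :: "real measure"
    and N :: "nat \<Rightarrow> nat" and \<gamma> \<rho> :: "nat \<Rightarrow> real" and \<gamma>\<^sub>0 \<rho>\<^sub>0 :: real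
    and M :: "nat \<Rightarrow> 'a measure" and eps z xi u :: "nat \<Rightarrow> int \<Rightarrow> 'a \<Rightarrow> real"
    and bh :: "nat \<Rightarrow> 'a \<Rightarrow> nat \<Rightarrow> real" +
  fixes v :: "nat \<Rightarrow> int \<Rightarrow> 'a \<Rightarrow> real" and K L B :: real and f :: "nat \<Rightarrow> real \<Rightarrow> real"
  assumes array: "\<And>k. contam_array (M k) (innov k) GE (contam_rate k) (eps k) (z k) (xi k) (v k) (N k) K L B (f k)"
    and version: "\<And>k. AE \<omega> in M k. \<forall>t. u k t \<omega> = v k t \<omega>"
begin

sublocale A: contam_array "M k" "innov k" GE "contam_rate k" "eps k" "z k" "xi k" "v k" p lag_coeff "N k" K L B "f k"
    for k
  by (rule array)

definition est_err :: "nat \<Rightarrow> 'a \<Rightarrow> nat \<Rightarrow> real" where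
  "est_err k \<omega> i = root_N k * (bh k \<omega> i - \<beta> i)"

lemma Oprob_est_err: "Oprob M (\<lambda>k \<omega>. \<Sum>i=1..p. \<bar>est_err k \<omega> i\<bar>)"
proof (rule Oprob_mono[OF Oprob_mult[OF Oprob_const[of M "real p"] tight]])
  fix k \<omega>
  have "(\<Sum>i=1..p. \<bar>est_err k \<omega> i\<bar>) \<le> (\<Sum>i=1..p. root_N k * sqrt (\<Sum>i=1..p. (bh k \<omega> i - \<beta> i)\<^sup>2))"
  proof (rule sum_mono)
    fix i assume i: "i \<in> {1..p}"
    have "\<bar>bh k \<omega> i - \<beta> i\<bar> = sqrt ((bh k \<omega> i - \<beta> i)\<^sup>2)" by simp
    also have "\<dots> \<le> sqrt (\<Sum>i=1..p. (bh k \<omega> i - \<beta> i)\<^sup>2)"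
      using i by (intro real_sqrt_le_mono member_le_sum) auto
    finally show "\<bar>est_err k \<omega> i\<bar> \<le> root_N k * sqrt (\<Sum>i=1..p. (bh k \<omega> i - \<beta> i)\<^sup>2)"
      by (simp add: est_err_def abs_mult mult_left_mono)
  qed
  then show "\<bar>\<Sum>i=1..p. \<bar>est_err k \<omega> i\<bar>\<bar> \<le> \<bar>real p * (root_N k * sqrt (\<Sum>i=1..p. (bh k \<omega> i - \<beta> i)\<^sup>2))\<bar>"
    by (simp add: sum_nonneg abs_mult)
qed

lemma below_resid_eq_below_threshold:
  "AE \<omega> in M k. \<forall>t. below (resid k t \<omega>) y = below (eps k t \<omega>) (A.threshold k y (est_err k \<omega>) t \<omega>)"
  using version[of k] AE_space
proof eventually_elim
  case (elim \<omega>)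
  show ?case
  proof
    fix t
    have recursion: "u k t \<omega> = (\<Sum>i=1..p. \<beta> i * u k (t - int i) \<omega>) + eps k t \<omega>"
      using model[of k] elim(2) unfolding AR_contam_model_def by blast
    have lin_err: "A.lin_err k (est_err k \<omega>) t \<omega> = (\<Sum>i=1..p. (bh k \<omega> i - \<beta> i) * observed k \<omega> (t - int i))"
      unfolding A.lin_err_def sum_divide_distrib using root_N_pos[of k] elim(1)
      by (intro sum.cong refl) (simp add: est_err_def yobs_def A.outlier_def)
    have contam: "A.contam k t \<omega> = - A.outlier k t \<omega> + (\<Sum>i=1..p. \<beta> i * A.outlier k (t - int i) \<omega>)"
      unfolding A.contam_def by (simp add: sum.atLeast_Suc_atMost lag_coeff_def)
    have "(\<Sum>i=1..p. bh k \<omega> i * observed k \<omega> (t - int i)) = (\<Sum>i=1..p. (bh k \<omega> i - \<beta> i) * observed k \<omega> (t - int i))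
        + (\<Sum>i=1..p. \<beta> i * u k (t - int i) \<omega>) + (\<Sum>i=1..p. \<beta> i * A.outlier k (t - int i) \<omega>)"
      unfolding sum.distrib[symmetric] by (intro sum.cong refl) (simp add: yobs_def A.outlier_def algebra_simps)
    then have "resid k t \<omega> = eps k t \<omega> - A.contam k t \<omega> - A.lin_err k (est_err k \<omega>) t \<omega>"
      unfolding resid_def residual_def lin_err contam using recursion by (simp add: yobs_def A.outlier_def)
    then show "below (resid k t \<omega>) y = below (eps k t \<omega>) (A.threshold k y (est_err k \<omega>) t \<omega>)"
      by (simp add: below_def A.threshold_def)
  qed
qed

lemma lag_bound_scaled:
  assumes D_nonneg: "0 \<le> D"
  shows "(\<lambda>k. root_N k * A.lag_bound k D) \<longlonglongrightarrow> L * D * (real p * sqrt K)"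
proof -
  have "root_N k * A.lag_bound k D
      = L * D * (real p * sqrt K)
        + real p * ((root_N k * contam_rate k) * truncated_mean GE (L * D / root_N k))" for k
    unfolding A.lag_bound_def using root_N_pos[of k] by (simp add: distrib_left)
  moreover have "(\<lambda>k. L * D * (real p * sqrt K)
        + real p * ((root_N k * contam_rate k) * truncated_mean GE (L * D / root_N k)))
      \<longlonglongrightarrow> L * D * (real p * sqrt K) + real p * (\<gamma>\<^sub>0 * 0)"
    using D_nonneg A.L_nonneg by (intro tendsto_intros contam_rate_scaled truncated_mean_tendsto_0) auto
  ultimately show ?thesis by simp
qed

lemma shift_bound_tendsto_0:
  assumes C_nonneg: "0 \<le> C"
  shows "(\<lambda>k. A.shift_bound k C) \<longlonglongrightarrow> 0"
proof -
  have LC_nonneg: "0 \<le> L * C" using C_nonneg A.L_nonneg by simp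
  have "(\<lambda>k. sqrt (A.lag_bound k C + (real p + 1) * contam_rate k)
      + (root_N k * contam_rate k) * (2 * L * C / root_N k * ((real p + 1) * real p * sqrt K)
          + real p * truncated_mean GE (L * C / root_N k))
      + (L * C * K + B * C\<^sup>2 * real p * K) / root_N k
      + (root_N k * contam_rate k) * ((real p + 2) * (real p + 1) * real p * contam_rate k)
      + (real p + 1) * sqrt (contam_rate k))
    \<longlonglongrightarrow> sqrt (0 + (real p + 1) * 0) + \<gamma>\<^sub>0 * (0 * ((real p + 1) * real p * sqrt K) + real p * 0) + 0
      + \<gamma>\<^sub>0 * ((real p + 2) * (real p + 1) * real p * 0) + (real p + 1) * sqrt 0"
    by (intro tendsto_add tendsto_mult tendsto_real_sqrt tendsto_const contam_rate_scaled contam_rate_tendsto_0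
        divide_root_N_tendsto_0 truncated_mean_tendsto_0[OF LC_nonneg]
        tendsto_0_of_root_N_mult[OF lag_bound_scaled[OF C_nonneg]])
  then show ?thesis by (simp add: A.shift_bound_def mult.assoc)
qed

lemma oprob_shift_dev_est_err: "oprob M (\<lambda>k \<omega>. A.shift_dev k y (est_err k \<omega>) \<omega>)"
proof (rule oprob_random_parameter[OF _ Oprob_est_err])
  show "oprob M (\<lambda>k. A.shift_dev k y \<tau>)" for \<tau>
    by (rule oprob_of_L1_bound[OF A.L1_bound_shift_dev shift_bound_tendsto_0[OF A.tau_size_nonneg]])
  fix c e :: real assume c_pos: "c > 0" and e_pos: "e > 0"
  define a where "a = 2 * L * (real p * sqrt K)"
  define \<eta> where "\<eta> = c * e / (a + 1)"
  have a_nonneg: "0 \<le> a" using A.L_nonneg A.K_nonneg by (simp add: a_def)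
  have \<eta>_pos: "0 < \<eta>" using c_pos e_pos a_nonneg by (simp add: \<eta>_def)
  have "L * (2 * \<eta>) * (real p * sqrt K) = (a + 1) * \<eta> - \<eta>" by (simp add: a_def algebra_simps)
  also have "\<dots> = c * e - \<eta>" using a_nonneg by (simp add: \<eta>_def)
  finally have "L * (2 * \<eta>) * (real p * sqrt K) < c * e" using \<eta>_pos by simp
  with lag_bound_scaled[of "2 * \<eta>"] \<eta>_pos have "\<forall>\<^sub>F k in sequentially. root_N k * A.lag_bound k (2 * \<eta>) < c * e"
    by (auto intro: order_tendstoD(2))
  then have drift: "mostly_le M (\<lambda>k. A.bracket_drift k \<eta>) c e"
    using \<eta>_pos c_pos by (intro mostly_le_of_L1_bound[OF A.L1_bound_bracket_drift]) auto
  have "(\<lambda>k. sqrt (A.lag_bound k (2 * \<eta>))) \<longlonglongrightarrow> sqrt 0"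
    using \<eta>_pos by (intro tendsto_real_sqrt tendsto_0_of_root_N_mult[OF lag_bound_scaled]) simp
  then have mart: "oprob M (\<lambda>k. A.bracket_mart k y \<tau> \<eta>)" for \<tau>
    using \<eta>_pos by (intro oprob_of_L1_bound[OF A.L1_bound_bracket_mart]) auto
  show "\<exists>\<eta>>0. \<exists>Y Z. (\<forall>\<tau>. oprob M (\<lambda>k. Y k \<tau>)) \<and> mostly_le M Z c e \<and>
      (\<forall>k \<tau> \<tau>' \<omega>. (\<forall>i\<in>{1..p}. \<bar>\<tau>' i - \<tau> i\<bar> \<le> \<eta>) \<longrightarrow>
        \<bar>A.shift_dev k y \<tau>' \<omega>\<bar> \<le> \<bar>A.shift_dev k y \<tau> \<omega>\<bar> + \<bar>Y k \<tau> \<omega>\<bar> + Z k \<omega>)"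
  proof (intro exI[of _ \<eta>] exI[of _ "\<lambda>k \<tau>. A.bracket_mart k y \<tau> \<eta>"] exI[of _ "\<lambda>k. A.bracket_drift k \<eta>"]
      conjI allI impI)
    fix k \<tau> \<tau>' \<omega> assume "\<forall>i\<in>{1..p}. \<bar>\<tau>' i - \<tau> i\<bar> \<le> \<eta>"
    then show "\<bar>A.shift_dev k y \<tau>' \<omega>\<bar>
        \<le> \<bar>A.shift_dev k y \<tau> \<omega>\<bar> + \<bar>A.bracket_mart k y \<tau> \<eta> \<omega>\<bar> + A.bracket_drift k \<eta> \<omega>"
      using \<eta>_pos by (intro A.abs_shift_dev_le_bracket) auto
  qed (use \<eta>_pos drift mart in auto)
qed simp

lemma oprob_count_shift_arrays: "oprob M (count_shift y)"
proof (rule oprob_AE_cong)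
  let ?bias = "\<lambda>k. root_N k * contam_rate k * (\<Sum>j=0..p. A.mean_outlier_shift k y j) - \<gamma>\<^sub>0 * Delta p \<beta> P GE y"
  have "?bias \<longlonglongrightarrow> \<gamma>\<^sub>0 * Delta p \<beta> P GE y - \<gamma>\<^sub>0 * Delta p \<beta> P GE y"
    unfolding A.mean_outlier_shift_def A.outlier_shift_def
    by (intro tendsto_diff tendsto_mult contam_rate_scaled outlier_shift_tendsto_Delta tendsto_const)
  then show "oprob M (\<lambda>k \<omega>. A.shift_dev k y (est_err k \<omega>) \<omega> + ?bias k)"
    by (intro oprob_add oprob_shift_dev_est_err oprob_tendsto_0) simp
  show "AE \<omega> in M k. A.shift_dev k y (est_err k \<omega>) \<omega> + ?bias k = count_shift y k \<omega>" for k
    using below_resid_eq_below_threshold[of k y]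
    by eventually_elim (simp add: count_shift_def A.shift_dev_def A.increment_def)
qed

end

context AR_seq
begin

lemma oprob_count_shift: "oprob M (count_shift y)"
proof -
  obtain v K L B f where array:
    "\<And>k. contam_array (M k) (innov k) GE (contam_rate k) (eps k) (z k) (xi k) (v k) (N k) K L B (f k)"
    "\<And>k. AE \<omega> in M k. \<forall>t. u k t \<omega> = v k t \<omega>"
    using ex_arrays by blast
  interpret AR_seq_arrays x m p \<beta> P Q GE N \<gamma> \<rho> \<gamma>\<^sub>0 \<rho>\<^sub>0 M eps z xi u bh v K L B f
    by (intro AR_seq_arrays.intro AR_seq_arrays_axioms.intro AR_seq_axioms array)
  show ?thesis by (rule oprob_count_shift_arrays)
qed

end

section \<open>The limit law of the statistic\<close>

context AR_seq
begin

abbreviation "cell_prob j \<equiv> measure P (bin_plus x m j)"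
abbreviation "asymmetry j \<equiv> measure Q (bin_plus x m j) - measure Q (bin_minus x m j)"
abbreviation "\<delta> j \<equiv> delta_j p \<beta> P GE x m j"

definition sign_sum :: "nat \<Rightarrow> nat \<Rightarrow> 'a \<Rightarrow> real" where
  "sign_sum k j \<omega> = (\<Sum>t=1..int (N k). bin_sign j (eps k t \<omega>)) / root_N k"

lemma sign_sum_measurable[measurable]: "sign_sum k j \<in> borel_measurable (M k)"
  unfolding sign_sum_def[abs_def] by measurable

lemma P_bin_minus:
  assumes "j \<in> {1..m}"
  shows "measure P (bin_minus x m j) = cell_prob j"
proof -
  have "isCont (cdf P) y" for y
    using twice_diff(1) unfolding twice_diff_bounded_def by (meson DERIV_isCont)
  then show ?thesis by (rule symmetric_distr_measure_bins[OF P P_symmetric _ assms])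
qed

lemma measure_innov:
  "A \<in> sets borel \<Longrightarrow> measure (innov k) A = (1 - mix_rate k) * measure P A + mix_rate k * measure Q A"
  by (rule measure_mix_distr[OF P Q mix_rate_bounds])

lemma expectation_bin_sign:
  assumes j: "j \<in> {1..m}"
  shows "(\<integral>e. bin_sign j e \<partial>innov k) = mix_rate k * asymmetry j"
proof -
  interpret real_distribution "innov k" by (rule real_distributions)
  have integrable: "integrable (innov k) (\<lambda>e. indicator A e :: real)" if "A \<in> sets borel" for A
    using that by (intro bounded_integrable[of _ 1]) auto
  have "(\<integral>e. bin_sign j e \<partial>innov k) = measure (innov k) (bin_plus x m j) - measure (innov k) (bin_minus x m j)"
    unfolding bin_sign_def using integrable[OF bins_borel(1)] integrable[OF bins_borel(2)] by simp
  also have "\<dots> = mix_rate k * asymmetry j"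
    unfolding measure_innov[OF bins_borel(1)] measure_innov[OF bins_borel(2)] P_bin_minus[OF j]
    by (simp add: algebra_simps)
  finally show ?thesis .
qed

lemma root_N_expectation_bin_sign_tendsto:
  assumes "j \<in> {1..m}"
  shows "(\<lambda>k. root_N k * (\<integral>e. bin_sign j e \<partial>innov k)) \<longlonglongrightarrow> \<rho>\<^sub>0 * asymmetry j"
  unfolding expectation_bin_sign[OF assms] mult.assoc[symmetric] by (intro tendsto_mult mix_rate_scaled tendsto_const)

lemma measure_bins_innov_tendsto:
  assumes "j \<in> {1..m}"
  shows "(\<lambda>k. measure (innov k) (bin_plus x m j) + measure (innov k) (bin_minus x m j)) \<longlonglongrightarrow> 2 * cell_prob j"
proof -
  have "(\<lambda>k. ((1 - mix_rate k) * cell_prob j + mix_rate k * measure Q (bin_plus x m j))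
      + ((1 - mix_rate k) * cell_prob j + mix_rate k * measure Q (bin_minus x m j)))
    \<longlonglongrightarrow> ((1 - 0) * cell_prob j + 0 * measure Q (bin_plus x m j))
      + ((1 - 0) * cell_prob j + 0 * measure Q (bin_minus x m j))"
    by (intro tendsto_intros mix_rate_tendsto_0)
  then show ?thesis by (simp add: measure_innov P_bin_minus[OF assms])
qed

definition sign_comb :: "(nat \<Rightarrow> real) \<Rightarrow> real \<Rightarrow> real" where
  "sign_comb \<theta> e = (\<Sum>j=1..m. \<theta> j * bin_sign j e)"

lemma sign_comb_measurable[measurable]: "sign_comb \<theta> \<in> borel_measurable borel"
  unfolding sign_comb_def[abs_def] by measurable

lemma abs_sign_comb_le: "\<bar>sign_comb \<theta> e\<bar> \<le> (\<Sum>j=1..m. \<bar>\<theta> j\<bar>)"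
  unfolding sign_comb_def using abs_bin_sign_le_1
  by (intro order_trans[OF sum_abs] sum_mono) (auto simp: abs_mult intro: mult_left_le)

lemma char_sign_sum_eq_power:
  "(\<integral>\<omega>. iexp (\<Sum>j=1..m. \<theta> j * sign_sum k j \<omega>) \<partial>M k) = (\<integral>e. iexp (sign_comb \<theta> e / root_N k) \<partial>innov k) ^ N k"
proof -
  interpret contam_noise "M k" "innov k" GE "contam_rate k" "eps k" "z k" "xi k" by (rule contam_noise_M)
  have "(\<Sum>j=1..m. \<theta> j * sign_sum k j \<omega>) = (\<Sum>t=1..int (N k). sign_comb \<theta> (eps k t \<omega>) / root_N k)" for \<omega>
    unfolding sign_comb_def sign_sum_def sum_divide_distrib
    by (subst sum.swap) (simp add: sum_distrib_left sum_divide_distrib)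
  then have "iexp (\<Sum>j=1..m. \<theta> j * sign_sum k j \<omega>)
      = (\<Prod>t\<in>{1..int (N k)}. iexp (sign_comb \<theta> (eps k t \<omega>) / root_N k))" for \<omega>
    by (simp only: iexp_sum[OF finite_atLeastAtMost_int])
  then show ?thesis
    using expectation_prod_eps[of "\<lambda>e. iexp (sign_comb \<theta> e / root_N k)" "{1..int (N k)}"] by simp
qed

lemma root_N_expectation_sign_comb_tendsto:
  "(\<lambda>k. root_N k * (\<integral>e. sign_comb \<theta> e \<partial>innov k)) \<longlonglongrightarrow> (\<Sum>j=1..m. \<theta> j * (\<rho>\<^sub>0 * asymmetry j))"
proof -
  interpret innov: real_distribution "innov k" for k by (rule real_distributions)
  have "integrable (innov k) (bin_sign j)" for j k
    by (rule innov.bounded_integrable[where c=1]) (simp_all add: abs_bin_sign_le_1)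
  then have "root_N k * (\<integral>e. sign_comb \<theta> e \<partial>innov k)
      = (\<Sum>j=1..m. \<theta> j * (root_N k * (\<integral>e. bin_sign j e \<partial>innov k)))" for k
    unfolding sign_comb_def by (simp add: sum_distrib_left mult_ac)
  then show ?thesis
    by (simp only:) (intro tendsto_sum tendsto_mult tendsto_const root_N_expectation_bin_sign_tendsto)
qed

lemma sign_comb_second_moment_tendsto:
  "(\<lambda>k. \<integral>e. (sign_comb \<theta> e)\<^sup>2 \<partial>innov k) \<longlonglongrightarrow> (\<Sum>j=1..m. (\<theta> j)\<^sup>2 * (2 * cell_prob j))"
proof -
  interpret innov: real_distribution "innov k" for k by (rule real_distributions)
  have "integrable (innov k) (\<lambda>e. indicator A e :: real)" if "A \<in> sets borel" for A k
    by (rule innov.bounded_integrable[where c=1]) (use that in auto)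
  from this[OF bins_borel(1)] this[OF bins_borel(2)]
  have "(\<integral>e. (sign_comb \<theta> e)\<^sup>2 \<partial>innov k)
      = (\<Sum>j=1..m. (\<theta> j)\<^sup>2 * (measure (innov k) (bin_plus x m j) + measure (innov k) (bin_minus x m j)))" for k
    unfolding sign_comb_def bin_sign_combination_square by simp
  then show ?thesis
    by (simp only:) (intro tendsto_sum tendsto_mult tendsto_const measure_bins_innov_tendsto)
qed

lemma char_sign_sum_tendsto:
  "(\<lambda>k. \<integral>\<omega>. iexp (\<Sum>j=1..m. \<theta> j * sign_sum k j \<omega>) \<partial>M k)
    \<longlonglongrightarrow> exp (\<i> * (\<Sum>j=1..m. \<theta> j * (\<rho>\<^sub>0 * asymmetry j)) - (\<Sum>j=1..m. (\<theta> j)\<^sup>2 * (2 * cell_prob j)) / 2)"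
proof -
  interpret innov: real_distribution "innov k" for k by (rule real_distributions)
  show ?thesis
    unfolding char_sign_sum_eq_power
    using bounded_iid_char_limit[OF innov.prob_space_axioms _ abs_sign_comb_le N N_ge_1
        root_N_expectation_sign_comb_tendsto sign_comb_second_moment_tendsto] by simp
qed

definition std_sum :: "nat \<Rightarrow> nat \<Rightarrow> 'a \<Rightarrow> real" where
  "std_sum k j \<omega> = (sign_sum k j \<omega> + \<gamma>\<^sub>0 * \<delta> j) / sqrt (2 * cell_prob j)"

definition std_mean :: "nat \<Rightarrow> real" where
  "std_mean j = (\<rho>\<^sub>0 * asymmetry j + \<gamma>\<^sub>0 * \<delta> j) / sqrt (2 * cell_prob j)"

lemma std_sum_measurable[measurable]: "std_sum k j \<in> borel_measurable (M k)"
  unfolding std_sum_def[abs_def] by measurable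

lemma sum_std_mean_square: "(\<Sum>j=1..m. (std_mean j)\<^sup>2) = noncentrality p m \<beta> x P Q GE \<gamma>\<^sub>0 \<rho>\<^sub>0"
  unfolding noncentrality_def using cell_prob_pos
  by (intro sum.cong refl) (simp add: std_mean_def power_divide less_imp_le)

lemma char_std_sum_tendsto:
  "(\<lambda>k. \<integral>\<omega>. iexp (\<Sum>j=1..m. \<theta> j * std_sum k j \<omega>) \<partial>M k)
    \<longlonglongrightarrow> exp (complex_of_real (- (\<Sum>j=1..m. (\<theta> j)\<^sup>2) / 2) + \<i> * complex_of_real (\<Sum>j=1..m. \<theta> j * std_mean j))"
proof -
  define \<theta>' where "\<theta>' j = \<theta> j / sqrt (2 * cell_prob j)" for j
  define a where "a = (\<Sum>j=1..m. \<theta>' j * (\<gamma>\<^sub>0 * \<delta> j))"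
  define b where "b = (\<Sum>j=1..m. \<theta>' j * (\<rho>\<^sub>0 * asymmetry j))"
  have "(\<Sum>j=1..m. \<theta> j * std_sum k j \<omega>) = a + (\<Sum>j=1..m. \<theta>' j * sign_sum k j \<omega>)" for k \<omega>
    unfolding a_def sum.distrib[symmetric]
    by (intro sum.cong refl) (simp add: std_sum_def \<theta>'_def add_divide_distrib distrib_left)
  then have "(\<integral>\<omega>. iexp (\<Sum>j=1..m. \<theta> j * std_sum k j \<omega>) \<partial>M k)
      = iexp a * (\<integral>\<omega>. iexp (\<Sum>j=1..m. \<theta>' j * sign_sum k j \<omega>) \<partial>M k)" for k
    by (simp add: distrib_left exp_add)
  moreover have "(\<lambda>k. iexp a * (\<integral>\<omega>. iexp (\<Sum>j=1..m. \<theta>' j * sign_sum k j \<omega>) \<partial>M k))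
      \<longlonglongrightarrow> iexp a * exp (\<i> * b - (\<Sum>j=1..m. (\<theta>' j)\<^sup>2 * (2 * cell_prob j)) / 2)"
    unfolding b_def by (intro tendsto_mult tendsto_const char_sign_sum_tendsto)
  moreover have "(\<Sum>j=1..m. (\<theta>' j)\<^sup>2 * (2 * cell_prob j)) = (\<Sum>j=1..m. (\<theta> j)\<^sup>2)"
    using cell_prob_pos by (intro sum.cong refl) (simp add: \<theta>'_def power_divide less_imp_le less_imp_neq[symmetric])
  moreover have "(\<Sum>j=1..m. \<theta> j * std_mean j) = a + b"
    unfolding a_def b_def sum.distrib[symmetric]
    by (intro sum.cong refl) (simp add: std_mean_def \<theta>'_def add_divide_distrib distrib_left)
  moreover have "iexp a * exp (\<i> * b - s / 2)
      = exp (complex_of_real (- s / 2) + \<i> * complex_of_real (a + b))" for s :: real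
    unfolding exp_add[symmetric] by (simp add: distrib_left add_diff_eq)
  ultimately show ?thesis by (simp only:)
qed

lemma laplace_std_sum_tendsto:
  assumes a_nonneg: "a \<ge> 0"
  shows "(\<lambda>k. \<integral>\<omega>. exp (- (a * (\<Sum>j=1..m. (std_sum k j \<omega>)\<^sup>2))) \<partial>M k)
    \<longlonglongrightarrow> exp (- (a * noncentrality p m \<beta> x P Q GE \<gamma>\<^sub>0 \<rho>\<^sub>0 / (1 + 2 * a))) / sqrt (1 + 2 * a) ^ m"
proof -
  have "(\<lambda>k. \<integral>\<omega>. exp (- (a * (\<Sum>j=1..m. (std_sum k j \<omega>)\<^sup>2))) \<partial>M k)
    \<longlonglongrightarrow> (\<integral>v. exp (- (a * (\<Sum>j=1..m. (v j + std_mean j)\<^sup>2))) \<partial>std_normal_vector {1..m})"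
  proof (rule char_conv_imp_laplace_square_norm_conv[OF prob_space_M prob_space_std_normal_vector _ a_nonneg])
    show "(\<lambda>k. \<integral>\<omega>. iexp (\<Sum>j=1..m. \<theta> j * std_sum k j \<omega>) \<partial>M k)
      \<longlonglongrightarrow> (\<integral>v. iexp (\<Sum>j=1..m. \<theta> j * (v j + std_mean j)) \<partial>std_normal_vector {1..m})" for \<theta>
      unfolding char_shifted_std_normal_vector[OF finite_atLeastAtMost] by (rule char_std_sum_tendsto)
  qed auto
  then show ?thesis
    unfolding laplace_shifted_square_norm_std_normal[OF finite_atLeastAtMost a_nonneg] sum_std_mean_square by simp
qed

definition resid_count :: "nat \<Rightarrow> real \<Rightarrow> 'a \<Rightarrow> real" where
  "resid_count k y \<omega> = (\<Sum>t=1..int (N k). below (resid k t \<omega>) y)"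

definition plus_count :: "nat \<Rightarrow> nat \<Rightarrow> 'a \<Rightarrow> real" where
  "plus_count k j \<omega> = real (card {t\<in>{1..int (N k)}. resid k t \<omega> \<in> bin_plus x m j})"

definition minus_count :: "nat \<Rightarrow> nat \<Rightarrow> 'a \<Rightarrow> real" where
  "minus_count k j \<omega> = real (card {t\<in>{1..int (N k)}. resid k t \<omega> \<in> bin_minus x m j})"

definition count_diff :: "nat \<Rightarrow> nat \<Rightarrow> 'a \<Rightarrow> real" where
  "count_diff k j \<omega> = (plus_count k j \<omega> - minus_count k j \<omega>) / root_N k"

lemma counts_eq_incr:
  assumes "j \<in> {1..m}"
  shows "plus_count k j \<omega> = plus_incr x m (real (N k)) (\<lambda>y. resid_count k y \<omega>) j"
    "minus_count k j \<omega> = minus_incr x m (\<lambda>y. resid_count k y \<omega>) j"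
  using card_bins[of "{1..int (N k)}" j "\<lambda>t. resid k t \<omega>"] assms
  by (simp_all add: plus_count_def minus_count_def resid_count_def)

lemma sum_bin_sign_eq_incr:
  assumes j: "j \<in> {1..m}"
  shows "(\<Sum>t=1..int (N k). bin_sign j (eps k t \<omega>))
    = plus_incr x m (real (N k)) (\<lambda>y. \<Sum>t=1..int (N k). below (eps k t \<omega>) y) j
      - minus_incr x m (\<lambda>y. \<Sum>t=1..int (N k). below (eps k t \<omega>) y) j"
  using plus_incr_sum[of x m "\<lambda>_. 1" "{1..int (N k)}" "\<lambda>t. below (eps k t \<omega>)" j]
  by (simp add: bin_sign_eq_incr[OF j] sum_subtractf minus_incr_sum)

lemma oprob_count_diff:
  assumes j: "j \<in> {1..m}"
  shows "oprob M (\<lambda>k \<omega>. count_diff k j \<omega> - (sign_sum k j \<omega> + \<gamma>\<^sub>0 * \<delta> j))"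
proof -
  have "oprob M (\<lambda>k \<omega>. plus_incr x m 0 (\<lambda>y. count_shift y k \<omega>) j - minus_incr x m (\<lambda>y. count_shift y k \<omega>) j)"
    by (intro oprob_diff oprob_plus_incr oprob_minus_incr oprob_count_shift)
  moreover have "count_diff k j \<omega> - (sign_sum k j \<omega> + \<gamma>\<^sub>0 * \<delta> j)
      = plus_incr x m 0 (\<lambda>y. count_shift y k \<omega>) j - minus_incr x m (\<lambda>y. count_shift y k \<omega>) j" for k \<omega>
    unfolding count_diff_def counts_eq_incr[OF j] sign_sum_def sum_bin_sign_eq_incr[OF j] delta_j_eq_incr
      count_shift_def resid_count_def sum_subtractf plus_incr_def minus_incr_def
    by (simp add: diff_divide_distrib add_divide_distrib algebra_simps)
  ultimately show ?thesis by simp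
qed

lemma oprob_centered_eps_mean:
  assumes h: "h \<in> borel_measurable borel" "\<And>e. \<bar>h e\<bar> \<le> 1"
  shows "oprob M (\<lambda>k \<omega>. (\<Sum>t=1..int (N k). h (eps k t \<omega>) - (\<integral>e. h e \<partial>innov k)) / real (N k))"
proof (rule oprob_of_L1_bound)
  show "L1_bound (M k) (\<lambda>\<omega>. (\<Sum>t=1..int (N k). h (eps k t \<omega>) - (\<integral>e. h e \<partial>innov k)) / real (N k)) (1 / root_N k)" for k
  proof -
    interpret contam_noise "M k" "innov k" GE "contam_rate k" "eps k" "z k" "xi k" by (rule contam_noise_M)
    have "sqrt (real (N k)) / real (N k) = 1 / root_N k"
      using N_ge_1[of k] sqrt_divide_self_eq[of "real (N k)"] by (simp add: inverse_eq_divide)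
    then show ?thesis
      using L1_bound_divide[OF L1_bound_centered_eps_sum[OF h, of "N k"], of "real (N k)"] N_ge_1[of k] by simp
  qed
qed (rule divide_root_N_tendsto_0)

lemma oprob_resid_count:
  "oprob M (\<lambda>k \<omega>. resid_count k y \<omega> / real (N k) - cdf P y)"
proof -
  define ecdf_err where "ecdf_err k \<omega> = (\<Sum>t=1..int (N k). below (eps k t \<omega>) y - cdf (innov k) y) / real (N k)" for k \<omega>
  have ecdf_err: "oprob M ecdf_err"
  proof -
    have "(\<integral>e. below e y \<partial>innov k) = cdf (innov k) y" for k
      by (rule real_distribution.expectation_below[OF real_distributions(4)])
    then show ?thesis
      using oprob_centered_eps_mean[of "\<lambda>e. below e y"] by (simp add: ecdf_err_def[abs_def])
  qed
  have "oprob M (\<lambda>k \<omega>. (count_shift y k \<omega> + \<gamma>\<^sub>0 * Delta p \<beta> P GE y) * (1 / root_N k) + ecdf_err k \<omega>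
      + (cdf (innov k) y - cdf P y))"
    by (intro oprob_add oprob_mult Oprob_add oprob_imp_Oprob[OF oprob_count_shift] Oprob_const ecdf_err
        oprob_tendsto_0[OF divide_root_N_tendsto_0] oprob_tendsto_0[OF LIM_zero[OF cdf_innov_tendsto]])
  moreover have "resid_count k y \<omega> / real (N k) - cdf P y
      = (count_shift y k \<omega> + \<gamma>\<^sub>0 * Delta p \<beta> P GE y) * (1 / root_N k) + ecdf_err k \<omega>
        + (cdf (innov k) y - cdf P y)" for k \<omega>
    unfolding count_shift_def ecdf_err_def resid_count_def sum_subtractf using N_ge_1[of k]
    by (simp add: diff_divide_distrib)
  ultimately show ?thesis by (simp only:)
qed

lemma oprob_plus_count:
  assumes j: "j \<in> {1..m}"
  shows "oprob M (\<lambda>k \<omega>. plus_count k j \<omega> / real (N k) - cell_prob j)"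
proof -
  have "plus_count k j \<omega> / real (N k) - cell_prob j
      = plus_incr x m 0 (\<lambda>y. resid_count k y \<omega> / real (N k) - cdf P y) j" for k \<omega>
    unfolding counts_eq_incr[OF j] measure_bins[OF real_distributions(1) j] plus_incr_def using N_ge_1[of k]
    by (simp add: diff_divide_distrib)
  then show ?thesis using oprob_plus_incr[OF oprob_resid_count] by simp
qed

lemma Oprob_sign_sum:
  assumes j: "j \<in> {1..m}"
  shows "Oprob M (\<lambda>k \<omega>. sign_sum k j \<omega>)"
proof -
  define centered where "centered k \<omega>
    = (\<Sum>t=1..int (N k). bin_sign j (eps k t \<omega>) - (\<integral>e. bin_sign j e \<partial>innov k)) / root_N k" for k \<omega>
  have "L1_bound (M k) (centered k) 1" for k
  proof -
    interpret contam_noise "M k" "innov k" GE "contam_rate k" "eps k" "z k" "xi k" by (rule contam_noise_M)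
    show ?thesis
      using L1_bound_divide[OF L1_bound_centered_eps_sum[OF bin_sign_measurable abs_bin_sign_le_1]
          root_N_pos, of j "N k" k]
        N_ge_1[of k] by (simp add: centered_def[abs_def])
  qed
  then have "Oprob M (\<lambda>k \<omega>. centered k \<omega> + (root_N k * (\<integral>e. bin_sign j e \<partial>innov k) - \<rho>\<^sub>0 * asymmetry j)
      + \<rho>\<^sub>0 * asymmetry j)"
    by (intro Oprob_add Oprob_const Oprob_of_L1_bound
        oprob_imp_Oprob[OF oprob_tendsto_0[OF LIM_zero[OF root_N_expectation_bin_sign_tendsto[OF j]]]])
  moreover have "centered k \<omega> + (root_N k * (\<integral>e. bin_sign j e \<partial>innov k) - \<rho>\<^sub>0 * asymmetry j) + \<rho>\<^sub>0 * asymmetry j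
      = sign_sum k j \<omega>" for k \<omega>
    unfolding centered_def sign_sum_def sum_subtractf
    by (simp add: diff_divide_distrib real_div_sqrt flip: times_divide_eq_left)
  ultimately show ?thesis by simp
qed

abbreviation "stat k \<omega> \<equiv> chi2_stat p m x (N k) (bh k \<omega>) (observed k \<omega>)"

lemma stat_eq: "stat k \<omega> = (\<Sum>j=1..m. (plus_count k j \<omega> - minus_count k j \<omega>)\<^sup>2 / (2 * plus_count k j \<omega>))"
  by (simp add: chi2_stat_def plus_count_def minus_count_def resid_def Let_def)

lemma stat_nonneg: "0 \<le> stat k \<omega>"
  unfolding stat_eq plus_count_def by (intro sum_nonneg divide_nonneg_nonneg) auto

lemma stat_measurable[measurable]: "(\<lambda>\<omega>. stat k \<omega>) \<in> borel_measurable (M k)"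
proof -
  interpret contam_noise "M k" "innov k" GE "contam_rate k" "eps k" "z k" "xi k" by (rule contam_noise_M)
  note [measurable] = bh_measurable
  have [measurable]: "u k t \<in> borel_measurable (M k)" for t
    using model[of k] by (simp add: AR_contam_model_def)
  have [measurable]: "resid k t \<in> borel_measurable (M k)" for t
    unfolding resid_def[abs_def] residual_def yobs_def by measurable
  have [measurable]: "resid_count k y \<in> borel_measurable (M k)" for y
    unfolding resid_count_def[abs_def] by measurable
  have [measurable]: "plus_count k j \<in> borel_measurable (M k)" "minus_count k j \<in> borel_measurable (M k)"
    if "j \<in> {1..m}" for j
    unfolding counts_eq_incr[OF that, abs_def] plus_incr_def minus_incr_def by measurable
  show ?thesis unfolding stat_eq by measurable
qed

lemma oprob_stat: "oprob M (\<lambda>k \<omega>. stat k \<omega> - (\<Sum>j=1..m. (std_sum k j \<omega>)\<^sup>2))"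
proof -
  have "oprob M (\<lambda>k \<omega>. (plus_count k j \<omega> - minus_count k j \<omega>)\<^sup>2 / (2 * plus_count k j \<omega>) - (std_sum k j \<omega>)\<^sup>2)"
    if j: "j \<in> {1..m}" for j
  proof -
    let ?T = "\<lambda>k \<omega>. count_diff k j \<omega>" and ?S = "\<lambda>k \<omega>. sign_sum k j \<omega> + \<gamma>\<^sub>0 * \<delta> j"
      and ?r = "\<lambda>k \<omega>. 1 / (2 * (plus_count k j \<omega> / real (N k)))"
    have S: "Oprob M ?S" by (intro Oprob_add Oprob_sign_sum[OF j] Oprob_const)
    have T: "Oprob M ?T"
      using Oprob_add[OF S oprob_imp_Oprob[OF oprob_count_diff[OF j]]] by simp
    have r: "oprob M (\<lambda>k \<omega>. ?r k \<omega> - 1 / (2 * cell_prob j))"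
      using cell_prob_pos[OF j]
      by (intro oprob_continuous_map[OF oprob_plus_count[OF j], of "\<lambda>y. 1 / (2 * y)"])
        (auto intro!: continuous_intros)
    have "(plus_count k j \<omega> - minus_count k j \<omega>)\<^sup>2 / (2 * plus_count k j \<omega>) - (std_sum k j \<omega>)\<^sup>2
      = ?T k \<omega> * ?T k \<omega> * (?r k \<omega> - 1 / (2 * cell_prob j))
        + 1 / (2 * cell_prob j) * (?T k \<omega> + ?S k \<omega>) * (?T k \<omega> - ?S k \<omega>)" for k \<omega>
    proof -
      have "(plus_count k j \<omega> - minus_count k j \<omega>)\<^sup>2 / (2 * plus_count k j \<omega>) = ?T k \<omega> * ?T k \<omega> * ?r k \<omega>"
        using N_ge_1[of k] by (simp add: count_diff_def power2_eq_square)
      moreover have "(std_sum k j \<omega>)\<^sup>2 = ?S k \<omega> * ?S k \<omega> * (1 / (2 * cell_prob j))"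
        using cell_prob_pos[OF j] by (simp add: std_sum_def power_divide power2_eq_square)
      ultimately show ?thesis by (simp only:) (simp only: algebra_simps)
    qed
    then show ?thesis
      by (simp only:) (intro oprob_add oprob_mult Oprob_mult Oprob_add Oprob_const T S r oprob_count_diff[OF j])
  qed
  from oprob_sum[of "{1..m}", OF this] show ?thesis unfolding stat_eq by (simp add: sum_subtractf)
qed

lemma laplace_stat_tendsto:
  assumes a_nonneg: "a \<ge> 0"
  shows "(\<lambda>k. \<integral>\<omega>. exp (- (a * stat k \<omega>)) \<partial>M k)
    \<longlonglongrightarrow> exp (- (a * noncentrality p m \<beta> x P Q GE \<gamma>\<^sub>0 \<rho>\<^sub>0 / (1 + 2 * a))) / sqrt (1 + 2 * a) ^ m"
proof -
  have lipschitz: "a-lipschitz_on {0..} (\<lambda>y. exp (- (a * y)))"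
  proof (rule bounded_derivative_imp_lipschitz)
    show "((\<lambda>y. exp (- (a * y))) has_derivative (\<lambda>h. - (a * exp (- (a * y))) * h)) (at y within {0..})" for y
      by (auto intro!: derivative_eq_intros)
    show "onorm (\<lambda>h. - (a * exp (- (a * y))) * h) \<le> a" if "y \<in> {0..}" for y
      using that a_nonneg by (intro onorm_le) (auto simp: abs_mult mult_right_mono mult_left_le)
  qed (use a_nonneg in auto)
  have "(\<lambda>k. (\<integral>\<omega>. exp (- (a * stat k \<omega>)) \<partial>M k) - (\<integral>\<omega>. exp (- (a * (\<Sum>j=1..m. (std_sum k j \<omega>)\<^sup>2))) \<partial>M k)) \<longlonglongrightarrow> 0"
    by (rule oprob_imp_expectation_lipschitz_diff[OF prob_space_M _ _ _ _ _ _ lipschitz oprob_stat, of 1])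
      (use a_nonneg stat_nonneg in \<open>auto intro!: sum_nonneg\<close>)
  from tendsto_add[OF this laplace_std_sum_tendsto[OF a_nonneg]] show ?thesis by simp
qed

lemma noncentrality_nonneg: "0 \<le> noncentrality p m \<beta> x P Q GE c r"
  unfolding noncentrality_def by (intro sum_nonneg divide_nonneg_nonneg) auto

theorem stat_cdf_uniform_limit:
  "uniform_limit UNIV (\<lambda>k y. measure (M k) {\<omega> \<in> space (M k). stat k \<omega> \<le> y}
    - ncchisq_cdf m (noncentrality p m \<beta> x P Q GE (\<gamma> k) (\<rho> k)) y) (\<lambda>_. 0) sequentially"
proof -
  have "(\<lambda>k. noncentrality p m \<beta> x P Q GE (\<gamma> k) (\<rho> k)) \<longlonglongrightarrow> noncentrality p m \<beta> x P Q GE \<gamma>\<^sub>0 \<rho>\<^sub>0"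
    unfolding noncentrality_def using cell_prob_pos by (intro tendsto_intros \<gamma> \<rho>) fastforce
  from ncchisq_cdf_uniform_limit[OF m noncentrality_nonneg noncentrality_nonneg this]
  have "uniform_limit UNIV (\<lambda>k. ncchisq_cdf m (noncentrality p m \<beta> x P Q GE (\<gamma> k) (\<rho> k)))
      (ncchisq_cdf m (noncentrality p m \<beta> x P Q GE \<gamma>\<^sub>0 \<rho>\<^sub>0)) sequentially" .
  from uniform_limit_minus[OF laplace_imp_uniform_limit_ncchisq_cdf[OF prob_space_M stat_measurable stat_nonneg m
        noncentrality_nonneg laplace_stat_tendsto] this]
  show ?thesis by simp
qed

end

section \<open>Uniformity in the parameters\<close>

lemma uniformly_eventually_on_bounded:
  fixes A :: "'a::heine_borel set" and R :: "nat \<Rightarrow> 'a \<Rightarrow> bool"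
  assumes A: "bounded A"
    and seq: "\<And>N :: nat \<Rightarrow> nat. \<And>a l. filterlim N at_top sequentially \<Longrightarrow> (\<And>k. N k \<ge> 1) \<Longrightarrow> (\<And>k. a k \<in> A) \<Longrightarrow> a \<longlonglongrightarrow> l
      \<Longrightarrow> \<forall>\<^sub>F k in sequentially. R (N k) (a k)"
  shows "\<exists>n\<^sub>0. \<forall>n\<ge>n\<^sub>0. \<forall>a\<in>A. R n a"
proof (rule ccontr)
  assume "\<not> ?thesis"
  then have "\<forall>k. \<exists>n a. n \<ge> Suc k \<and> a \<in> A \<and> \<not> R n a" by blast
  then obtain n a where n: "\<And>k. n k \<ge> Suc k" and a: "\<And>k. a k \<in> A" and not_R: "\<And>k. \<not> R (n k) (a k)"
    by metis
  have "bounded (range a)" using A a by (auto intro: bounded_subset)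
  then obtain l s where s: "strict_mono s" and l: "(a \<circ> s) \<longlonglongrightarrow> l"
    using bounded_imp_convergent_subsequence by blast
  have "k \<le> n (s k)" for k using n[of "s k"] seq_suble[OF s, of k] by linarith
  then have "filterlim (n \<circ> s) at_top sequentially"
    by (intro filterlim_at_top_mono[OF filterlim_ident]) simp
  then have "\<forall>\<^sub>F k in sequentially. R ((n \<circ> s) k) ((a \<circ> s) k)"
    by (rule seq[OF _ _ _ l]) (use n a in \<open>auto intro: order_trans[OF _ n]\<close>)
  then show False using not_R by (auto simp: eventually_sequentially)
qed

locale AR_family = bins x m
  for x :: "nat \<Rightarrow> real" and m :: nat +
  fixes p :: nat and \<beta> :: "nat \<Rightarrow> real" and P Q GE :: "real measure" and contam_levels mix_levels :: "real set"
    and M :: "nat \<Rightarrow> real \<Rightarrow> real \<Rightarrow> 'a measure"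
    and eps z xi u :: "nat \<Rightarrow> real \<Rightarrow> real \<Rightarrow> int \<Rightarrow> 'a \<Rightarrow> real"
    and est :: "nat \<Rightarrow> (int \<Rightarrow> real) \<Rightarrow> nat \<Rightarrow> real"
  assumes causal: "causal_coeffs p \<beta>"
    and distrs: "is_real_distr P" "is_real_distr Q" "is_real_distr GE"
    and P_symmetric: "symmetric_distr P"
    and moments: "zero_mean_finite_var P" "zero_mean_finite_var Q"
    and twice_diff: "twice_diff_bounded P" "twice_diff_bounded Q"
    and cell_prob_pos: "\<And>j. j \<in> {1..m} \<Longrightarrow> 0 < measure P (bin_plus x m j)"
    and est_measurable: "\<And>n i. (\<lambda>v. est n v i) \<in> borel_measurable (PiM {1 - int p..int n} (\<lambda>_. borel))"
    and bounded_levels: "bounded contam_levels" "bounded mix_levels"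
    and levels_nonneg: "\<And>\<gamma>. \<gamma> \<in> contam_levels \<Longrightarrow> 0 \<le> \<gamma>" "\<And>\<rho>. \<rho> \<in> mix_levels \<Longrightarrow> 0 \<le> \<rho>"
    and model: "\<And>n \<gamma> \<rho>. \<gamma> \<in> contam_levels \<Longrightarrow> \<rho> \<in> mix_levels \<Longrightarrow>
        AR_contam_model p \<beta> (mix_distr (rate \<rho> n) P Q) GE (rate \<gamma> n) (M n \<gamma> \<rho>)
          (eps n \<gamma> \<rho>) (z n \<gamma> \<rho>) (xi n \<gamma> \<rho>) (u n \<gamma> \<rho>)"
    and tight: "\<And>e. e > 0 \<Longrightarrow> \<exists>C n\<^sub>0. \<forall>n\<ge>n\<^sub>0. \<forall>\<gamma>\<in>contam_levels. \<forall>\<rho>\<in>mix_levels.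
        measure (M n \<gamma> \<rho>) {\<omega>\<in>space (M n \<gamma> \<rho>). sqrt (real n) * sqrt (\<Sum>i=1..p.
          (est_of p n est (\<lambda>t. yobs (u n \<gamma> \<rho>) (z n \<gamma> \<rho>) (xi n \<gamma> \<rho>) t \<omega>) i - \<beta> i)\<^sup>2) > C} < e"
begin

abbreviation "observed n \<gamma> \<rho> \<omega> \<equiv> \<lambda>t. yobs (u n \<gamma> \<rho>) (z n \<gamma> \<rho>) (xi n \<gamma> \<rho>) t \<omega>"

lemma estimate_measurable:
  assumes "\<gamma> \<in> contam_levels" "\<rho> \<in> mix_levels"
  shows "(\<lambda>\<omega>. est_of p n est (observed n \<gamma> \<rho> \<omega>) i) \<in> borel_measurable (M n \<gamma> \<rho>)"
proof -
  interpret contam_noise "M n \<gamma> \<rho>" "mix_distr (rate \<rho> n) P Q" GE "rate \<gamma> n" "eps n \<gamma> \<rho>" "z n \<gamma> \<rho>" "xi n \<gamma> \<rho>"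
    by (rule AR_contam_model_imp_contam_noise[OF model[OF assms]])
  have [measurable]: "u n \<gamma> \<rho> t \<in> borel_measurable (M n \<gamma> \<rho>)" for t
    using model[OF assms] by (simp add: AR_contam_model_def)
  have "(\<lambda>\<omega>. restrict (observed n \<gamma> \<rho> \<omega>) {1 - int p..int n})
      \<in> measurable (M n \<gamma> \<rho>) (PiM {1 - int p..int n} (\<lambda>_. borel))"
    unfolding yobs_def by (intro measurable_restrict) measurable
  from measurable_compose[OF this est_measurable] show ?thesis unfolding est_of_def .
qed

lemma Oprob_estimate:
  assumes N: "filterlim N at_top sequentially"
    and levels: "\<And>k. \<gamma> k \<in> contam_levels" "\<And>k. \<rho> k \<in> mix_levels"
  shows "Oprob (\<lambda>k. M (N k) (\<gamma> k) (\<rho> k)) (\<lambda>k \<omega>. sqrt (real (N k)) *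
    sqrt (\<Sum>i=1..p. (est_of p (N k) est (observed (N k) (\<gamma> k) (\<rho> k) \<omega>) i - \<beta> i)\<^sup>2))"
    (is "Oprob ?M ?X")
  unfolding Oprob_def
proof (intro allI impI)
  fix e :: real assume "e > 0"
  from tight[OF this] obtain C n\<^sub>0 where C: "\<And>n \<gamma> \<rho>. n \<ge> n\<^sub>0 \<Longrightarrow> \<gamma> \<in> contam_levels \<Longrightarrow> \<rho> \<in> mix_levels \<Longrightarrow>
      measure (M n \<gamma> \<rho>) {\<omega>\<in>space (M n \<gamma> \<rho>). sqrt (real n) *
        sqrt (\<Sum>i=1..p. (est_of p n est (observed n \<gamma> \<rho> \<omega>) i - \<beta> i)\<^sup>2) > C} < e"
    by blast
  note [measurable] = estimate_measurable[OF levels]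
  have "\<forall>\<^sub>F k in sequentially. n\<^sub>0 \<le> N k" using N by (simp add: filterlim_at_top)
  then have "mostly_le ?M ?X C e"
    unfolding mostly_le_def
  proof eventually_elim
    case (elim k)
    have "{\<omega> \<in> space (?M k). ?X k \<omega> > C} \<in> sets (?M k)" by measurable
    moreover have "0 \<le> ?X k \<omega>" for \<omega> by (simp add: sum_nonneg)
    ultimately show ?case
      using C[OF elim levels] by (intro bexI[of _ "{\<omega> \<in> space (?M k). ?X k \<omega> > C}"]) auto
  qed
  then show "\<exists>C. mostly_le ?M ?X C e" ..
qed

lemma AR_seq_of_convergent_levels:
  assumes N: "filterlim N at_top sequentially" "\<And>k. N k \<ge> 1"
    and levels: "\<And>k. \<gamma> k \<in> contam_levels" "\<And>k. \<rho> k \<in> mix_levels"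
    and lim: "\<gamma> \<longlonglongrightarrow> \<gamma>\<^sub>0" "\<rho> \<longlonglongrightarrow> \<rho>\<^sub>0"
  shows "AR_seq x m p \<beta> P Q GE N \<gamma> \<rho> \<gamma>\<^sub>0 \<rho>\<^sub>0 (\<lambda>k. M (N k) (\<gamma> k) (\<rho> k)) (\<lambda>k. eps (N k) (\<gamma> k) (\<rho> k))
    (\<lambda>k. z (N k) (\<gamma> k) (\<rho> k)) (\<lambda>k. xi (N k) (\<gamma> k) (\<rho> k)) (\<lambda>k. u (N k) (\<gamma> k) (\<rho> k))
    (\<lambda>k \<omega>. est_of p (N k) est (observed (N k) (\<gamma> k) (\<rho> k) \<omega>))"
  by (intro AR_seq.intro bins_axioms AR_seq_axioms.intro causal distrs P_symmetric moments twice_diff cell_prob_pos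
      N lim
      levels_nonneg levels model estimate_measurable Oprob_estimate)

theorem chi2_stat_uniform_limit:
  assumes e_pos: "e > 0"
  shows "\<exists>n\<^sub>0. \<forall>n\<ge>n\<^sub>0. \<forall>y. \<forall>\<gamma>\<in>contam_levels. \<forall>\<rho>\<in>mix_levels.
    \<bar>measure (M n \<gamma> \<rho>) {\<omega>\<in>space (M n \<gamma> \<rho>).
        chi2_stat p m x n (est_of p n est (observed n \<gamma> \<rho> \<omega>)) (observed n \<gamma> \<rho> \<omega>) \<le> y}
      - ncchisq_cdf m (noncentrality p m \<beta> x P Q GE \<gamma> \<rho>) y\<bar> < e"
proof -
  let ?R = "\<lambda>n (\<gamma>, \<rho>). \<forall>y. \<bar>measure (M n \<gamma> \<rho>) {\<omega>\<in>space (M n \<gamma> \<rho>).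
      chi2_stat p m x n (est_of p n est (observed n \<gamma> \<rho> \<omega>)) (observed n \<gamma> \<rho> \<omega>) \<le> y}
      - ncchisq_cdf m (noncentrality p m \<beta> x P Q GE \<gamma> \<rho>) y\<bar> < e"
  have "\<exists>n\<^sub>0. \<forall>n\<ge>n\<^sub>0. \<forall>a\<in>contam_levels \<times> mix_levels. ?R n a"
  proof (rule uniformly_eventually_on_bounded[OF bounded_Times[OF bounded_levels]])
    fix N :: "nat \<Rightarrow> nat" and a :: "nat \<Rightarrow> real \<times> real" and l
    assume N: "filterlim N at_top sequentially" "\<And>k. N k \<ge> 1"
      and levels: "\<And>k. a k \<in> contam_levels \<times> mix_levels" and lim: "a \<longlonglongrightarrow> l"
    have "fst (a k) \<in> contam_levels" "snd (a k) \<in> mix_levels" for k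
      using levels[of k] by (auto simp: mem_Times_iff)
    from AR_seq.stat_cdf_uniform_limit[OF AR_seq_of_convergent_levels[OF N this
          tendsto_fst[OF lim] tendsto_snd[OF lim]]] e_pos
    show "\<forall>\<^sub>F k in sequentially. ?R (N k) (a k)"
      by (auto simp: uniform_limit_iff dist_real_def case_prod_beta)
  qed
  then show ?thesis by (simp add: Ball_def) blast
qed

end

lemma noncentrality_no_mixture:
  "noncentrality p m \<beta> x P Q GE \<gamma> 0
    = \<gamma>\<^sup>2 * (\<Sum>j=1..m. (delta_j p \<beta> P GE x m j)\<^sup>2 / (2 * measure P (bin_plus x m j)))"
  by (simp add: noncentrality_def power_mult_distrib sum_distrib_left)

theorem theorem3p1:
  fixes p m :: nat and \<beta> x :: "nat \<Rightarrow> real"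
    and P Q GE :: "real measure" and R \<Gamma> :: real
    and M :: "nat \<Rightarrow> real \<Rightarrow> real \<Rightarrow> 'a measure"
    and eps z xi u :: "nat \<Rightarrow> real \<Rightarrow> real \<Rightarrow> int \<Rightarrow> 'a \<Rightarrow> real"
    and est :: "nat \<Rightarrow> (int \<Rightarrow> real) \<Rightarrow> nat \<Rightarrow> real"
  assumes beta: "causal_coeffs p \<beta>"
    and m: "m \<ge> 1"
    and x0: "x 0 = 0"
    and xmono: "\<forall>j. j + 1 < m \<longrightarrow> x j < x (j + 1)"
    and Pdistr: "is_real_distr P"
    and Pi_distr: "is_real_distr GE"
    and pplus: "\<forall>j\<in>{1..m}. measure P (bin_plus x m j) > 0"
    and est_meas: "\<forall>n i. (\<lambda>v. est n v i) \<in> borel_measurable (PiM {1 - int p..int n} (\<lambda>_. borel))"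
    and R: "R \<ge> 0" and \<Gamma>: "\<Gamma> \<ge> 0"
  shows
   "(symmetric_distr P \<and> zero_mean_finite_var P \<and> twice_diff_bounded P \<and>
     (\<forall>n \<gamma>. \<gamma> \<ge> 0 \<longrightarrow>
        AR_contam_model p \<beta> P GE (rate \<gamma> n) (M n \<gamma> 0)
          (eps n \<gamma> 0) (z n \<gamma> 0) (xi n \<gamma> 0) (u n \<gamma> 0)) \<and>
     (\<forall>\<Gamma>'\<ge>0. \<forall>e>0. \<exists>C N. \<forall>n\<ge>N. \<forall>\<gamma>\<in>{0..\<Gamma>'}.
        measure (M n \<gamma> 0) {\<omega>\<in>space (M n \<gamma> 0).
          sqrt (real n) * sqrt (\<Sum>i=1..p.
            (est_of p n est (\<lambda>t. yobs (u n \<gamma> 0) (z n \<gamma> 0) (xi n \<gamma> 0) t \<omega>) i - \<beta> i)\<^sup>2) > C} < e)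
    \<longrightarrow>
     (\<forall>e>0. \<exists>N. \<forall>n\<ge>N. \<forall>y. \<forall>\<gamma>\<in>{0..\<Gamma>}.
        \<bar>measure (M n \<gamma> 0) {\<omega>\<in>space (M n \<gamma> 0).
            chi2_stat p m x n
              (est_of p n est (\<lambda>t. yobs (u n \<gamma> 0) (z n \<gamma> 0) (xi n \<gamma> 0) t \<omega>))
              (\<lambda>t. yobs (u n \<gamma> 0) (z n \<gamma> 0) (xi n \<gamma> 0) t \<omega>) \<le> y}
         - ncchisq_cdf m (\<gamma>\<^sup>2 * (\<Sum>j=1..m. (delta_j p \<beta> P GE x m j)\<^sup>2 / (2 * measure P (bin_plus x m j)))) y\<bar>
        < e))
  \<and>
   (symmetric_distr P \<and> is_real_distr Q \<and> \<not> symmetric_distr Q \<and>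
     zero_mean_finite_var P \<and> zero_mean_finite_var Q \<and>
     twice_diff_bounded P \<and> twice_diff_bounded Q \<and>
     (\<forall>n \<gamma> \<rho>. \<gamma> \<ge> 0 \<longrightarrow> \<rho> > 0 \<longrightarrow>
        AR_contam_model p \<beta> (mix_distr (rate \<rho> n) P Q) GE (rate \<gamma> n) (M n \<gamma> \<rho>)
          (eps n \<gamma> \<rho>) (z n \<gamma> \<rho>) (xi n \<gamma> \<rho>) (u n \<gamma> \<rho>)) \<and>
     (\<forall>R'\<ge>0. \<forall>\<Gamma>'\<ge>0. \<forall>e>0. \<exists>C N. \<forall>n\<ge>N. \<forall>\<gamma>\<in>{0..\<Gamma>'}. \<forall>\<rho>\<in>{0<..R'}.
        measure (M n \<gamma> \<rho>) {\<omega>\<in>space (M n \<gamma> \<rho>).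
          sqrt (real n) * sqrt (\<Sum>i=1..p.
            (est_of p n est (\<lambda>t. yobs (u n \<gamma> \<rho>) (z n \<gamma> \<rho>) (xi n \<gamma> \<rho>) t \<omega>) i - \<beta> i)\<^sup>2) > C} < e)
    \<longrightarrow>
     (\<forall>e>0. \<exists>N. \<forall>n\<ge>N. \<forall>y. \<forall>\<gamma>\<in>{0..\<Gamma>}. \<forall>\<rho>\<in>{0<..R}.
        \<bar>measure (M n \<gamma> \<rho>) {\<omega>\<in>space (M n \<gamma> \<rho>).
            chi2_stat p m x n
              (est_of p n est (\<lambda>t. yobs (u n \<gamma> \<rho>) (z n \<gamma> \<rho>) (xi n \<gamma> \<rho>) t \<omega>))
              (\<lambda>t. yobs (u n \<gamma> \<rho>) (z n \<gamma> \<rho>) (xi n \<gamma> \<rho>) t \<omega>) \<le> y}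
         - ncchisq_cdf m (\<Sum>j=1..m.
              (\<rho> * (measure Q (bin_plus x m j) - measure Q (bin_minus x m j))
               + \<gamma> * delta_j p \<beta> P GE x m j)\<^sup>2 / (2 * measure P (bin_plus x m j))) y\<bar>
        < e))"
proof (intro conjI impI, goal_cases symmetric alternative)
  case symmetric
  then have "AR_family x m p \<beta> P P GE {0..\<Gamma>} {0} M eps z xi u est"
    using assms by unfold_locales (auto simp: mix_distr_0 rate_def)
  from AR_family.chi2_stat_uniform_limit[OF this] show ?case
    by (simp add: noncentrality_no_mixture)
next
  case alternative
  have "bounded {0<..R}"
    by (rule bounded_subset[of "{0..R}"]) auto
  with alternative have "AR_family x m p \<beta> P Q GE {0..\<Gamma>} {0<..R} M eps z xi u est"
    using assms by unfold_locales auto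
  from AR_family.chi2_stat_uniform_limit[OF this] show ?case
    by (simp add: noncentrality_def)
qed

end
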